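(* Let $(X,Y)$ be an O2BP with parameters $\alpha,\beta,\gamma,\delta$ and correlation $\rho$, and let $\tau^{\mathbf 0}:=\inf\{t>0:(X_t,Y_t)=(0,0)\}$ (with $\inf\emptyset=\infty$). Then $\mathbb P(\tau^{\mathbf 0}<\infty)=0$ if one of the following conditions holds: $C_1$: $\beta\geq 0$, $\gamma\geq 0$ and $-1\leq\rho\leq\alpha+\delta$; $C_{2a}$: $\alpha\geq\frac12$ and $\beta\geq 0$; $C_{2b}$: $\delta\geq\frac12$ and $\gamma\geq 0$; $C_3$: there exist $\lambda>0$ and $\mu>0$ such that $\lambda\alpha+\mu\gamma\geq 0$, $\lambda\beta+\mu\delta\geq 0$ and \[\Big(\sqrt{\lambda(\lambda\alpha+\mu\gamma)}+\sqrt{\mu(\lambda\beta+\mu\delta)}\Big)^2\geq\tfrac12(\lambda^2+\mu^2+2\rho\lambda\mu).\]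
   Context: Let $(\Omega,\mathcal F,(\mathcal F_t)_{t\geq0},\mathbb P)$ be a complete filtered probability space satisfying the usual conditions, and $(B,C)$ an $(\mathcal F_t)$-adapted planar Brownian motion started at $0$ with $\langle B\rangle_t=\langle C\rangle_t=t$ and $\langle B,C\rangle_t=\rho t$, where $\rho\in[-1,1]$. Let $\alpha>0$, $\delta>0$, $\beta,\gamma\in\mathbb R$, $S=[0,\infty)^2$. An Oblique Two-dimensional Bessel Process (O2BP), also called a solution to the system (O), is an $(\mathcal F_t)$-adapted continuous process $(X,Y)$ with values in $S$ such that for all $t\geq0$ \[X_t=X_0+B_t+\alpha\int_0^t\frac{ds}{X_s}+\beta\int_0^t\frac{ds}{Y_s},\qquad Y_t=Y_0+C_t+\gamma\int_0^t\frac{ds}{X_s}+\delta\int_0^t\frac{ds}{Y_s},\] where $X_0,Y_0$ are nonnegative $\mathcal F_0$-measurable random variables, and for all $t\geq 0$: $\int_0^t\mathbf 1_{\{X_s=0\}}ds=\int_0^t\mathbf 1_{\{Y_s=0\}}ds=0$, $\int_0^t\mathbf 1_{\{X_s>0\}}\frac{ds}{X_s}<\infty$, $\int_0^t\mathbf 1_{\{Y_s>0\}}\frac{ds}{Y_s}<\infty$. *)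

theory Defs
  imports "HOL-Probability.Probability"
begin

definition filtration_usual :: "'a measure \<Rightarrow> (real \<Rightarrow> 'a measure) \<Rightarrow> bool" where
  "filtration_usual M F \<longleftrightarrow>
     (\<forall>t\<ge>0. space (F t) = space M \<and> sets (F t) \<subseteq> sets M) \<and>
     (\<forall>s t. 0 \<le> s \<longrightarrow> s \<le> t \<longrightarrow> sets (F s) \<subseteq> sets (F t)) \<and>
     (\<forall>N\<in>null_sets M. \<forall>A. A \<subseteq> N \<longrightarrow> A \<in> sets (F 0)) \<and>
     (\<forall>t\<ge>0. sets (F t) = (\<Inter>s\<in>{t<..}. sets (F s)))"

definition adapted :: "(real \<Rightarrow> 'a measure) \<Rightarrow> (real \<Rightarrow> 'a \<Rightarrow> real) \<Rightarrow> bool" where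
  "adapted F X \<longleftrightarrow> (\<forall>t\<ge>0. X t \<in> borel_measurable (F t))"

text \<open>(B,C) is an (F_t)-Brownian motion in the plane started at 0 with
  <B>_t = <C>_t = t and <B,C>_t = rho t, i.e. continuous paths, and for s < t the increment
  (B_t - B_s, C_t - C_s) is independent of F_s and centred Gaussian with covariance
  (t - s) [[1, rho], [rho, 1]]. Independence plus the law of the increment are expressed jointly
  through the (conditional) characteristic function.\<close>
definition corr_brownian :: "'a measure \<Rightarrow> (real \<Rightarrow> 'a measure) \<Rightarrow> real \<Rightarrow>
    (real \<Rightarrow> 'a \<Rightarrow> real) \<Rightarrow> (real \<Rightarrow> 'a \<Rightarrow> real) \<Rightarrow> bool" where
  "corr_brownian M F \<rho> B C \<longleftrightarrow>
     adapted F B \<and> adapted F C \<and>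
     (AE \<omega> in M. B 0 \<omega> = 0 \<and> C 0 \<omega> = 0 \<and>
        continuous_on {0..} (\<lambda>t. B t \<omega>) \<and> continuous_on {0..} (\<lambda>t. C t \<omega>)) \<and>
     (\<forall>s t u v A. 0 \<le> s \<longrightarrow> s < t \<longrightarrow> A \<in> sets (F s) \<longrightarrow>
        (\<integral>\<omega>. indicator A \<omega> * cos (u * (B t \<omega> - B s \<omega>) + v * (C t \<omega> - C s \<omega>)) \<partial>M)
          = measure M A * exp (- (t - s) / 2 * (u\<^sup>2 + 2 * \<rho> * u * v + v\<^sup>2)) \<and>
        (\<integral>\<omega>. indicator A \<omega> * sin (u * (B t \<omega> - B s \<omega>) + v * (C t \<omega> - C s \<omega>)) \<partial>M) = 0)"

definition O2BP :: "'a measure \<Rightarrow> (real \<Rightarrow> 'a measure) \<Rightarrow> real \<Rightarrow> real \<Rightarrow> real \<Rightarrow> real \<Rightarrow>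
    (real \<Rightarrow> 'a \<Rightarrow> real) \<Rightarrow> (real \<Rightarrow> 'a \<Rightarrow> real) \<Rightarrow>
    (real \<Rightarrow> 'a \<Rightarrow> real) \<Rightarrow> (real \<Rightarrow> 'a \<Rightarrow> real) \<Rightarrow> bool" where
  "O2BP M F \<alpha> \<beta> \<gamma> \<delta> B C X Y \<longleftrightarrow>
     adapted F X \<and> adapted F Y \<and>
     (AE \<omega> in M.
        continuous_on {0..} (\<lambda>t. X t \<omega>) \<and> continuous_on {0..} (\<lambda>t. Y t \<omega>) \<and>
        (\<forall>t\<ge>0. X t \<omega> \<ge> 0 \<and> Y t \<omega> \<ge> 0 \<and>
           emeasure lborel {s\<in>{0..t}. X s \<omega> = 0} = 0 \<and>
           emeasure lborel {s\<in>{0..t}. Y s \<omega> = 0} = 0 \<and>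
           set_integrable lborel {0..t} (\<lambda>s. 1 / X s \<omega>) \<and>
           set_integrable lborel {0..t} (\<lambda>s. 1 / Y s \<omega>) \<and>
           X t \<omega> = X 0 \<omega> + B t \<omega> + \<alpha> * (LINT s:{0..t}|lborel. 1 / X s \<omega>)
                     + \<beta> * (LINT s:{0..t}|lborel. 1 / Y s \<omega>) \<and>
           Y t \<omega> = Y 0 \<omega> + C t \<omega> + \<gamma> * (LINT s:{0..t}|lborel. 1 / X s \<omega>)
                     + \<delta> * (LINT s:{0..t}|lborel. 1 / Y s \<omega>)))"

definition corner_time :: "(real \<Rightarrow> 'a \<Rightarrow> real) \<Rightarrow> (real \<Rightarrow> 'a \<Rightarrow> real) \<Rightarrow> 'a \<Rightarrow> ereal" where
  "corner_time X Y \<omega> = Inf {ereal t |t. t > 0 \<and> X t \<omega> = 0 \<and> Y t \<omega> = 0}"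

end

theory Submission
  imports Defs
begin

text \<open>
  Write V = X c1 + Y c2 for suitable vectors c1, c2, where V = (X, Y) under C1 and
  V = la X + mu Y otherwise. In each case the drift of V dominates that of a planar Bessel
  process, so -ln |V| is formally a supermartingale. To avoid localisation, use
  f = (1/2) ln ((|V|^2 + 1 + eps) / (|V|^2 + eps)), which is bounded, nonnegative and has bounded
  derivatives on the whole plane, and whose generator is at most a constant theta that does not
  depend on eps. Hence f(V_t) - theta t is a bounded supermartingale. Its maximal inequality bounds
  the probability of reaching the corner, where f equals (1/2) ln (1 + 1/eps), by a multiple of
  1 / ln (1/eps).

  Ito's formula is replaced by a partition argument. Each increment of f(V) splits into a Gaussian
  part, computed by Taylor expansion and conditional moments, and a drift part, estimated path by
  path. The drift is not known to be integrable, but the drift sums are bounded in L2, because the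
  Gaussian sums are and f is bounded. So a pathwise upper bound passes to expectations.
\<close>

section \<open>Gaussian increments\<close>

text \<open>Put n = |V|^2, let P be the drift rate of n and tau a quarter of the rate of its
  quadratic variation. The comparison with a planar Bessel process means P >= 2 theta and tau <=
  theta n, as for a squared Bessel process of dimension 2 run at speed theta. The drift has no upper
  bound near the axes, so a logarithm with a plus sign cannot be controlled alone. In the difference
  of the two logarithms P is multiplied by the nonpositive factor 1/(n + 1 + eps) - 1/(n + eps), so
  a lower bound for P is enough. The second logarithm keeps f bounded and nonnegative, and it alone
  produces the constant theta. Two features of the process shape the rest. Paths may touch the axes,
  where the drift is singular, so the generator inequality is available only at almost every time
  and must be integrated along the path. The process may also start in the corner, where f is large
  for small eps. The argument therefore starts at a later time s, on the event that |V_s|^2 is at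
  least a positive constant, which is why the supermartingale estimates carry an event of the
  past.\<close>

lemma (in prob_space) std_normal_moments_on_event:
  fixes Z :: "'a \<Rightarrow> real"
  assumes Z[measurable]: "Z \<in> borel_measurable M" and A[measurable]: "A \<in> sets M"
    and cos: "\<And>u. expectation (\<lambda>\<omega>. indicator A \<omega> * cos (u * Z \<omega>)) = prob A * exp (- u\<^sup>2 / 2)"
    and sin: "\<And>u. expectation (\<lambda>\<omega>. indicator A \<omega> * sin (u * Z \<omega>)) = 0"
  shows "integrable M (\<lambda>\<omega>. indicator A \<omega> * Z \<omega> ^ k)"
    and "expectation (\<lambda>\<omega>. indicator A \<omega> * Z \<omega> ^ k)
      = prob A * (LINT x|std_normal_distribution. x ^ k)"
proof -
  have "integrable M (\<lambda>\<omega>. indicator A \<omega> * Z \<omega> ^ k) \<and>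
    expectation (\<lambda>\<omega>. indicator A \<omega> * Z \<omega> ^ k) = prob A * (LINT x|std_normal_distribution. x ^ k)"
  proof (cases "prob A = 0")
    case True
    then have "AE \<omega> in M. \<omega> \<notin> A"
      by (simp add: prob_eq_0)
    then have ae: "AE \<omega> in M. indicator A \<omega> * Z \<omega> ^ k = 0"
      by eventually_elim auto
    have "integrable M (\<lambda>\<omega>. indicator A \<omega> * Z \<omega> ^ k)"
      by (subst integrable_cong_AE[OF _ _ ae]) auto
    moreover have "expectation (\<lambda>\<omega>. indicator A \<omega> * Z \<omega> ^ k) = 0"
      by (subst integral_cong_AE[OF _ _ ae]) auto
    ultimately show ?thesis
      using True by simp
  next
    case False
    then have pos: "prob A > 0"
      by (simp add: zero_less_measure_iff)
    define p where "p = (\<lambda>\<omega>. indicator A \<omega> / prob A)"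
    \<comment> \<open>Under this measure, the probability conditioned on \<open>A\<close>, the
      cosine and sine hypotheses give \<open>Z\<close> the characteristic function of a standard
      normal variable. Levy's uniqueness theorem then identifies its law, and every moment comes
      with it.\<close>
    define N where "N = density M (\<lambda>\<omega>. ennreal (p \<omega>))"
    have p[measurable]: "p \<in> borel_measurable M"
      unfolding p_def by measurable
    have p0: "p \<omega> \<ge> 0" for \<omega>
      by (simp add: p_def)
    have intp: "integrable M p"
      unfolding p_def by (simp add: less_top[symmetric])
    have "(\<integral>\<omega>. p \<omega> \<partial>M) = 1"
      unfolding p_def using False by simp
    then have "emeasure N (space N) = 1"
      unfolding N_def by (simp add: emeasure_density nn_integral_eq_integral intp p0)
    then interpret N: prob_space N
      by (rule prob_spaceI)
    have sN[measurable_cong]: "sets N = sets M"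
      by (simp add: N_def)
    have Zn[measurable]: "Z \<in> borel_measurable N"
      by measurable
    have int_N: "(\<integral>\<omega>. f \<omega> \<partial>N) = expectation (\<lambda>\<omega>. indicator A \<omega> * f \<omega>) / prob A"
      if [measurable]: "f \<in> borel_measurable M" for f :: "'a \<Rightarrow> real"
      unfolding N_def by (subst integral_density) (auto simp: p0 p_def)
    interpret D: real_distribution "distr N borel Z"
      by (auto simp: real_distribution_def real_distribution_axioms_def intro!: N.prob_space_distr)
    have char: "char (distr N borel Z) u = char std_normal_distribution u" for u
    proof -
      have "char (distr N borel Z) u = (CLINT \<omega>|N. iexp (u * Z \<omega>))"
        unfolding char_def by (subst integral_distr) auto
      also have "\<dots> = complex_of_real (LINT \<omega>|N. cos (u * Z \<omega>)) + \<i> * complex_of_real (LINT \<omega>|N. sin (u * Z \<omega>))"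
      proof -
        have "integrable N (\<lambda>\<omega>. cos (u * Z \<omega>))" "integrable N (\<lambda>\<omega>. sin (u * Z \<omega>))"
          by (auto intro!: N.integrable_const_bound[where B=1])
        then show ?thesis
          unfolding exp_Euler cos_of_real sin_of_real of_real_mult[symmetric]
          by (simp del: of_real_mult)
      qed
      also have "\<dots> = exp (- u\<^sup>2 / 2)"
        by (simp add: int_N cos sin False)
      finally show ?thesis
        by (simp add: char_std_normal_distribution)
    qed
    then have eq: "distr N borel Z = std_normal_distribution"
      by (intro Levy_uniqueness D.real_distribution_axioms real_dist_normal_dist ext)
    have "integrable N (\<lambda>\<omega>. Z \<omega> ^ k)"
      using integrable_std_normal_distribution_moment[of k]
      unfolding eq[symmetric] by (subst (asm) integrable_distr_eq) auto
    then have "integrable M (\<lambda>\<omega>. p \<omega> * Z \<omega> ^ k)"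
      unfolding N_def by (subst (asm) integrable_density) (auto simp: p0)
    then have "integrable M (\<lambda>\<omega>. prob A * (p \<omega> * Z \<omega> ^ k))"
      by (rule integrable_mult_right)
    then have "integrable M (\<lambda>\<omega>. indicator A \<omega> * Z \<omega> ^ k)"
      using False by (simp add: p_def)
    moreover have "(LINT x|std_normal_distribution. x ^ k) = (LINT \<omega>|N. Z \<omega> ^ k)"
      unfolding eq[symmetric] by (subst integral_distr) auto
    then have "(LINT x|std_normal_distribution. x ^ k) = expectation (\<lambda>\<omega>. indicator A \<omega> * Z \<omega> ^ k) / prob A"
      by (subst (asm) int_N) auto
    ultimately show ?thesis
      using False by simp
  qed
  then show "integrable M (\<lambda>\<omega>. indicator A \<omega> * Z \<omega> ^ k)"
    and "expectation (\<lambda>\<omega>. indicator A \<omega> * Z \<omega> ^ k)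
      = prob A * (LINT x|std_normal_distribution. x ^ k)"
    by auto
qed

text \<open>The hypothesis on events identifies the conditional expectation of \<open>Z\<close>
  given \<open>F\<close> as the constant \<open>\<kappa>\<close>, and the factor \<open>G\<close> is
  pulled out. \<open>G\<close> is not assumed bounded, only the product integrable; this is needed
  for the cross terms of discrete stochastic integrals.\<close>

lemma (in prob_space) expectation_mult_of_const_on_events:
  fixes G Z :: "'a \<Rightarrow> real"
  assumes sub: "subalgebra M F" and Z: "integrable M Z"
    and const: "\<And>A. A \<in> sets F \<Longrightarrow> expectation (\<lambda>\<omega>. indicator A \<omega> * Z \<omega>) = \<kappa> * prob A"
    and G[measurable]: "G \<in> borel_measurable F"
    and GZ: "integrable M (\<lambda>\<omega>. G \<omega> * Z \<omega>)"
  shows "expectation (\<lambda>\<omega>. G \<omega> * Z \<omega>) = \<kappa> * expectation G"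
proof -
  interpret finite_measure_subalgebra M F
    using sub by unfold_locales
  have AM: "A \<in> sets M" if "A \<in> sets F" for A
    using that sub by (auto simp: subalgebra_def)
  have "AE \<omega> in M. real_cond_exp M F Z \<omega> = \<kappa>"
  proof (rule real_cond_exp_charact)
    show "(\<integral>x\<in>A. Z x \<partial>M) = (\<integral>x\<in>A. \<kappa> \<partial>M)" if "A \<in> sets F" for A
      using const[OF that] AM[OF that]
      by (simp add: set_lebesgue_integral_def mult.commute sets.Int_space_eq2)
  qed (use Z in auto)
  moreover have GM[measurable]: "G \<in> borel_measurable M"
    using G sub measurable_from_subalg by blast
  moreover have [measurable]: "Z \<in> borel_measurable M"
    using Z by auto
  ultimately have "expectation (\<lambda>\<omega>. G \<omega> * real_cond_exp M F Z \<omega>) = expectation (\<lambda>\<omega>. G \<omega> * \<kappa>)"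
    by (intro integral_cong_AE) auto
  moreover have "expectation (\<lambda>\<omega>. G \<omega> * real_cond_exp M F Z \<omega>) = expectation (\<lambda>\<omega>. G \<omega> * Z \<omega>)"
    by (rule real_cond_exp_intg(2)) (use GZ in auto)
  ultimately show ?thesis
    by simp
qed


lemma std_normal_moments:
  "(LINT x|std_normal_distribution. x ^ Suc 0) = 0"
  "(LINT x|std_normal_distribution. x ^ 2) = 1"
  "(LINT x|std_normal_distribution. x ^ 4) = 3"
  using integral_std_normal_distribution_moment_odd[of "Suc 0"]
    std_normal_distribution_even_moments(1)[of 1] std_normal_distribution_even_moments(1)[of 2]
  by (simp_all add: fact_numeral)

locale brownian_pair = prob_space M for M :: "'a measure" +
  fixes F :: "real \<Rightarrow> 'a measure" and \<rho> :: real and B C :: "real \<Rightarrow> 'a \<Rightarrow> real"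
  assumes filtration: "filtration_usual M F"
    and brownian: "corr_brownian M F \<rho> B C"
    and rho: "-1 \<le> \<rho>" "\<rho> \<le> 1"
begin

lemma subalgebra_filtration: "0 \<le> t \<Longrightarrow> subalgebra M (F t)"
  using filtration[unfolded filtration_usual_def, THEN conjunct1] by (simp add: subalgebra_def)

lemma measurable_filtration_mono:
  assumes "0 \<le> s" "s \<le> t" "f \<in> borel_measurable (F s)"
  shows "f \<in> borel_measurable (F t)"
proof -
  have "subalgebra (F t) (F s)"
    using filtration[unfolded filtration_usual_def, THEN conjunct1]
      filtration[unfolded filtration_usual_def, THEN conjunct2, THEN conjunct1] assms(1,2)
    by (simp add: subalgebra_def)
  then show ?thesis
    using assms(3) by (rule measurable_from_subalg)
qed

lemma measurable_filtration_M:
  assumes "0 \<le> s" "f \<in> borel_measurable (F s)"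
  shows "f \<in> borel_measurable M"
  using subalgebra_filtration[OF assms(1)] assms(2) by (rule measurable_from_subalg)

lemma filtration_event: "0 \<le> s \<Longrightarrow> A \<in> sets (F s) \<Longrightarrow> A \<in> events"
  using subalgebra_filtration by (auto simp: subalgebra_def)

lemma
  assumes "0 \<le> t"
  shows measurable_B: "B t \<in> borel_measurable (F t)" and measurable_C: "C t \<in> borel_measurable (F t)"
  using brownian assms by (auto simp: corr_brownian_def adapted_def)

text \<open>Division by the standard deviation turns the combination into the situation of
  \<open>std_normal_moments_on_event\<close>. Positivity of the quadratic form excludes combinations
  that degenerate, such as B + C when rho = -1.\<close>

lemma
  assumes st: "0 \<le> s" "s < t" and q: "u\<^sup>2 + 2 * \<rho> * u * v + v\<^sup>2 > 0"
  shows integrable_incr_power: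
      "integrable M (\<lambda>\<omega>. (u * (B t \<omega> - B s \<omega>) + v * (C t \<omega> - C s \<omega>)) ^ k)"
    and expectation_incr_power: "A \<in> sets (F s) \<Longrightarrow>
      expectation (\<lambda>\<omega>. indicator A \<omega> * (u * (B t \<omega> - B s \<omega>) + v * (C t \<omega> - C s \<omega>)) ^ k)
       = prob A * (sqrt ((t - s) * (u\<^sup>2 + 2 * \<rho> * u * v + v\<^sup>2)) ^ k * (LINT x|std_normal_distribution. x ^ k))"
proof -
  define r where "r = sqrt ((t - s) * (u\<^sup>2 + 2 * \<rho> * u * v + v\<^sup>2))"
  define D where "D = (\<lambda>\<omega>. u * (B t \<omega> - B s \<omega>) + v * (C t \<omega> - C s \<omega>))"
  have r: "r > 0"
    using st q by (simp add: r_def)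
  have r2: "r\<^sup>2 = (t - s) * (u\<^sup>2 + 2 * \<rho> * u * v + v\<^sup>2)"
    using st q by (simp add: r_def)
  have [measurable]: "B t \<in> borel_measurable M" "B s \<in> borel_measurable M"
    "C t \<in> borel_measurable M" "C s \<in> borel_measurable M"
    using st by (auto intro!: measurable_filtration_M[OF _ measurable_B] measurable_filtration_M[OF _ measurable_C])
  have D[measurable]: "D \<in> borel_measurable M"
    unfolding D_def by measurable
  have *: "integrable M (\<lambda>\<omega>. indicator A \<omega> * D \<omega> ^ k) \<and>
    expectation (\<lambda>\<omega>. indicator A \<omega> * D \<omega> ^ k) = prob A * (r ^ k * (LINT x|std_normal_distribution. x ^ k))"
    if A: "A \<in> sets (F s)" for A
  proof -
    have AM[measurable]: "A \<in> events"
      using filtration_event st A by auto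
    have arg: "w * (D \<omega> / r) = w / r * u * (B t \<omega> - B s \<omega>) + w / r * v * (C t \<omega> - C s \<omega>)" for w \<omega>
      by (simp add: D_def algebra_simps add_divide_distrib diff_divide_distrib)
    have ex0: "- (t - s) / 2 * ((z * u)\<^sup>2 + 2 * \<rho> * (z * u) * (z * v) + (z * v)\<^sup>2)
      = - z\<^sup>2 / 2 * ((t - s) * (u\<^sup>2 + 2 * \<rho> * u * v + v\<^sup>2))" for z
    proof -
      have "(z * u)\<^sup>2 + 2 * \<rho> * (z * u) * (z * v) + (z * v)\<^sup>2 = z\<^sup>2 * (u\<^sup>2 + 2 * \<rho> * u * v + v\<^sup>2)"
        by (simp add: power2_eq_square algebra_simps)
      moreover have "- (t - s) / 2 * (Z * q) = - Z / 2 * ((t - s) * q)" for Z q :: real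
        by (simp add: field_simps)
      ultimately show ?thesis
        by metis
    qed
    have ex: "- (t - s) / 2 * ((w / r * u)\<^sup>2 + 2 * \<rho> * (w / r * u) * (w / r * v) + (w / r * v)\<^sup>2) = - w\<^sup>2 / 2" for w
    proof -
      have "- (t - s) / 2 * ((w / r * u)\<^sup>2 + 2 * \<rho> * (w / r * u) * (w / r * v) + (w / r * v)\<^sup>2)
        = - (w / r)\<^sup>2 / 2 * ((t - s) * (u\<^sup>2 + 2 * \<rho> * u * v + v\<^sup>2))"
        by (rule ex0)
      also have "\<dots> = - (w\<^sup>2 / r\<^sup>2) / 2 * r\<^sup>2"
        unfolding r2[symmetric] by (simp add: power_divide)
      also have "\<dots> = - w\<^sup>2 / 2"
        using r by simp
      finally show ?thesis .
    qed
    note char = brownian[unfolded corr_brownian_def, THEN conjunct2, THEN conjunct2, THEN conjunct2,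
        rule_format, OF st A]
    have c: "expectation (\<lambda>\<omega>. indicator A \<omega> * cos (w * (D \<omega> / r))) = prob A * exp (- w\<^sup>2 / 2)" for w
      unfolding arg using char[of "w / r * u" "w / r * v"] unfolding ex by simp
    have s: "expectation (\<lambda>\<omega>. indicator A \<omega> * sin (w * (D \<omega> / r))) = 0" for w
      unfolding arg using char[of "w / r * u" "w / r * v"] by simp
    have "integrable M (\<lambda>\<omega>. indicator A \<omega> * (D \<omega> / r) ^ k)"
      "expectation (\<lambda>\<omega>. indicator A \<omega> * (D \<omega> / r) ^ k) = prob A * (LINT x|std_normal_distribution. x ^ k)"
      by (rule std_normal_moments_on_event[OF _ AM c s]; simp)+
    note this(1)[THEN integrable_mult_right, of "r ^ k"] arg_cong[OF this(2), of "(*) (r ^ k)"]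
    then show ?thesis
      using r by (simp add: power_divide ac_simps)
  qed
  then show "A \<in> sets (F s) \<Longrightarrow>
      expectation (\<lambda>\<omega>. indicator A \<omega> * (u * (B t \<omega> - B s \<omega>) + v * (C t \<omega> - C s \<omega>)) ^ k)
       = prob A * (sqrt ((t - s) * (u\<^sup>2 + 2 * \<rho> * u * v + v\<^sup>2)) ^ k * (LINT x|std_normal_distribution. x ^ k))"
    unfolding D_def r_def by simp
  have "space M \<in> sets (F s)"
    using subalgebra_filtration[OF st(1)] by (metis sets.top subalgebra_def)
  from *[OF this] have "integrable M (\<lambda>\<omega>. indicator (space M) \<omega> * D \<omega> ^ k)"
    by simp
  then show "integrable M (\<lambda>\<omega>. (u * (B t \<omega> - B s \<omega>) + v * (C t \<omega> - C s \<omega>)) ^ k)"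
    unfolding D_def by (subst Bochner_Integration.integrable_cong[OF refl, of _ _ "\<lambda>\<omega>. indicator (space M) \<omega> * (u * (B t \<omega> - B s \<omega>) + v * (C t \<omega> - C s \<omega>)) ^ k"]) auto
qed

lemma space_in_filtration: "0 \<le> s \<Longrightarrow> space M \<in> sets (F s)"
  using subalgebra_filtration by (metis sets.top subalgebra_def)

lemma
  assumes "0 \<le> s" "s < t"
  shows integrable_incr_B: "integrable M (\<lambda>\<omega>. (B t \<omega> - B s \<omega>) ^ k)"
    and integrable_incr_C: "integrable M (\<lambda>\<omega>. (C t \<omega> - C s \<omega>) ^ k)"
  using integrable_incr_power[OF assms, of 1 0 k] integrable_incr_power[OF assms, of 0 1 k] by simp_all

lemma
  assumes st: "0 \<le> s" "s < t" and A: "A \<in> sets (F s)"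
  shows expectation_incr_B: "expectation (\<lambda>\<omega>. indicator A \<omega> * (B t \<omega> - B s \<omega>)) = 0"
    and expectation_incr_C: "expectation (\<lambda>\<omega>. indicator A \<omega> * (C t \<omega> - C s \<omega>)) = 0"
    and expectation_incr_B_square: "expectation (\<lambda>\<omega>. indicator A \<omega> * (B t \<omega> - B s \<omega>)\<^sup>2) = (t - s) * prob A"
    and expectation_incr_C_square: "expectation (\<lambda>\<omega>. indicator A \<omega> * (C t \<omega> - C s \<omega>)\<^sup>2) = (t - s) * prob A"
  using expectation_incr_power[OF st _ A, of 1 0 "Suc 0"] expectation_incr_power[OF st _ A, of 0 1 "Suc 0"]
    expectation_incr_power[OF st _ A, of 1 0 2] expectation_incr_power[OF st _ A, of 0 1 2] st
  by (simp_all add: std_normal_moments[simplified])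

lemma
  assumes st: "0 \<le> s" "s < t"
  shows expectation_incr_B_four: "expectation (\<lambda>\<omega>. (B t \<omega> - B s \<omega>) ^ 4) = 3 * (t - s)\<^sup>2"
    and expectation_incr_C_four: "expectation (\<lambda>\<omega>. (C t \<omega> - C s \<omega>) ^ 4) = 3 * (t - s)\<^sup>2"
proof -
  have ind: "expectation (\<lambda>\<omega>. indicator (space M) \<omega> * f \<omega>) = expectation f" for f :: "'a \<Rightarrow> real"
    by (rule Bochner_Integration.integral_cong) auto
  have s4: "sqrt (t - s) ^ 4 = (t - s)\<^sup>2"
    using st by (simp add: power4_eq_xxxx power2_eq_square)
  show "expectation (\<lambda>\<omega>. (B t \<omega> - B s \<omega>) ^ 4) = 3 * (t - s)\<^sup>2"
    "expectation (\<lambda>\<omega>. (C t \<omega> - C s \<omega>) ^ 4) = 3 * (t - s)\<^sup>2"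
    using expectation_incr_power[OF st _ space_in_filtration[OF st(1)], of 1 0 4]
      expectation_incr_power[OF st _ space_in_filtration[OF st(1)], of 0 1 4]
    by (simp_all add: std_normal_moments ind s4 prob_space)
qed

lemma
  assumes st: "0 \<le> s" "s < t"
  shows integrable_incr_BC: "integrable M (\<lambda>\<omega>. (B t \<omega> - B s \<omega>) * (C t \<omega> - C s \<omega>))"
    and expectation_incr_BC: "A \<in> sets (F s) \<Longrightarrow>
      expectation (\<lambda>\<omega>. indicator A \<omega> * ((B t \<omega> - B s \<omega>) * (C t \<omega> - C s \<omega>))) = \<rho> * (t - s) * prob A"
proof -
  \<comment> \<open>Polarise with B + C, or with B - C when B + C is degenerate.\<close>
  define e :: real where "e = (if \<rho> = -1 then -1 else 1)"
  have e: "e\<^sup>2 = 1" "e * e = 1" "e \<noteq> 0"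
    by (auto simp: e_def)
  have q: "1\<^sup>2 + 2 * \<rho> * 1 * e + e\<^sup>2 > 0"
    using rho by (auto simp: e_def)
  have poly: "b * c = e / 2 * ((1 * b + e * c)\<^sup>2 - b\<^sup>2 - c\<^sup>2)" for b c :: real
    using e by (simp add: power2_eq_square algebra_simps)
  have poly': "i * (b * c) = e / 2 * (i * (1 * b + e * c)\<^sup>2 - i * b\<^sup>2 - i * c\<^sup>2)" for i b c :: real
    by (subst poly[of b c]) (simp add: algebra_simps)
  note I = integrable_incr_B[OF st, of 2] integrable_incr_C[OF st, of 2] integrable_incr_power[OF st q, of 2]
  show "integrable M (\<lambda>\<omega>. (B t \<omega> - B s \<omega>) * (C t \<omega> - C s \<omega>))"
    unfolding poly[of "B t _ - B s _"] by (intro integrable_mult_right Bochner_Integration.integrable_diff I)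
  assume A: "A \<in> sets (F s)"
  have [measurable]: "A \<in> events"
    using A filtration_event st by auto
  have I': "integrable M (\<lambda>\<omega>. indicator A \<omega> * f \<omega>)" if "integrable M f" for f :: "'a \<Rightarrow> real"
    using integrable_mult_indicator[OF \<open>A \<in> events\<close> that] by simp
  have "expectation (\<lambda>\<omega>. indicator A \<omega> * ((B t \<omega> - B s \<omega>) * (C t \<omega> - C s \<omega>)))
    = expectation (\<lambda>\<omega>. e / 2 * (indicator A \<omega> * (1 * (B t \<omega> - B s \<omega>) + e * (C t \<omega> - C s \<omega>))\<^sup>2
       - indicator A \<omega> * (B t \<omega> - B s \<omega>)\<^sup>2 - indicator A \<omega> * (C t \<omega> - C s \<omega>)\<^sup>2))"
    by (simp only: poly')
  also have "\<dots> = e / 2 * ((t - s) * (1\<^sup>2 + 2 * \<rho> * 1 * e + e\<^sup>2) * prob A - (t - s) * prob A - (t - s) * prob A)"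
  proof -
    have "expectation (\<lambda>\<omega>. indicator A \<omega> * (1 * (B t \<omega> - B s \<omega>) + e * (C t \<omega> - C s \<omega>))\<^sup>2)
      = (t - s) * (1\<^sup>2 + 2 * \<rho> * 1 * e + e\<^sup>2) * prob A"
      using st q by (subst expectation_incr_power[OF st q A]) (simp add: std_normal_moments)
    then show ?thesis
      using I'[OF I(1)] I'[OF I(2)] I'[OF I(3)] expectation_incr_B_square[OF st A] expectation_incr_C_square[OF st A]
      by simp
  qed
  also have "\<dots> = \<rho> * (t - s) * prob A"
    by (cases "\<rho> = -1") (simp_all add: e_def field_simps)
  finally show "expectation (\<lambda>\<omega>. indicator A \<omega> * ((B t \<omega> - B s \<omega>) * (C t \<omega> - C s \<omega>))) = \<rho> * (t - s) * prob A" .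
qed

end

section \<open>Logarithmic test functions\<close>

lemma abs_inner_le_sqrt:
  fixes p w :: "'b::real_inner"
  assumes "a > 0"
  shows "\<bar>p \<bullet> w\<bar> \<le> sqrt (p \<bullet> p + a) * norm w" and "norm p \<le> sqrt (p \<bullet> p + a)"
proof -
  show n: "norm p \<le> sqrt (p \<bullet> p + a)"
    unfolding norm_eq_sqrt_inner using assms by simp
  have "\<bar>p \<bullet> w\<bar> \<le> norm p * norm w"
    by (rule Cauchy_Schwarz_ineq2)
  also have "\<dots> \<le> sqrt (p \<bullet> p + a) * norm w"
    using n by (intro mult_right_mono) auto
  finally show "\<bar>p \<bullet> w\<bar> \<le> sqrt (p \<bullet> p + a) * norm w" .
qed

text \<open>On the segment from v to v + w the logarithm is a function of one variable, and Taylor's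
  theorem applies. Its k-th derivative is at most a constant times |w|^k / a^(k/2), because the
  derivative of the quadratic is controlled by its own square root and the quadratic stays above a.
  The constants are 6/2 = 3 and 28/6 < 5.\<close>

lemma
  fixes v w :: "'b::real_inner"
  assumes a: "a > 0"
  shows ln_taylor2: "\<bar>ln ((v + w) \<bullet> (v + w) + a) - ln (v \<bullet> v + a) - 2 * (v \<bullet> w) / (v \<bullet> v + a)\<bar>
      \<le> 3 / a * (norm w)\<^sup>2"
    and ln_taylor3: "\<bar>ln ((v + w) \<bullet> (v + w) + a) - ln (v \<bullet> v + a) - 2 * (v \<bullet> w) / (v \<bullet> v + a)
      - ((w \<bullet> w) / (v \<bullet> v + a) - 2 * (v \<bullet> w)\<^sup>2 / (v \<bullet> v + a)\<^sup>2)\<bar> \<le> 5 / (a * sqrt a) * norm w ^ 3"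
proof -
  define p where "p = (\<lambda>\<theta>. v + \<theta> *\<^sub>R w)"
  define N where "N = (\<lambda>\<theta>. p \<theta> \<bullet> p \<theta> + a)"
  define m where "m = (\<lambda>\<theta>. p \<theta> \<bullet> w)"
  define W where "W = w \<bullet> w"
  \<comment> \<open>The function \<open>d k\<close> is the k-th derivative of ln N along the
    segment, obtained from N' = 2 m and m' = W. The last branch is only ever used for k = 3.\<close>
  define d where "d = (\<lambda>(k::nat) \<theta>. if k = 0 then ln (N \<theta>) else if k = 1 then 2 * m \<theta> / N \<theta>
    else if k = 2 then 2 * W / N \<theta> - 4 * (m \<theta>)\<^sup>2 / (N \<theta>)\<^sup>2
    else - 12 * W * m \<theta> / (N \<theta>)\<^sup>2 + 16 * (m \<theta>)^3 / (N \<theta>)^3)"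
  have Na: "N \<theta> \<ge> a" for \<theta>
    by (simp add: N_def)
  then have Npos: "N \<theta> > 0" for \<theta>
    using a by (rule less_le_trans[rotated])
  then have N0: "N \<theta> \<noteq> 0" for \<theta>
    by (metis less_irrefl)
  have DN: "(N has_real_derivative 2 * m \<theta>) (at \<theta>)" for \<theta>
  proof -
    have eq: "N = (\<lambda>\<theta>. v \<bullet> v + a + 2 * (v \<bullet> w) * \<theta> + \<theta>\<^sup>2 * (w \<bullet> w))"
      by (auto simp: N_def p_def algebra_simps power2_eq_square inner_commute)
    show ?thesis
      unfolding eq m_def p_def
      by (auto intro!: derivative_eq_intros simp: algebra_simps)
  qed
  have Dm: "(m has_real_derivative W) (at \<theta>)" for \<theta>
  proof -
    have eq: "m = (\<lambda>\<theta>. v \<bullet> w + \<theta> * (w \<bullet> w))"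
      by (auto simp: m_def p_def algebra_simps)
    show ?thesis
      unfolding eq W_def by (auto intro!: derivative_eq_intros)
  qed
  have D0: "(d 0 has_real_derivative d 1 \<theta>) (at \<theta>)" for \<theta>
    unfolding d_def using Npos[of \<theta>]
    by (auto intro!: derivative_eq_intros DN simp: field_simps)
  have D1: "(d 1 has_real_derivative d 2 \<theta>) (at \<theta>)" for \<theta>
    unfolding d_def using N0[of \<theta>]
    by (auto intro!: derivative_eq_intros DN Dm simp: field_simps power2_eq_square)
  have D2: "(d 2 has_real_derivative d 3 \<theta>) (at \<theta>)" for \<theta>
    unfolding d_def using N0[of \<theta>]
    by (auto intro!: derivative_eq_intros DN Dm simp: field_simps power2_eq_square power3_eq_cube)
  have der: "k < 3 \<Longrightarrow> (d k has_real_derivative d (Suc k) \<theta>) (at \<theta>)" for k \<theta>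
  proof -
    assume "k < 3"
    then have "k = 0 \<or> k = 1 \<or> k = 2" by auto
    then show ?thesis
      using D0 D1 D2 by (auto simp: eval_nat_numeral)
  qed
  have mb: "\<bar>m \<theta>\<bar> \<le> sqrt (N \<theta>) * norm w" for \<theta>
    unfolding m_def N_def using abs_inner_le_sqrt(1)[OF a] .
  have W: "W = (norm w)\<^sup>2"
    by (simp add: W_def power2_norm_eq_inner)
  have sq: "sqrt (N \<theta>) * sqrt (N \<theta>) = N \<theta>" for \<theta>
    using Npos[of \<theta>] by simp
  have b2: "\<bar>d 2 \<theta>\<bar> \<le> 6 / a * (norm w)\<^sup>2" for \<theta>
  proof -
    have "(m \<theta>)\<^sup>2 \<le> N \<theta> * (norm w)\<^sup>2"
      using power_mono[OF mb[of \<theta>], of 2] sq[of \<theta>] Npos[of \<theta>] by (simp add: power_mult_distrib)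
    then have "(m \<theta>)\<^sup>2 / (N \<theta>)\<^sup>2 \<le> N \<theta> * (norm w)\<^sup>2 / (N \<theta>)\<^sup>2"
      by (intro divide_right_mono) auto
    also have "\<dots> = (norm w)\<^sup>2 / N \<theta>"
      using N0[of \<theta>] by (simp add: power2_eq_square)
    finally have *: "(m \<theta>)\<^sup>2 / (N \<theta>)\<^sup>2 \<le> (norm w)\<^sup>2 / N \<theta>" .
    have "\<bar>d 2 \<theta>\<bar> \<le> 2 * ((norm w)\<^sup>2 / N \<theta>) + 4 * ((m \<theta>)\<^sup>2 / (N \<theta>)\<^sup>2)"
    proof -
      have "0 \<le> (norm w)\<^sup>2 / N \<theta>" "0 \<le> (m \<theta>)\<^sup>2 / (N \<theta>)\<^sup>2"
        using less_imp_le[OF Npos[of \<theta>]] by simp_all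
      moreover have "d 2 \<theta> = 2 * ((norm w)\<^sup>2 / N \<theta>) - 4 * ((m \<theta>)\<^sup>2 / (N \<theta>)\<^sup>2)"
        unfolding d_def W by simp
      ultimately show ?thesis
        by linarith
    qed
    also have "\<dots> \<le> 6 * ((norm w)\<^sup>2 / N \<theta>)"
      using * by simp
    also have "\<dots> \<le> 6 * ((norm w)\<^sup>2 / a)"
      using Na[of \<theta>] a by (intro mult_left_mono divide_left_mono) auto
    finally show ?thesis by simp
  qed
  have b3: "\<bar>d 3 \<theta>\<bar> \<le> 28 / (a * sqrt a) * norm w ^ 3" for \<theta>
  proof -
    define r where "r = sqrt (N \<theta>)"
    have r: "r > 0" "N \<theta> = r\<^sup>2" "sqrt a \<le> r"
      using Npos[of \<theta>] Na[of \<theta>] by (auto simp: r_def)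
    have m1: "\<bar>m \<theta>\<bar> \<le> r * norm w"
      using mb[of \<theta>] by (simp add: r_def)
    have "\<bar>d 3 \<theta>\<bar> \<le> 12 * W * \<bar>m \<theta>\<bar> / r ^ 4 + 16 * \<bar>m \<theta>\<bar> ^ 3 / r ^ 6"
    proof -
      have "\<bar>d 3 \<theta>\<bar> \<le> \<bar>12 * W * m \<theta> / (r\<^sup>2)\<^sup>2\<bar> + \<bar>16 * (m \<theta>)^3 / (r\<^sup>2)^3\<bar>"
      proof -
        have "d 3 \<theta> = - (12 * W * m \<theta> / (r\<^sup>2)\<^sup>2) + 16 * (m \<theta>)^3 / (r\<^sup>2)^3"
          unfolding d_def r(2) by simp
        then show ?thesis
          by linarith
      qed
      also have "\<dots> = 12 * W * \<bar>m \<theta>\<bar> / r ^ 4 + 16 * \<bar>m \<theta>\<bar> ^ 3 / r ^ 6"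
        using r by (simp add: abs_mult power_abs power_mult[symmetric] W)
      finally show ?thesis .
    qed
    also have "\<dots> \<le> 12 * (norm w)\<^sup>2 * (r * norm w) / r ^ 4 + 16 * (r * norm w) ^ 3 / r ^ 6"
      unfolding W using r m1 by (intro add_mono divide_right_mono mult_left_mono power_mono) auto
    also have "\<dots> = 28 * norm w ^ 3 / r ^ 3"
      using r by (simp add: field_simps eval_nat_numeral)
    also have "\<dots> \<le> 28 * norm w ^ 3 / (sqrt a) ^ 3"
      using r a by (intro divide_left_mono power_mono) auto
    also have "\<dots> = 28 / (a * sqrt a) * norm w ^ 3"
      using a by (simp add: power3_eq_cube)
    finally show ?thesis .
  qed
  have ends: "d 0 1 = ln ((v + w) \<bullet> (v + w) + a)" "d 0 0 = ln (v \<bullet> v + a)"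
    "d 1 0 = 2 * (v \<bullet> w) / (v \<bullet> v + a)"
    "d 2 0 / 2 = (w \<bullet> w) / (v \<bullet> v + a) - 2 * (v \<bullet> w)\<^sup>2 / (v \<bullet> v + a)\<^sup>2"
  proof -
    have "(2 * W / n - 4 * q / r) / 2 = W / n - 2 * q / r" for n q r
      by (simp add: diff_divide_distrib)
    then show "d 2 0 / 2 = (w \<bullet> w) / (v \<bullet> v + a) - 2 * (v \<bullet> w)\<^sup>2 / (v \<bullet> v + a)\<^sup>2"
      by (simp only: d_def N_def p_def m_def W_def) simp
  qed (simp_all add: d_def N_def p_def m_def)
  have "\<exists>\<theta>>0. \<theta> \<le> 1 \<and> d 0 1 = (\<Sum>k<2. d k 0 / fact k * 1 ^ k) + d 2 \<theta> / fact 2 * 1 ^ 2"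
    by (rule Maclaurin2) (use der in auto)
  then obtain \<theta> where "d 0 1 = d 0 0 + d 1 0 + d 2 \<theta> / 2"
    by (auto simp: eval_nat_numeral)
  then show "\<bar>ln ((v + w) \<bullet> (v + w) + a) - ln (v \<bullet> v + a) - 2 * (v \<bullet> w) / (v \<bullet> v + a)\<bar>
      \<le> 3 / a * (norm w)\<^sup>2"
    using b2[of \<theta>] unfolding ends by simp
  have "\<exists>\<theta>>0. \<theta> \<le> 1 \<and> d 0 1 = (\<Sum>k<3. d k 0 / fact k * 1 ^ k) + d 3 \<theta> / fact 3 * 1 ^ 3"
    by (rule Maclaurin2) (use der in auto)
  then obtain \<theta> where "d 0 1 = d 0 0 + d 1 0 + d 2 0 / 2 + d 3 \<theta> / 6"
    by (auto simp: numeral_3_eq_3 numeral_2_eq_2)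
  then have "d 0 1 - d 0 0 - d 1 0 - d 2 0 / 2 = d 3 \<theta> / 6"
    by simp
  moreover have "\<bar>d 3 \<theta> / 6\<bar> \<le> 5 / (a * sqrt a) * norm w ^ 3"
  proof -
    have "\<bar>d 3 \<theta> / 6\<bar> \<le> (28 / (a * sqrt a) * norm w ^ 3) / 6"
      using b3[of \<theta>] by simp
    also have "\<dots> \<le> 5 / (a * sqrt a) * norm w ^ 3"
      using a by (simp add: field_simps)
    finally show ?thesis .
  qed
  ultimately show "\<bar>ln ((v + w) \<bullet> (v + w) + a) - ln (v \<bullet> v + a) - 2 * (v \<bullet> w) / (v \<bullet> v + a)
      - ((w \<bullet> w) / (v \<bullet> v + a) - 2 * (v \<bullet> w)\<^sup>2 / (v \<bullet> v + a)\<^sup>2)\<bar> \<le> 5 / (a * sqrt a) * norm w ^ 3"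
    unfolding ends by (simp only:)
qed

text \<open>The difference of the quotients splits into the change of the numerator, which
  contributes 2, and the change of the denominator, which contributes 4. In the second part the
  factors |v| and |v + w| are absorbed by the square roots of the denominators, so the bound holds
  uniformly in v.\<close>

lemma ln_gradient_lipschitz:
  fixes v w e :: "'b::real_inner"
  assumes a: "a > 0"
  shows "\<bar>2 * ((v + w) \<bullet> e) / ((v + w) \<bullet> (v + w) + a) - 2 * (v \<bullet> e) / (v \<bullet> v + a)\<bar> \<le> 6 / a * norm w * norm e"
proof -
  define N where "N = v \<bullet> v + a"
  define N' where "N' = (v + w) \<bullet> (v + w) + a"
  have pos: "N > 0" "N' > 0" "N \<ge> a" "N' \<ge> a"
    using a by (auto simp: N_def N'_def add_nonneg_pos)
  have nv: "norm v \<le> sqrt N" "norm (v + w) \<le> sqrt N'"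
    using abs_inner_le_sqrt(2)[OF a] by (auto simp: N_def N'_def)
  have dN: "\<bar>N - N'\<bar> \<le> norm w * (norm v + norm (v + w))"
  proof -
    have "N - N' = - (w \<bullet> (v + (v + w)))"
      by (simp add: N_def N'_def algebra_simps inner_commute)
    then have "\<bar>N - N'\<bar> \<le> norm w * norm (v + (v + w))"
      using Cauchy_Schwarz_ineq2[of w "v + (v + w)"] by simp
    also have "\<dots> \<le> norm w * (norm v + norm (v + w))"
      by (intro mult_left_mono norm_triangle_ineq) auto
    finally show ?thesis .
  qed
  have eq: "2 * ((v + w) \<bullet> e) / N' - 2 * (v \<bullet> e) / N = 2 * ((w \<bullet> e) / N') + 2 * ((v \<bullet> e) * (N - N') / (N * N'))"
    using pos by (simp add: field_simps inner_add_left)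
  have 1: "\<bar>(w \<bullet> e) / N'\<bar> \<le> norm w * norm e / a"
    unfolding abs_divide using pos a Cauchy_Schwarz_ineq2[of w e] by (intro frac_le) auto
  have "\<bar>(v \<bullet> e) * (N - N')\<bar> \<le> (norm v * norm e) * (norm w * (norm v + norm (v + w)))"
    unfolding abs_mult by (intro mult_mono dN Cauchy_Schwarz_ineq2) auto
  also have "\<dots> = norm w * norm e * (norm v * norm v + norm v * norm (v + w))"
    by (simp add: algebra_simps)
  also have "\<dots> \<le> norm w * norm e * (2 * (N * N') / a)"
  proof (intro mult_left_mono)
    have "norm v * norm v \<le> N * N' / a"
    proof -
      have "norm v * norm v \<le> N"
        using a by (simp add: N_def dot_square_norm power2_eq_square)
      also have "\<dots> \<le> N * N' / a"
        using pos a by (simp add: field_simps)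
      finally show ?thesis .
    qed
    moreover have "norm v * norm (v + w) \<le> N * N' / a"
    proof -
      have "norm v * norm (v + w) \<le> sqrt N * sqrt N'"
        using nv pos by (intro mult_mono) auto
      also have "\<dots> = N * N' / sqrt (N * N')"
        using pos by (subst real_div_sqrt) (auto simp: real_sqrt_mult)
      also have "\<dots> \<le> N * N' / a"
      proof (intro divide_left_mono)
        have "a\<^sup>2 \<le> N * N'"
          unfolding power2_eq_square using pos a by (intro mult_mono) auto
        then show "a \<le> sqrt (N * N')"
          using a by (simp add: real_le_rsqrt)
      qed (use pos a in auto)
      finally show ?thesis .
    qed
    ultimately have "norm v * norm v + norm v * norm (v + w) \<le> N * N' / a + N * N' / a"
      by (rule add_mono)
    then show "norm v * norm v + norm v * norm (v + w) \<le> 2 * (N * N') / a"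
      by (simp add: mult.commute)
  qed auto
  finally have "\<bar>(v \<bullet> e) * (N - N')\<bar> / (N * N') \<le> norm w * norm e * (2 * (N * N') / a) / (N * N')"
    using pos by (intro divide_right_mono) auto
  also have "\<dots> = 2 * (norm w * norm e / a)"
    using pos by simp
  finally have 2: "\<bar>(v \<bullet> e) * (N - N') / (N * N')\<bar> \<le> 2 * (norm w * norm e / a)"
    using pos by simp
  have "\<bar>2 * ((v + w) \<bullet> e) / N' - 2 * (v \<bullet> e) / N\<bar> \<le> 2 * (norm w * norm e / a) + 2 * (2 * (norm w * norm e / a))"
  proof -
    have "\<bar>2 * p + 2 * q\<bar> \<le> 2 * r + 2 * r'" if "\<bar>p\<bar> \<le> r" "\<bar>q\<bar> \<le> r'" for p q r r' :: real
      using that by linarith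
    from this[OF 1 2] show ?thesis
      unfolding eq .
  qed
  then show ?thesis
    unfolding N_def N'_def by (simp add: ac_simps)
qed


text \<open>The coefficients h11, h12 and h22 are those of the Taylor polynomial: half the pure second
  derivatives and the full mixed derivative.\<close>

locale test_function =
  fixes f g1 g2 h11 h12 h22 :: "real \<Rightarrow> real \<Rightarrow> real" and K :: real
  assumes cont_f: "continuous_on UNIV (\<lambda>p. f (fst p) (snd p))"
    and cont_g1: "continuous_on UNIV (\<lambda>p. g1 (fst p) (snd p))"
    and cont_g2: "continuous_on UNIV (\<lambda>p. g2 (fst p) (snd p))"
    and cont_h11: "continuous_on UNIV (\<lambda>p. h11 (fst p) (snd p))"
    and cont_h12: "continuous_on UNIV (\<lambda>p. h12 (fst p) (snd p))"
    and cont_h22: "continuous_on UNIV (\<lambda>p. h22 (fst p) (snd p))"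
    and bound_g1: "\<bar>g1 x y\<bar> \<le> K" and bound_g2: "\<bar>g2 x y\<bar> \<le> K"
    and bound_h11: "\<bar>h11 x y\<bar> \<le> K" and bound_h12: "\<bar>h12 x y\<bar> \<le> K" and bound_h22: "\<bar>h22 x y\<bar> \<le> K"
    and taylor2: "\<bar>f (x + b) (y + c) - f x y - (g1 x y * b + g2 x y * c)\<bar> \<le> K * (b\<^sup>2 + c\<^sup>2)"
    and taylor3: "\<bar>f (x + b) (y + c) - f x y - (g1 x y * b + g2 x y * c)
      - (h11 x y * b\<^sup>2 + h12 x y * (b * c) + h22 x y * c\<^sup>2)\<bar> \<le> K * (\<bar>b\<bar> ^ 3 + \<bar>c\<bar> ^ 3)"
    and lipschitz_g1: "\<bar>g1 (x + b) (y + c) - g1 x y\<bar> \<le> K * (\<bar>b\<bar> + \<bar>c\<bar>)"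
    and lipschitz_g2: "\<bar>g2 (x + b) (y + c) - g2 x y\<bar> \<le> K * (\<bar>b\<bar> + \<bar>c\<bar>)"

lemma abs_half_diff_le:
  fixes p q :: real
  assumes "\<bar>p\<bar> \<le> A * z" "\<bar>q\<bar> \<le> A' * z" and "r = (p - q) / 2"
  shows "\<bar>r\<bar> \<le> (A + A') * z"
  using assms by (simp add: algebra_simps)

text \<open>Every requirement is linear in the function and its coefficients or is stable under
  sums, so the logarithms with the two shifts can be treated separately and then combined into
  f.\<close>

lemma test_function_half_diff:
  assumes "test_function f g1 g2 h11 h12 h22 K" and "test_function f' g1' g2' h11' h12' h22' K'"
  shows "test_function (\<lambda>x y. (f x y - f' x y) / 2) (\<lambda>x y. (g1 x y - g1' x y) / 2)
    (\<lambda>x y. (g2 x y - g2' x y) / 2) (\<lambda>x y. (h11 x y - h11' x y) / 2)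
    (\<lambda>x y. (h12 x y - h12' x y) / 2) (\<lambda>x y. (h22 x y - h22' x y) / 2) (K + K')"
proof -
  interpret T: test_function f g1 g2 h11 h12 h22 K by fact
  interpret T': test_function f' g1' g2' h11' h12' h22' K' by fact
  have half: "\<bar>(p - q) / 2\<bar> \<le> A + A'" if "\<bar>p\<bar> \<le> A" "\<bar>q\<bar> \<le> A'" for p q A A' :: real
    using that by simp
  show ?thesis
  proof
    show "\<bar>(f (x + b) (y + c) - f' (x + b) (y + c)) / 2 - (f x y - f' x y) / 2
        - ((g1 x y - g1' x y) / 2 * b + (g2 x y - g2' x y) / 2 * c)\<bar> \<le> (K + K') * (b\<^sup>2 + c\<^sup>2)" for x b y c
      by (rule abs_half_diff_le[OF T.taylor2[of x b y c] T'.taylor2[of x b y c]])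
         (simp add: field_simps)
    show "\<bar>(f (x + b) (y + c) - f' (x + b) (y + c)) / 2 - (f x y - f' x y) / 2
        - ((g1 x y - g1' x y) / 2 * b + (g2 x y - g2' x y) / 2 * c)
        - ((h11 x y - h11' x y) / 2 * b\<^sup>2 + (h12 x y - h12' x y) / 2 * (b * c) + (h22 x y - h22' x y) / 2 * c\<^sup>2)\<bar>
        \<le> (K + K') * (\<bar>b\<bar> ^ 3 + \<bar>c\<bar> ^ 3)" for x b y c
      by (rule abs_half_diff_le[OF T.taylor3[of x b y c] T'.taylor3[of x b y c]])
         (simp add: field_simps)
    show "\<bar>(g1 (x + b) (y + c) - g1' (x + b) (y + c)) / 2 - (g1 x y - g1' x y) / 2\<bar>
        \<le> (K + K') * (\<bar>b\<bar> + \<bar>c\<bar>)" for x b y c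
      by (rule abs_half_diff_le[OF T.lipschitz_g1[of x b y c] T'.lipschitz_g1[of x b y c]])
         (simp add: field_simps)
    show "\<bar>(g2 (x + b) (y + c) - g2' (x + b) (y + c)) / 2 - (g2 x y - g2' x y) / 2\<bar>
        \<le> (K + K') * (\<bar>b\<bar> + \<bar>c\<bar>)" for x b y c
      by (rule abs_half_diff_le[OF T.lipschitz_g2[of x b y c] T'.lipschitz_g2[of x b y c]])
         (simp add: field_simps)
  qed (intro half T.bound_g1 T.bound_g2 T.bound_h11 T.bound_h12 T.bound_h22
        T'.bound_g1 T'.bound_g2 T'.bound_h11 T'.bound_h12 T'.bound_h22
      | intro continuous_intros T.cont_f T.cont_g1 T.cont_g2 T.cont_h11 T.cont_h12 T.cont_h22
        T'.cont_f T'.cont_g1 T'.cont_g2 T'.cont_h11 T'.cont_h12 T'.cont_h22; simp)+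
qed

text \<open>The Taylor bounds in the vector v are composed with the linear map sending (b, c) to b
  c1 + c c2, whose norm is at most k (|b| + |c|). Working in an arbitrary inner product space covers
  both the planar V and the scalar V.\<close>

lemma test_function_ln:
  fixes c1 c2 :: "'b::real_inner"
  defines "v \<equiv> \<lambda>x y. x *\<^sub>R c1 + y *\<^sub>R c2"
  assumes a: "a > 0"
  shows "\<exists>K. test_function (\<lambda>x y. ln (v x y \<bullet> v x y + a))
    (\<lambda>x y. 2 * (v x y \<bullet> c1) / (v x y \<bullet> v x y + a)) (\<lambda>x y. 2 * (v x y \<bullet> c2) / (v x y \<bullet> v x y + a))
    (\<lambda>x y. (c1 \<bullet> c1) / (v x y \<bullet> v x y + a) - 2 * (v x y \<bullet> c1)\<^sup>2 / (v x y \<bullet> v x y + a)\<^sup>2)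
    (\<lambda>x y. 2 * (c1 \<bullet> c2) / (v x y \<bullet> v x y + a) - 4 * ((v x y \<bullet> c1) * (v x y \<bullet> c2)) / (v x y \<bullet> v x y + a)\<^sup>2)
    (\<lambda>x y. (c2 \<bullet> c2) / (v x y \<bullet> v x y + a) - 2 * (v x y \<bullet> c2)\<^sup>2 / (v x y \<bullet> v x y + a)\<^sup>2) K"
proof -
  define k where "k = norm c1 + norm c2"
  \<comment> \<open>The first summand bounds the gradient. The second serves the second-order
    coefficients, the Lipschitz bound and the quadratic remainder, where 6 = 3 * 2 by (p + q)^2 <= 2
    (p^2 + q^2). The third is for the cubic remainder, where 20 = 5 * 4 by (p + q)^3 <= 4 (p^3 +
    q^3).\<close>
  define K where "K = 2 * k / sqrt a + 6 * k\<^sup>2 / a + 20 * k ^ 3 / (a * sqrt a)"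
  have k: "k \<ge> 0" "norm c1 \<le> k" "norm c2 \<le> k"
    by (auto simp: k_def)
  have Kparts: "2 * k / sqrt a \<ge> 0" "6 * k\<^sup>2 / a \<ge> 0" "20 * k ^ 3 / (a * sqrt a) \<ge> 0"
    using a k by auto
  then have K: "2 * k / sqrt a \<le> K" "6 * k\<^sup>2 / a \<le> K" "20 * k ^ 3 / (a * sqrt a) \<le> K"
    unfolding K_def by linarith+
  have pos: "p \<bullet> p + a > 0" for p :: 'b
    using a by (simp add: add_nonneg_pos)
  then have nz: "p \<bullet> p + a \<noteq> 0" for p :: 'b
    by (metis less_irrefl)
  have shift: "v (x + b) (y + c) = v x y + (b *\<^sub>R c1 + c *\<^sub>R c2)" for x b y c
    by (simp add: v_def algebra_simps)
  have nw: "norm (b *\<^sub>R c1 + c *\<^sub>R c2) \<le> k * (\<bar>b\<bar> + \<bar>c\<bar>)" for b c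
  proof -
    have "norm (b *\<^sub>R c1 + c *\<^sub>R c2) \<le> \<bar>b\<bar> * norm c1 + \<bar>c\<bar> * norm c2"
      using norm_triangle_ineq[of "b *\<^sub>R c1" "c *\<^sub>R c2"] by simp
    also have "\<dots> \<le> \<bar>b\<bar> * k + \<bar>c\<bar> * k"
      using k by (intro add_mono mult_left_mono) auto
    finally show ?thesis by (simp add: algebra_simps)
  qed
  have sq_le: "(norm (b *\<^sub>R c1 + c *\<^sub>R c2))\<^sup>2 \<le> 2 * k\<^sup>2 * (b\<^sup>2 + c\<^sup>2)" for b c
  proof -
    have "(norm (b *\<^sub>R c1 + c *\<^sub>R c2))\<^sup>2 \<le> (k * (\<bar>b\<bar> + \<bar>c\<bar>))\<^sup>2"
      using nw by (intro power_mono) auto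
    also have "\<dots> = k\<^sup>2 * (\<bar>b\<bar> + \<bar>c\<bar>)\<^sup>2"
      by (simp add: power_mult_distrib)
    also have "\<dots> \<le> k\<^sup>2 * (2 * (b\<^sup>2 + c\<^sup>2))"
      using sum_squares_bound[of "\<bar>b\<bar>" "\<bar>c\<bar>"] by (intro mult_left_mono) (auto simp: power2_sum)
    finally show ?thesis by (simp add: algebra_simps)
  qed
  have cube_le: "norm (b *\<^sub>R c1 + c *\<^sub>R c2) ^ 3 \<le> 4 * k ^ 3 * (\<bar>b\<bar> ^ 3 + \<bar>c\<bar> ^ 3)" for b c
  proof -
    have "norm (b *\<^sub>R c1 + c *\<^sub>R c2) ^ 3 \<le> (k * (\<bar>b\<bar> + \<bar>c\<bar>)) ^ 3"
      using nw by (intro power_mono) auto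
    also have "\<dots> = k ^ 3 * (\<bar>b\<bar> + \<bar>c\<bar>) ^ 3"
      by (simp add: power_mult_distrib)
    also have "\<dots> \<le> k ^ 3 * (4 * (\<bar>b\<bar> ^ 3 + \<bar>c\<bar> ^ 3))"
    proof (intro mult_left_mono)
      have "(p + q) ^ 3 \<le> 4 * (p ^ 3 + q ^ 3)" if "p \<ge> 0" "q \<ge> 0" for p q :: real
      proof -
        have "0 \<le> 3 * (p + q) * (p - q)\<^sup>2"
          using that by simp
        then show ?thesis
          by (simp add: power3_eq_cube power2_eq_square algebra_simps)
      qed
      then show "(\<bar>b\<bar> + \<bar>c\<bar>) ^ 3 \<le> 4 * (\<bar>b\<bar> ^ 3 + \<bar>c\<bar> ^ 3)"
        by simp
    qed (use k in auto)
    finally show ?thesis by (simp add: algebra_simps)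
  qed
  have ve: "\<bar>p \<bullet> e\<bar> / sqrt (p \<bullet> p + a) \<le> norm e" for p e :: 'b
    using abs_inner_le_sqrt(1)[OF a, of p e] pos[of p] by (simp add: field_simps)
  have grad_le: "\<bar>2 * (p \<bullet> e) / (p \<bullet> p + a)\<bar> \<le> K" if "norm e \<le> k" for p e :: 'b
  proof -
    have "\<bar>2 * (p \<bullet> e) / (p \<bullet> p + a)\<bar> = 2 * (\<bar>p \<bullet> e\<bar> / sqrt (p \<bullet> p + a)) / sqrt (p \<bullet> p + a)"
      using pos[of p] by (simp add: abs_mult)
    also have "\<dots> \<le> 2 * k / sqrt a"
      using ve[of p e] that a pos[of p] k by (intro frac_le mult_left_mono) auto
    finally show ?thesis using K by simp
  qed
  have dd_le: "\<bar>e \<bullet> e'\<bar> / (p \<bullet> p + a) + 2 * (\<bar>p \<bullet> e\<bar> * \<bar>p \<bullet> e'\<bar>) / (p \<bullet> p + a)\<^sup>2 \<le> 3 * k\<^sup>2 / a"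
    if "norm e \<le> k" "norm e' \<le> k" for p e e' :: 'b
  proof -
    have "\<bar>e \<bullet> e'\<bar> / (p \<bullet> p + a) \<le> k\<^sup>2 / a"
    proof (intro frac_le)
      have "\<bar>e \<bullet> e'\<bar> \<le> norm e * norm e'" by (rule Cauchy_Schwarz_ineq2)
      also have "\<dots> \<le> k * k" using that k by (intro mult_mono) auto
      finally show "\<bar>e \<bullet> e'\<bar> \<le> k\<^sup>2" by (simp add: power2_eq_square)
    qed (use a k in auto)
    moreover have "(\<bar>p \<bullet> e\<bar> * \<bar>p \<bullet> e'\<bar>) / (p \<bullet> p + a)\<^sup>2 \<le> k\<^sup>2 / a"
    proof -
      have "(\<bar>p \<bullet> e\<bar> * \<bar>p \<bullet> e'\<bar>) / (p \<bullet> p + a)\<^sup>2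
        = (\<bar>p \<bullet> e\<bar> / sqrt (p \<bullet> p + a)) * (\<bar>p \<bullet> e'\<bar> / sqrt (p \<bullet> p + a)) / (p \<bullet> p + a)"
        using pos[of p] by (simp add: power2_eq_square)
      also have "\<dots> \<le> (k * k) / a"
      proof (intro frac_le mult_mono)
        show "\<bar>p \<bullet> e\<bar> / sqrt (p \<bullet> p + a) \<le> k" "\<bar>p \<bullet> e'\<bar> / sqrt (p \<bullet> p + a) \<le> k"
          using ve[of p e] ve[of p e'] that by linarith+
      qed (use a k pos[of p] in auto)
      finally show ?thesis by (simp add: power2_eq_square)
    qed
    ultimately show ?thesis
      by (simp add: field_simps)
  qed
  have hess1: "\<bar>(e \<bullet> e) / (p \<bullet> p + a) - 2 * (p \<bullet> e)\<^sup>2 / (p \<bullet> p + a)\<^sup>2\<bar> \<le> K" if "norm e \<le> k" for p e :: 'b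
  proof -
    have "\<bar>(e \<bullet> e) / (p \<bullet> p + a) - 2 * (p \<bullet> e)\<^sup>2 / (p \<bullet> p + a)\<^sup>2\<bar>
      \<le> \<bar>e \<bullet> e\<bar> / (p \<bullet> p + a) + 2 * (\<bar>p \<bullet> e\<bar> * \<bar>p \<bullet> e\<bar>) / (p \<bullet> p + a)\<^sup>2"
      using pos[of p] by (intro order_trans[OF abs_triangle_ineq4] add_mono)
        (auto simp: abs_mult power2_eq_square)
    also have "\<dots> \<le> 3 * k\<^sup>2 / a" using that by (intro dd_le)
    also have "\<dots> \<le> 6 * k\<^sup>2 / a" using a by (intro divide_right_mono) auto
    finally show ?thesis using K by simp
  qed
  have hess2: "\<bar>2 * (c1 \<bullet> c2) / (p \<bullet> p + a) - 4 * ((p \<bullet> c1) * (p \<bullet> c2)) / (p \<bullet> p + a)\<^sup>2\<bar> \<le> K" for p :: 'b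
  proof -
    have "\<bar>2 * (c1 \<bullet> c2) / (p \<bullet> p + a) - 4 * ((p \<bullet> c1) * (p \<bullet> c2)) / (p \<bullet> p + a)\<^sup>2\<bar>
      \<le> 2 * (\<bar>c1 \<bullet> c2\<bar> / (p \<bullet> p + a) + 2 * (\<bar>p \<bullet> c1\<bar> * \<bar>p \<bullet> c2\<bar>) / (p \<bullet> p + a)\<^sup>2)"
      using pos[of p] unfolding distrib_left
      by (intro order_trans[OF abs_triangle_ineq4] add_mono) (auto simp: abs_mult)
    also have "\<dots> \<le> 2 * (3 * k\<^sup>2 / a)" using k by (intro mult_left_mono dd_le) auto
    finally show ?thesis using K by simp
  qed
  have lip: "\<bar>2 * (v (x + b) (y + c) \<bullet> e) / (v (x + b) (y + c) \<bullet> v (x + b) (y + c) + a)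
      - 2 * (v x y \<bullet> e) / (v x y \<bullet> v x y + a)\<bar> \<le> K * (\<bar>b\<bar> + \<bar>c\<bar>)" if "norm e \<le> k" for x y b c e
  proof -
    have "\<bar>2 * (v (x + b) (y + c) \<bullet> e) / (v (x + b) (y + c) \<bullet> v (x + b) (y + c) + a)
      - 2 * (v x y \<bullet> e) / (v x y \<bullet> v x y + a)\<bar> \<le> 6 / a * norm (b *\<^sub>R c1 + c *\<^sub>R c2) * norm e"
      unfolding shift by (rule ln_gradient_lipschitz[OF a])
    also have "\<dots> \<le> 6 / a * (k * (\<bar>b\<bar> + \<bar>c\<bar>)) * k"
      using nw that a k by (intro mult_mono mult_left_mono) auto
    also have "\<dots> = 6 * k\<^sup>2 / a * (\<bar>b\<bar> + \<bar>c\<bar>)"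
      by (simp add: power2_eq_square)
    also have "\<dots> \<le> K * (\<bar>b\<bar> + \<bar>c\<bar>)"
      using K by (intro mult_right_mono) auto
    finally show ?thesis .
  qed
  have lin: "2 * (p \<bullet> c1) / n * b + 2 * (p \<bullet> c2) / n * c = 2 * (p \<bullet> (b *\<^sub>R c1 + c *\<^sub>R c2)) / n" for p n b c
    by (simp add: inner_add_right add_divide_distrib algebra_simps)
  have quad: "((c1 \<bullet> c1) / n - 2 * (p \<bullet> c1)\<^sup>2 / m) * b\<^sup>2
    + (2 * (c1 \<bullet> c2) / n - 4 * ((p \<bullet> c1) * (p \<bullet> c2)) / m) * (b * c)
    + ((c2 \<bullet> c2) / n - 2 * (p \<bullet> c2)\<^sup>2 / m) * c\<^sup>2
    = ((b *\<^sub>R c1 + c *\<^sub>R c2) \<bullet> (b *\<^sub>R c1 + c *\<^sub>R c2)) / n - 2 * (p \<bullet> (b *\<^sub>R c1 + c *\<^sub>R c2))\<^sup>2 / m" for p n m b c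
    by (simp add: inner_add_right inner_add_left inner_commute[of c2 c1] power2_eq_square
        divide_inverse algebra_simps)
  have cv: "continuous_on UNIV (\<lambda>p. v (fst p) (snd p))"
    unfolding v_def by (intro continuous_intros)
  show ?thesis
  proof (rule exI[of _ K], unfold_locales, goal_cases)
    \<comment> \<open>The six continuity goals and the five bounds on coefficients come earlier in
      the locale, so goals 12 and 13 are the two Taylor remainders.\<close>
    case (12 x b y c)
    have "\<bar>ln (v (x + b) (y + c) \<bullet> v (x + b) (y + c) + a) - ln (v x y \<bullet> v x y + a)
      - (2 * (v x y \<bullet> c1) / (v x y \<bullet> v x y + a) * b + 2 * (v x y \<bullet> c2) / (v x y \<bullet> v x y + a) * c)\<bar>
      \<le> 3 / a * (norm (b *\<^sub>R c1 + c *\<^sub>R c2))\<^sup>2"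
      unfolding lin shift by (rule ln_taylor2[OF a])
    also have "\<dots> \<le> 3 / a * (2 * k\<^sup>2 * (b\<^sup>2 + c\<^sup>2))"
      using sq_le a by (intro mult_left_mono) auto
    also have "\<dots> = 6 * k\<^sup>2 / a * (b\<^sup>2 + c\<^sup>2)"
      by simp
    also have "\<dots> \<le> K * (b\<^sup>2 + c\<^sup>2)"
      using K by (intro mult_right_mono) auto
    finally show ?case .
  next
    case (13 x b y c)
    have "\<bar>ln (v (x + b) (y + c) \<bullet> v (x + b) (y + c) + a) - ln (v x y \<bullet> v x y + a)
      - (2 * (v x y \<bullet> c1) / (v x y \<bullet> v x y + a) * b + 2 * (v x y \<bullet> c2) / (v x y \<bullet> v x y + a) * c)
      - (((c1 \<bullet> c1) / (v x y \<bullet> v x y + a) - 2 * (v x y \<bullet> c1)\<^sup>2 / (v x y \<bullet> v x y + a)\<^sup>2) * b\<^sup>2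
       + (2 * (c1 \<bullet> c2) / (v x y \<bullet> v x y + a) - 4 * ((v x y \<bullet> c1) * (v x y \<bullet> c2)) / (v x y \<bullet> v x y + a)\<^sup>2) * (b * c)
       + ((c2 \<bullet> c2) / (v x y \<bullet> v x y + a) - 2 * (v x y \<bullet> c2)\<^sup>2 / (v x y \<bullet> v x y + a)\<^sup>2) * c\<^sup>2)\<bar>
      \<le> 5 / (a * sqrt a) * norm (b *\<^sub>R c1 + c *\<^sub>R c2) ^ 3"
      unfolding lin quad shift by (rule ln_taylor3[OF a])
    also have "\<dots> \<le> 5 / (a * sqrt a) * (4 * k ^ 3 * (\<bar>b\<bar> ^ 3 + \<bar>c\<bar> ^ 3))"
      using cube_le a by (intro mult_left_mono) auto
    also have "\<dots> = 20 * k ^ 3 / (a * sqrt a) * (\<bar>b\<bar> ^ 3 + \<bar>c\<bar> ^ 3)"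
      by simp
    also have "\<dots> \<le> K * (\<bar>b\<bar> ^ 3 + \<bar>c\<bar> ^ 3)"
      using K by (intro mult_right_mono) auto
    finally show ?case .
  qed (use k in \<open>auto intro!: grad_le hess1 hess2 lip continuous_intros cv simp: nz pos simp del: abs_divide\<close>)
qed


text \<open>With r = 1/(n + a), the extremal values P = 2 theta and tau = theta n leave theta (r - n
  r^2) = theta a r^2 for half a logarithm. For a = eps this enters with a minus sign and is dropped;
  for a = 1 + eps it is at most theta, because a r <= 1 and r <= 1. This is why the bound does not
  depend on eps.\<close>

lemma log_ratio_generator_le:
  fixes n P \<tau> \<theta> \<epsilon> :: real
  assumes n: "n \<ge> 0" and e: "\<epsilon> > 0" and th: "\<theta> \<ge> 0" and P: "P \<ge> 2 * \<theta>" and tau: "\<tau> \<le> \<theta> * n"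
  shows "(P / (n + (1 + \<epsilon>)) - 2 * \<tau> / (n + (1 + \<epsilon>))\<^sup>2 - (P / (n + \<epsilon>) - 2 * \<tau> / (n + \<epsilon>)\<^sup>2)) / 2 \<le> \<theta>"
proof -
  define r0 where "r0 = 1 / (n + \<epsilon>)"
  define r1 where "r1 = 1 / (n + (1 + \<epsilon>))"
  have r: "0 < r1" "r1 \<le> r0" "r1 \<le> 1" "(n + \<epsilon>) * r0 = 1" "(n + (1 + \<epsilon>)) * r1 = 1"
    using n e by (auto simp: r0_def r1_def field_simps)
  have sq: "r1\<^sup>2 \<le> r0\<^sup>2"
    using r by (intro power_mono) auto
  have "(P / (n + (1 + \<epsilon>)) - 2 * \<tau> / (n + (1 + \<epsilon>))\<^sup>2 - (P / (n + \<epsilon>) - 2 * \<tau> / (n + \<epsilon>)\<^sup>2)) / 2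
    = \<tau> * (r0\<^sup>2 - r1\<^sup>2) - P / 2 * (r0 - r1)"
  proof -
    have "(P * r1 - 2 * \<tau> * r1\<^sup>2 - (P * r0 - 2 * \<tau> * r0\<^sup>2)) / 2 = \<tau> * (r0\<^sup>2 - r1\<^sup>2) - P / 2 * (r0 - r1)"
      by (simp add: field_simps)
    then show ?thesis
      by (simp add: r0_def r1_def power_one_over)
  qed
  \<comment> \<open>Since r1 <= r0, the coefficient of tau is nonnegative and that of P is
    nonpositive, so the two hypotheses may be inserted as equalities.\<close>
  also have "\<dots> \<le> (\<theta> * n) * (r0\<^sup>2 - r1\<^sup>2) - \<theta> * (r0 - r1)"
    using sq r P tau by (intro diff_mono mult_right_mono) auto
  also have "\<dots> = \<theta> * (r1 * (1 - n * r1) - r0 * (1 - n * r0))"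
    by (simp add: algebra_simps power2_eq_square)
  also have "\<dots> = \<theta> * (r1 * ((1 + \<epsilon>) * r1) - r0 * (\<epsilon> * r0))"
  proof -
    have "1 - n * r1 = (1 + \<epsilon>) * r1" "1 - n * r0 = \<epsilon> * r0"
      using r(4,5) by (simp_all add: algebra_simps)
    then show ?thesis by simp
  qed
  also have "\<dots> \<le> \<theta> * 1"
  proof (intro mult_left_mono)
    have "(1 + \<epsilon>) * r1 \<le> 1"
    proof -
      have "n * r1 \<ge> 0"
        using n r(1) by simp
      then show ?thesis
        using r(5) by (simp only: distrib_right)
    qed
    then have "r1 * ((1 + \<epsilon>) * r1) \<le> 1 * 1"
      using r e by (intro mult_mono) auto
    moreover have "0 \<le> r0 * (\<epsilon> * r0)"
      using r e by auto
    ultimately show "r1 * ((1 + \<epsilon>) * r1) - r0 * (\<epsilon> * r0) \<le> 1"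
      by linarith
  qed (use th in auto)
  finally show ?thesis by simp
qed

text \<open>Both hypotheses concern n = |v|^2: \<open>disp\<close> bounds a quarter of the rate of
  its quadratic variation by theta n, and the left side of \<open>drift\<close> is the drift rate of
  n, its last bracket being the Ito correction. Together they compare n with a squared Bessel
  process of dimension 2 at speed theta.\<close>

lemma log_ratio_test_function:
  fixes c1 c2 :: "'b::real_inner"
  defines "v \<equiv> \<lambda>x y. x *\<^sub>R c1 + y *\<^sub>R c2"
  assumes e: "\<epsilon> > 0" and th: "\<theta> \<ge> 0"
    and disp: "\<And>x y. x > 0 \<Longrightarrow> y > 0 \<Longrightarrow>
      (v x y \<bullet> c1)\<^sup>2 + 2 * \<rho> * ((v x y \<bullet> c1) * (v x y \<bullet> c2)) + (v x y \<bullet> c2)\<^sup>2 \<le> \<theta> * (v x y \<bullet> v x y)"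
    and drift: "\<And>x y. x > 0 \<Longrightarrow> y > 0 \<Longrightarrow>
      2 * ((v x y \<bullet> c1) * (\<alpha> / x + \<beta> / y) + (v x y \<bullet> c2) * (\<gamma> / x + \<delta> / y))
        + (c1 \<bullet> c1 + 2 * \<rho> * (c1 \<bullet> c2) + c2 \<bullet> c2) \<ge> 2 * \<theta>"
  shows "\<exists>g1 g2 h11 h12 h22 K.
    test_function (\<lambda>x y. (ln (v x y \<bullet> v x y + (1 + \<epsilon>)) - ln (v x y \<bullet> v x y + \<epsilon>)) / 2) g1 g2 h11 h12 h22 K \<and>
    (\<forall>x>0. \<forall>y>0. g1 x y * (\<alpha> / x + \<beta> / y) + g2 x y * (\<gamma> / x + \<delta> / y)
       + (h11 x y + \<rho> * h12 x y + h22 x y) \<le> \<theta>)"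
proof -
  obtain K where K: "test_function (\<lambda>x y. ln (v x y \<bullet> v x y + (1 + \<epsilon>)))
    (\<lambda>x y. 2 * (v x y \<bullet> c1) / (v x y \<bullet> v x y + (1 + \<epsilon>))) (\<lambda>x y. 2 * (v x y \<bullet> c2) / (v x y \<bullet> v x y + (1 + \<epsilon>)))
    (\<lambda>x y. (c1 \<bullet> c1) / (v x y \<bullet> v x y + (1 + \<epsilon>)) - 2 * (v x y \<bullet> c1)\<^sup>2 / (v x y \<bullet> v x y + (1 + \<epsilon>))\<^sup>2)
    (\<lambda>x y. 2 * (c1 \<bullet> c2) / (v x y \<bullet> v x y + (1 + \<epsilon>)) - 4 * ((v x y \<bullet> c1) * (v x y \<bullet> c2)) / (v x y \<bullet> v x y + (1 + \<epsilon>))\<^sup>2)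
    (\<lambda>x y. (c2 \<bullet> c2) / (v x y \<bullet> v x y + (1 + \<epsilon>)) - 2 * (v x y \<bullet> c2)\<^sup>2 / (v x y \<bullet> v x y + (1 + \<epsilon>))\<^sup>2) K"
    using test_function_ln[of "1 + \<epsilon>" c1 c2] e unfolding v_def by auto
  obtain K' where K': "test_function (\<lambda>x y. ln (v x y \<bullet> v x y + \<epsilon>))
    (\<lambda>x y. 2 * (v x y \<bullet> c1) / (v x y \<bullet> v x y + \<epsilon>)) (\<lambda>x y. 2 * (v x y \<bullet> c2) / (v x y \<bullet> v x y + \<epsilon>))
    (\<lambda>x y. (c1 \<bullet> c1) / (v x y \<bullet> v x y + \<epsilon>) - 2 * (v x y \<bullet> c1)\<^sup>2 / (v x y \<bullet> v x y + \<epsilon>)\<^sup>2)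
    (\<lambda>x y. 2 * (c1 \<bullet> c2) / (v x y \<bullet> v x y + \<epsilon>) - 4 * ((v x y \<bullet> c1) * (v x y \<bullet> c2)) / (v x y \<bullet> v x y + \<epsilon>)\<^sup>2)
    (\<lambda>x y. (c2 \<bullet> c2) / (v x y \<bullet> v x y + \<epsilon>) - 2 * (v x y \<bullet> c2)\<^sup>2 / (v x y \<bullet> v x y + \<epsilon>)\<^sup>2) K'"
    using test_function_ln[of \<epsilon> c1 c2] e unfolding v_def by auto
  show ?thesis
  proof (intro exI conjI allI impI, rule test_function_half_diff[OF K K'])
    fix x y :: real
    assume xy: "x > 0" "y > 0"
    \<comment> \<open>The generator is regrouped by powers of 1/N1 and 1/N0, with the inner products
      replaced by free real variables so that the identity is purely polynomial in them and in the
      inverses.\<close>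
    have "(2 * m1 / N1 - 2 * m1 / N0) / 2 * p + (2 * m2 / N1 - 2 * m2 / N0) / 2 * q
      + ((w11 / N1 - 2 * m1\<^sup>2 / N1\<^sup>2 - (w11 / N0 - 2 * m1\<^sup>2 / N0\<^sup>2)) / 2
        + \<rho> * ((2 * w12 / N1 - 4 * (m1 * m2) / N1\<^sup>2 - (2 * w12 / N0 - 4 * (m1 * m2) / N0\<^sup>2)) / 2)
        + (w22 / N1 - 2 * m2\<^sup>2 / N1\<^sup>2 - (w22 / N0 - 2 * m2\<^sup>2 / N0\<^sup>2)) / 2)
      = ((2 * (m1 * p + m2 * q) + (w11 + 2 * \<rho> * w12 + w22)) / N1
        - 2 * (m1\<^sup>2 + 2 * \<rho> * (m1 * m2) + m2\<^sup>2) / N1\<^sup>2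
        - ((2 * (m1 * p + m2 * q) + (w11 + 2 * \<rho> * w12 + w22)) / N0
        - 2 * (m1\<^sup>2 + 2 * \<rho> * (m1 * m2) + m2\<^sup>2) / N0\<^sup>2)) / 2"
      for m1 m2 N1 N0 p q w11 w12 w22 :: real
      unfolding divide_inverse by algebra
    note eq = this[of "v x y \<bullet> c1" "v x y \<bullet> v x y + (1 + \<epsilon>)" "v x y \<bullet> v x y + \<epsilon>" "\<alpha> / x + \<beta> / y"
        "v x y \<bullet> c2" "\<gamma> / x + \<delta> / y" "c1 \<bullet> c1" "c1 \<bullet> c2" "c2 \<bullet> c2"]
    show "(2 * (v x y \<bullet> c1) / (v x y \<bullet> v x y + (1 + \<epsilon>)) - 2 * (v x y \<bullet> c1) / (v x y \<bullet> v x y + \<epsilon>)) / 2 * (\<alpha> / x + \<beta> / y)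
      + (2 * (v x y \<bullet> c2) / (v x y \<bullet> v x y + (1 + \<epsilon>)) - 2 * (v x y \<bullet> c2) / (v x y \<bullet> v x y + \<epsilon>)) / 2 * (\<gamma> / x + \<delta> / y)
      + (((c1 \<bullet> c1) / (v x y \<bullet> v x y + (1 + \<epsilon>)) - 2 * (v x y \<bullet> c1)\<^sup>2 / (v x y \<bullet> v x y + (1 + \<epsilon>))\<^sup>2
          - ((c1 \<bullet> c1) / (v x y \<bullet> v x y + \<epsilon>) - 2 * (v x y \<bullet> c1)\<^sup>2 / (v x y \<bullet> v x y + \<epsilon>)\<^sup>2)) / 2
        + \<rho> * ((2 * (c1 \<bullet> c2) / (v x y \<bullet> v x y + (1 + \<epsilon>)) - 4 * ((v x y \<bullet> c1) * (v x y \<bullet> c2)) / (v x y \<bullet> v x y + (1 + \<epsilon>))\<^sup>2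
          - (2 * (c1 \<bullet> c2) / (v x y \<bullet> v x y + \<epsilon>) - 4 * ((v x y \<bullet> c1) * (v x y \<bullet> c2)) / (v x y \<bullet> v x y + \<epsilon>)\<^sup>2)) / 2)
        + ((c2 \<bullet> c2) / (v x y \<bullet> v x y + (1 + \<epsilon>)) - 2 * (v x y \<bullet> c2)\<^sup>2 / (v x y \<bullet> v x y + (1 + \<epsilon>))\<^sup>2
          - ((c2 \<bullet> c2) / (v x y \<bullet> v x y + \<epsilon>) - 2 * (v x y \<bullet> c2)\<^sup>2 / (v x y \<bullet> v x y + \<epsilon>)\<^sup>2)) / 2) \<le> \<theta>"
      unfolding eq by (rule log_ratio_generator_le[OF _ e th drift[OF xy] disp[OF xy]]) simp
  qed
qed

section \<open>The drift along a path\<close>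

lemma set_lebesgue_integral_Icc_diff:
  fixes f :: "real \<Rightarrow> real"
  assumes "p \<le> q" "q \<le> r" "set_integrable lborel {p..r} f"
  shows "(LINT u:{q..r}|lborel. f u) = (LINT u:{p..r}|lborel. f u) - (LINT u:{p..q}|lborel. f u)"
proof -
  have I: "set_integrable lborel {p..q} f" "set_integrable lborel {q..r} f"
    using assms by (auto intro: set_integrable_subset[OF assms(3)])
  have "integral {p..q} f + integral {q..r} f = integral {p..r} f"
    using assms set_borel_integral_eq_integral(1)[OF assms(3)]
    by (intro Henstock_Kurzweil_Integration.integral_combine) auto
  then show ?thesis
    using set_borel_integral_eq_integral(2)[OF assms(3)] set_borel_integral_eq_integral(2)[OF I(1)]
      set_borel_integral_eq_integral(2)[OF I(2)] by simp
qed

text \<open>This is the pathwise content of \<open>O2BP\<close> at one fixed outcome. It makes the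
  drift estimates deterministic, with no question of measurability or integrability in the
  outcome.\<close>

definition o2bp_path :: "real \<Rightarrow> real \<Rightarrow> real \<Rightarrow> real \<Rightarrow> (real \<Rightarrow> real) \<Rightarrow> (real \<Rightarrow> real) \<Rightarrow>
    (real \<Rightarrow> real) \<Rightarrow> (real \<Rightarrow> real) \<Rightarrow> bool" where
  "o2bp_path \<alpha> \<beta> \<gamma> \<delta> b c x y \<longleftrightarrow>
     continuous_on {0..} x \<and> continuous_on {0..} y \<and>
     (\<forall>t\<ge>0. x t \<ge> 0 \<and> y t \<ge> 0 \<and>
        emeasure lborel {s\<in>{0..t}. x s = 0} = 0 \<and> emeasure lborel {s\<in>{0..t}. y s = 0} = 0 \<and>
        set_integrable lborel {0..t} (\<lambda>s. 1 / x s) \<and> set_integrable lborel {0..t} (\<lambda>s. 1 / y s) \<and>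
        x t = x 0 + b t + \<alpha> * (LINT s:{0..t}|lborel. 1 / x s) + \<beta> * (LINT s:{0..t}|lborel. 1 / y s) \<and>
        y t = y 0 + c t + \<gamma> * (LINT s:{0..t}|lborel. 1 / x s) + \<delta> * (LINT s:{0..t}|lborel. 1 / y s))"

lemma o2bp_pathD:
  assumes path: "o2bp_path \<alpha> \<beta> \<gamma> \<delta> b c x y"
  shows "continuous_on {0..} x" "continuous_on {0..} y"
    and "t \<ge> 0 \<Longrightarrow> x t \<ge> 0" "t \<ge> 0 \<Longrightarrow> y t \<ge> 0"
    and "t \<ge> 0 \<Longrightarrow> emeasure lborel {s\<in>{0..t}. x s = 0} = 0"
      "t \<ge> 0 \<Longrightarrow> emeasure lborel {s\<in>{0..t}. y s = 0} = 0"
    and "t \<ge> 0 \<Longrightarrow> set_integrable lborel {0..t} (\<lambda>s. 1 / x s)"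
      "t \<ge> 0 \<Longrightarrow> set_integrable lborel {0..t} (\<lambda>s. 1 / y s)"
    and "t \<ge> 0 \<Longrightarrow> x t = x 0 + b t + \<alpha> * (LINT s:{0..t}|lborel. 1 / x s) + \<beta> * (LINT s:{0..t}|lborel. 1 / y s)"
      "t \<ge> 0 \<Longrightarrow> y t = y 0 + c t + \<gamma> * (LINT s:{0..t}|lborel. 1 / x s) + \<delta> * (LINT s:{0..t}|lborel. 1 / y s)"
  using path[unfolded o2bp_path_def, THEN conjunct1] path[unfolded o2bp_path_def, THEN conjunct2, THEN conjunct1]
    path[unfolded o2bp_path_def, THEN conjunct2, THEN conjunct2, rule_format, of t]
  by blast+

lemma o2bp_path_AE_pos:
  assumes path: "o2bp_path \<alpha> \<beta> \<gamma> \<delta> b c x y" and r: "r \<ge> 0"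
  shows "AE u in lborel. u \<in> {0..r} \<longrightarrow> x u > 0 \<and> y u > 0"
proof -
  have *: "AE u in lborel. u \<in> {0..r} \<longrightarrow> z u \<noteq> 0"
    if c: "continuous_on {0..} z" and e: "emeasure lborel {s\<in>{0..r}. z s = 0} = 0" for z :: "real \<Rightarrow> real"
  proof -
    \<comment> \<open>Closedness supplies the measurability that turns measure zero into membership
      in \<open>null_sets\<close>; the value 0 alone is no information, since
      \<open>emeasure\<close> also assigns it to non-measurable sets.\<close>
    have "closed {s\<in>{0..r}. z s = 0}"
      by (rule continuous_closed_preimage_constant[OF continuous_on_subset[OF c]]) auto
    then have "{s\<in>{0..r}. z s = 0} \<in> null_sets lborel"
      using e by (auto simp: null_sets_def)
    then show ?thesis
      by (rule AE_I') auto
  qed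
  have "AE u in lborel. u \<in> {0..r} \<longrightarrow> x u \<noteq> 0" "AE u in lborel. u \<in> {0..r} \<longrightarrow> y u \<noteq> 0"
    using o2bp_pathD[OF path] r by (blast intro: *)+
  then show ?thesis
  proof eventually_elim
    case (elim u)
    then show ?case
      using o2bp_pathD(3,4)[OF path, of u] by (auto simp: less_le)
  qed
qed

lemma uniformly_continuous_eventually_grid:
  fixes z :: "real \<Rightarrow> real"
  assumes c: "continuous_on {s..t} z" and "s < t" and w: "w > 0"
  shows "eventually (\<lambda>n. \<forall>i<n. \<forall>u\<in>{s + real i * ((t - s) / real n)..s + real (Suc i) * ((t - s) / real n)}.
    \<bar>z u - z (s + real i * ((t - s) / real n))\<bar> \<le> w) sequentially"
proof -
  have "uniformly_continuous_on {s..t} z"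
    using c by (rule compact_uniformly_continuous) auto
  then obtain d where d: "d > 0" "\<And>u u'. u \<in> {s..t} \<Longrightarrow> u' \<in> {s..t} \<Longrightarrow> dist u' u < d \<Longrightarrow> dist (z u') (z u) < w"
    unfolding uniformly_continuous_on_def using w by metis
  obtain N :: nat where N: "(t - s) / d < real N"
    using reals_Archimedean2 by blast
  show ?thesis
  proof (rule eventually_sequentiallyI[of "Suc N"], intro allI impI ballI)
    fix n i u
    assume n: "Suc N \<le> n" and i: "i < n"
      and u: "u \<in> {s + real i * ((t - s) / real n)..s + real (Suc i) * ((t - s) / real n)}"
    define h where "h = (t - s) / real n"
    have hpos: "h > 0" "real n * h = t - s"
      using \<open>s < t\<close> n by (auto simp: h_def)
    have "t - s < real N * d"
      using N d by (simp add: field_simps)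
    also have "\<dots> \<le> real n * d"
      using n d by (intro mult_right_mono) auto
    finally have hd: "h < d"
      using n by (simp add: h_def field_simps)
    have "real (Suc i) * h \<le> real n * h"
      using i hpos by (intro mult_right_mono) auto
    then have le: "s + real (Suc i) * h \<le> t"
      using hpos by simp
    have 0: "0 \<le> real i * h"
      using hpos by simp
    have u': "s + real i * h \<le> u" "u \<le> s + real i * h + h"
      using u by (auto simp: h_def[symmetric] algebra_simps)
    have "s + real i * h \<in> {s..t}" "u \<in> {s..t}" "dist u (s + real i * h) < d"
    proof -
      have "s \<le> s + real i * h" "s + real i * h + h \<le> t"
        using 0 le by (auto simp: algebra_simps)
      then show "s + real i * h \<in> {s..t}" "u \<in> {s..t}" "dist u (s + real i * h) < d"
        using u' hd hpos(1) unfolding dist_real_def atLeastAtMost_iff by linarith+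
    qed
    from d(2)[OF this] show "\<bar>z u - z (s + real i * ((t - s) / real n))\<bar> \<le> w"
      by (simp add: dist_real_def h_def)
  qed
qed

context test_function
begin

lemma K_nonneg: "K \<ge> 0"
  using bound_g1[of 0 0] by linarith

text \<open>The Brownian move is made first, with the drift switched off, and this estimate concerns
  the remaining drift move. Freezing the gradient at the left endpoint turns that move into an
  integral over {p..q}, to which the generator inequality applies at almost every time. In the error
  6 = 4 + 2, the 4 comes from the Taylor step and the 2 from freezing the gradient inside the
  integral; both are multiplied by the small oscillation \<open>w\<close> and by the finite drift
  mass I + J.\<close>

lemma drift_increment_le:
  fixes x y :: "real \<Rightarrow> real" and \<rho> \<alpha> \<beta> \<gamma> \<delta> :: real
  defines "a \<equiv> \<lambda>x y. h11 x y + \<rho> * h12 x y + h22 x y"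
    and "S \<equiv> \<bar>\<alpha>\<bar> + \<bar>\<beta>\<bar> + \<bar>\<gamma>\<bar> + \<bar>\<delta>\<bar>"
  assumes pq: "p \<le> q" and w: "w \<ge> 0"
    and gen: "\<And>x y. x > 0 \<Longrightarrow> y > 0 \<Longrightarrow>
      g1 x y * (\<alpha> / x + \<beta> / y) + g2 x y * (\<gamma> / x + \<delta> / y) + a x y \<le> \<theta>"
    and pos: "AE u in lborel. u \<in> {p..q} \<longrightarrow> x u > 0 \<and> y u > 0"
    and ix: "set_integrable lborel {p..q} (\<lambda>u. 1 / x u)"
    and iy: "set_integrable lborel {p..q} (\<lambda>u. 1 / y u)"
    and I: "I = (LINT u:{p..q}|lborel. 1 / x u)" and J: "J = (LINT u:{p..q}|lborel. 1 / y u)"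
    and eqx: "x q = x p + db + \<alpha> * I + \<beta> * J"
    and eqy: "y q = y p + dc + \<gamma> * I + \<delta> * J"
    and oscx: "\<And>u. u \<in> {p..q} \<Longrightarrow> \<bar>x u - x p\<bar> \<le> w"
    and oscy: "\<And>u. u \<in> {p..q} \<Longrightarrow> \<bar>y u - y p\<bar> \<le> w"
    and osca: "\<And>u. u \<in> {p..q} \<Longrightarrow> \<bar>a (x u) (y u) - a (x p) (y p)\<bar> \<le> w"
    and osc: "\<bar>db\<bar> \<le> w" "\<bar>dc\<bar> \<le> w"
  shows "f (x q) (y q) - f (x p + db) (y p + dc) + (q - p) * a (x p) (y p)
    \<le> (\<theta> + w) * (q - p) + 6 * K * S * w * (I + J)"
proof -
  note K = K_nonneg
  have S: "S \<ge> 0"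
    by (simp add: S_def)
  define D1 where "D1 = \<alpha> * I + \<beta> * J"
  define D2 where "D2 = \<gamma> * I + \<delta> * J"
  define G1 where "G1 = g1 (x p) (y p)"
  define G2 where "G2 = g2 (x p) (y p)"
  have IJ: "I \<ge> 0" "J \<ge> 0"
  proof -
    have "AE u in lborel. u \<in> {p..q} \<longrightarrow> 0 \<le> 1 / x u" "AE u in lborel. u \<in> {p..q} \<longrightarrow> 0 \<le> 1 / y u"
      using pos by (eventually_elim, auto)+
    then show "I \<ge> 0" "J \<ge> 0"
      unfolding I J set_lebesgue_integral_def
      by (auto intro!: integral_nonneg_AE elim!: AE_mp simp: indicator_def)
  qed
  \<comment> \<open>The drift displacement is the total displacement minus the Brownian one, each at
    most \<open>w\<close>. Hence the quadratic Taylor remainder is only \<open>w\<close> times a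
    first-order quantity.\<close>
  have D: "\<bar>D1\<bar> \<le> 2 * w" "\<bar>D2\<bar> \<le> 2 * w"
    using oscx[of q] oscy[of q] osc eqx eqy pq by (auto simp: D1_def D2_def)
  have DS: "\<bar>D1\<bar> + \<bar>D2\<bar> \<le> S * (I + J)"
  proof -
    have "\<bar>D1\<bar> \<le> \<bar>\<alpha>\<bar> * I + \<bar>\<beta>\<bar> * J" "\<bar>D2\<bar> \<le> \<bar>\<gamma>\<bar> * I + \<bar>\<delta>\<bar> * J"
      unfolding D1_def D2_def using IJ by (auto intro!: order_trans[OF abs_triangle_ineq] simp: abs_mult)
    moreover have "0 \<le> \<bar>\<beta>\<bar> * I" "0 \<le> \<bar>\<delta>\<bar> * I" "0 \<le> \<bar>\<alpha>\<bar> * J" "0 \<le> \<bar>\<gamma>\<bar> * J"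
      using IJ by auto
    ultimately show ?thesis
      unfolding S_def by (simp add: algebra_simps)
  qed
  have lip: "\<bar>g1 (x p + r) (y p + r') - G1\<bar> \<le> 2 * K * w" "\<bar>g2 (x p + r) (y p + r') - G2\<bar> \<le> 2 * K * w"
    if "\<bar>r\<bar> \<le> w" "\<bar>r'\<bar> \<le> w" for r r'
  proof -
    have "K * (\<bar>r\<bar> + \<bar>r'\<bar>) \<le> K * (w + w)"
      using that K by (intro mult_left_mono) auto
    also have "\<dots> = 2 * K * w"
      by simp
    finally show "\<bar>g1 (x p + r) (y p + r') - G1\<bar> \<le> 2 * K * w" "\<bar>g2 (x p + r) (y p + r') - G2\<bar> \<le> 2 * K * w"
      using lipschitz_g1[of "x p" r "y p" r'] lipschitz_g2[of "x p" r "y p" r'] unfolding G1_def G2_def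
      by linarith+
  qed
  have "f (x q) (y q) - f (x p + db) (y p + dc)
    \<le> g1 (x p + db) (y p + dc) * D1 + g2 (x p + db) (y p + dc) * D2 + K * (D1\<^sup>2 + D2\<^sup>2)"
  proof -
    have "x q = x p + db + D1" "y q = y p + dc + D2"
      by (simp_all add: D1_def D2_def eqx eqy)
    then show ?thesis
      using taylor2[of "x p + db" D1 "y p + dc" D2] by simp
  qed
  also have "\<dots> \<le> (G1 * D1 + 2 * K * w * \<bar>D1\<bar>) + (G2 * D2 + 2 * K * w * \<bar>D2\<bar>) + K * (2 * w * \<bar>D1\<bar> + 2 * w * \<bar>D2\<bar>)"
  proof -
    have *: "g * d \<le> G * d + 2 * K * w * \<bar>d\<bar>" if "\<bar>g - G\<bar> \<le> 2 * K * w" for g G d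
    proof -
      have "(g - G) * d \<le> \<bar>g - G\<bar> * \<bar>d\<bar>"
        by (metis abs_ge_self abs_mult)
      also have "\<dots> \<le> 2 * K * w * \<bar>d\<bar>"
        using that by (intro mult_right_mono) auto
      finally show ?thesis by (simp add: algebra_simps)
    qed
    have **: "d\<^sup>2 \<le> 2 * w * \<bar>d\<bar>" if "\<bar>d\<bar> \<le> 2 * w" for d
      using mult_right_mono[OF that abs_ge_zero, of d] by (simp add: power2_eq_square abs_mult[symmetric])
    show ?thesis
      by (intro add_mono * lip osc mult_left_mono ** D K)
  qed
  also have "\<dots> = G1 * D1 + G2 * D2 + 4 * K * w * (\<bar>D1\<bar> + \<bar>D2\<bar>)"
    by (simp add: algebra_simps)
  also have "\<dots> \<le> G1 * D1 + G2 * D2 + 4 * K * w * (S * (I + J))"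
    using DS K w by (intro add_left_mono mult_left_mono) auto
  finally have first: "f (x q) (y q) - f (x p + db) (y p + dc)
    \<le> G1 * D1 + G2 * D2 + 4 * K * w * (S * (I + J))" .
  define k1 where "k1 = G1 * \<alpha> + G2 * \<gamma>"
  define k2 where "k2 = G1 * \<beta> + G2 * \<delta>"
  have ic: "set_integrable lborel {p..q} (\<lambda>u. k)" for k :: real
    by (auto simp: set_integrable_def emeasure_lborel_Icc_eq intro!: integrable_mult_left integrable_real_indicator)
  have lc: "(LINT u:{p..q}|lborel. k) = (q - p) * k" for k :: real
    using pq by (simp add: set_lebesgue_integral_def)
  have int_lin: "set_integrable lborel {p..q} (\<lambda>u. r * (1 / x u) + r' * (1 / y u) + k)"
    "(LINT u:{p..q}|lborel. r * (1 / x u) + r' * (1 / y u) + k) = r * I + r' * J + (q - p) * k" for r r' k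
  proof -
    have i: "set_integrable lborel {p..q} (\<lambda>u. r * (1 / x u))" "set_integrable lborel {p..q} (\<lambda>u. r' * (1 / y u))"
      by (rule set_integrable_mult_right, rule ix, rule set_integrable_mult_right, rule iy)
    have i': "set_integrable lborel {p..q} (\<lambda>u. r * (1 / x u) + r' * (1 / y u))"
      by (rule set_integral_add(1)[OF i])
    show "set_integrable lborel {p..q} (\<lambda>u. r * (1 / x u) + r' * (1 / y u) + k)"
      by (rule set_integral_add(1)[OF i' ic])
    show "(LINT u:{p..q}|lborel. r * (1 / x u) + r' * (1 / y u) + k) = r * I + r' * J + (q - p) * k"
      unfolding set_integral_add(2)[OF i' ic] set_integral_add(2)[OF i] lc I J set_integral_mult_right ..
  qed
  \<comment> \<open>The generator inequality is used at the current point (x u, y u), while the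
    gradient and the second-order term on the left are those at time p. The exchange costs 2 K w per
    unit of drift, plus \<open>w\<close> for the second-order term.\<close>
  have ptw: "k1 * (1 / x u) + k2 * (1 / y u) + a (x p) (y p)
      \<le> 2 * K * w * S * (1 / x u) + 2 * K * w * S * (1 / y u) + (\<theta> + w)"
    if u: "u \<in> {p..q}" and p: "x u > 0" "y u > 0" for u
  proof -
    define d1 where "d1 = \<alpha> / x u + \<beta> / y u"
    define d2 where "d2 = \<gamma> / x u + \<delta> / y u"
    have l: "\<bar>g1 (x u) (y u) - G1\<bar> \<le> 2 * K * w" "\<bar>g2 (x u) (y u) - G2\<bar> \<le> 2 * K * w"
      using lip[of "x u - x p" "y u - y p"] oscx[OF u] oscy[OF u] by auto
    have *: "G * d \<le> g * d + 2 * K * w * \<bar>d\<bar>" if "\<bar>g - G\<bar> \<le> 2 * K * w" for g G d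
    proof -
      have "(G - g) * d \<le> \<bar>g - G\<bar> * \<bar>d\<bar>"
        by (metis abs_ge_self abs_mult abs_minus_commute)
      also have "\<dots> \<le> 2 * K * w * \<bar>d\<bar>"
        using that by (intro mult_right_mono) auto
      finally show ?thesis by (simp add: algebra_simps)
    qed
    have "\<bar>d1\<bar> \<le> \<bar>\<alpha>\<bar> * (1 / x u) + \<bar>\<beta>\<bar> * (1 / y u)" "\<bar>d2\<bar> \<le> \<bar>\<gamma>\<bar> * (1 / x u) + \<bar>\<delta>\<bar> * (1 / y u)"
      unfolding d1_def d2_def using p by (auto intro!: order_trans[OF abs_triangle_ineq])
    moreover have "0 \<le> \<bar>\<beta>\<bar> * (1 / x u)" "0 \<le> \<bar>\<delta>\<bar> * (1 / x u)" "0 \<le> \<bar>\<alpha>\<bar> * (1 / y u)" "0 \<le> \<bar>\<gamma>\<bar> * (1 / y u)"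
      using p by auto
    ultimately have dS: "\<bar>d1\<bar> + \<bar>d2\<bar> \<le> S * (1 / x u + 1 / y u)"
      unfolding S_def distrib_left distrib_right by linarith
    have "k1 * (1 / x u) + k2 * (1 / y u) + a (x p) (y p) = G1 * d1 + G2 * d2 + a (x p) (y p)"
      by (simp add: k1_def k2_def d1_def d2_def algebra_simps add_divide_distrib)
    also have "\<dots> \<le> (g1 (x u) (y u) * d1 + 2 * K * w * \<bar>d1\<bar>) + (g2 (x u) (y u) * d2 + 2 * K * w * \<bar>d2\<bar>)
        + (a (x u) (y u) + w)"
      using osca[OF u] by (intro add_mono * l) auto
    also have "\<dots> = (g1 (x u) (y u) * d1 + g2 (x u) (y u) * d2 + a (x u) (y u)) + w + 2 * K * w * (\<bar>d1\<bar> + \<bar>d2\<bar>)"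
      by (simp add: algebra_simps)
    also have "\<dots> \<le> \<theta> + w + 2 * K * w * (S * (1 / x u + 1 / y u))"
      using gen[OF p] dS K w unfolding d1_def d2_def by (intro add_mono mult_left_mono) auto
    finally show ?thesis by (simp add: algebra_simps)
  qed
  have "k1 * I + k2 * J + (q - p) * a (x p) (y p)
    \<le> 2 * K * w * S * I + 2 * K * w * S * J + (q - p) * (\<theta> + w)"
    unfolding int_lin(2)[symmetric] unfolding set_lebesgue_integral_def
  proof (intro integral_mono_AE int_lin(1)[unfolded set_integrable_def])
    show "AE u in lborel. indicat_real {p..q} u *\<^sub>R (k1 * (1 / x u) + k2 * (1 / y u) + a (x p) (y p))
        \<le> indicat_real {p..q} u *\<^sub>R (2 * K * w * S * (1 / x u) + 2 * K * w * S * (1 / y u) + (\<theta> + w))"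
      using pos
    proof eventually_elim
      case (elim u)
      then show ?case
        using ptw[of u] by (cases "u \<in> {p..q}") (auto simp: indicator_def)
    qed
  qed
  moreover have "G1 * D1 + G2 * D2 = k1 * I + k2 * J"
    by (simp add: D1_def D2_def k1_def k2_def algebra_simps)
  ultimately show ?thesis
    using first by (simp add: algebra_simps)
qed


text \<open>Along one path the integrals of 1/x and 1/y over {s..t} are finite and do not depend on
  the partition. The errors of \<open>drift_increment_le\<close> telescope to the oscillation times
  a fixed number, and uniform continuity makes the oscillation as small as needed.\<close>

lemma drift_sum_eventually_le:
  fixes x y b c :: "real \<Rightarrow> real" and \<rho> s t :: real
  defines "a \<equiv> \<lambda>x y. h11 x y + \<rho> * h12 x y + h22 x y"
    and "T \<equiv> \<lambda>n i. s + real i * ((t - s) / real n)"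
  assumes st: "0 \<le> s" "s < t"
    and path: "o2bp_path \<alpha> \<beta> \<gamma> \<delta> b c x y"
    and cb: "continuous_on {0..} b" and cc: "continuous_on {0..} c"
    and gen: "\<And>x y. x > 0 \<Longrightarrow> y > 0 \<Longrightarrow>
      g1 x y * (\<alpha> / x + \<beta> / y) + g2 x y * (\<gamma> / x + \<delta> / y) + a x y \<le> \<theta>"
    and e: "e > 0"
  shows "eventually (\<lambda>n. (\<Sum>i<n. f (x (T n (Suc i))) (y (T n (Suc i)))
      - f (x (T n i) + (b (T n (Suc i)) - b (T n i))) (y (T n i) + (c (T n (Suc i)) - c (T n i)))
      + (t - s) / real n * a (x (T n i)) (y (T n i))) \<le> \<theta> * (t - s) + e) sequentially"
proof -
  define I where "I = (\<lambda>r. LINT u:{0..r}|lborel. 1 / x u)"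
  define J where "J = (\<lambda>r. LINT u:{0..r}|lborel. 1 / y u)"
  define S where "S = \<bar>\<alpha>\<bar> + \<bar>\<beta>\<bar> + \<bar>\<gamma>\<bar> + \<bar>\<delta>\<bar>"
  define V where "V = (I t - I s) + (J t - J s)"
  \<comment> \<open>The absolute value of V makes \<open>E\<close> at least t - s > 0 without a
    separate proof that V is nonnegative, so \<open>e / E\<close> is a legitimate oscillation
    bound.\<close>
  define E where "E = (t - s) + 6 * K * S * \<bar>V\<bar>"
  define w where "w = e / E"
  have "6 * K * S * \<bar>V\<bar> \<ge> 0"
    using K_nonneg by (auto simp: S_def)
  then have E: "E > 0"
    using st by (simp add: E_def)
  have E': "6 * K * S * V \<le> E - (t - s)"
    using K_nonneg by (auto simp: E_def S_def intro!: mult_left_mono)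
  have w: "w > 0"
    using e E by (simp add: w_def)
  have cx: "continuous_on {0..} x" and cy: "continuous_on {0..} y"
    using o2bp_pathD(1,2)[OF path] by auto
  have sub: "{s..t} \<subseteq> {0..}"
    using st by auto
  have ca: "continuous_on {s..t} (\<lambda>u. a (x u) (y u))"
  proof -
    have *: "continuous_on {s..t} (\<lambda>u. h (x u) (y u))"
      if "continuous_on UNIV (\<lambda>p. h (fst p) (snd p))" for h :: "real \<Rightarrow> real \<Rightarrow> real"
    proof -
      have "continuous_on {s..t} (\<lambda>u. (x u, y u))"
        by (intro continuous_on_Pair continuous_on_subset[OF cx sub] continuous_on_subset[OF cy sub])
      from continuous_on_compose2[OF that this] show ?thesis by simp
    qed
    show ?thesis
      unfolding a_def by (intro continuous_intros * cont_h11 cont_h12 cont_h22)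
  qed
  have ev: "eventually (\<lambda>n. \<forall>i<n. \<forall>u\<in>{T n i..T n (Suc i)}. \<bar>z u - z (T n i)\<bar> \<le> w) sequentially"
    if "continuous_on {s..t} z" for z
    unfolding T_def by (rule uniformly_continuous_eventually_grid[OF that st(2) w])
  have "eventually (\<lambda>n. n > 0) sequentially"
    by (rule eventually_gt_at_top)
  then show ?thesis
    using ev[OF continuous_on_subset[OF cx sub]] ev[OF continuous_on_subset[OF cy sub]] ev[OF ca]
      ev[OF continuous_on_subset[OF cb sub]] ev[OF continuous_on_subset[OF cc sub]]
  proof eventually_elim
    case (elim n)
    have h: "(t - s) / real n > 0" "real n * ((t - s) / real n) = t - s"
      using st elim(1) by auto
    have Tdiff: "T n (Suc i) - T n i = (t - s) / real n" for i
      by (simp add: T_def distrib_right add_divide_distrib)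
    then have Tle: "T n i \<le> T n (Suc i)" for i
      using h(1) by (metis diff_ge_0_iff_ge less_imp_le)
    have Tge: "T n i \<ge> 0" for i
      using st h(1) by (auto simp: T_def intro!: add_nonneg_nonneg mult_nonneg_nonneg)
    have T0: "T n 0 = s" "T n n = t"
      using h(2) by (auto simp: T_def)
    have "f (x (T n (Suc i))) (y (T n (Suc i)))
      - f (x (T n i) + (b (T n (Suc i)) - b (T n i))) (y (T n i) + (c (T n (Suc i)) - c (T n i)))
      + (t - s) / real n * a (x (T n i)) (y (T n i))
      \<le> (\<theta> + w) * ((t - s) / real n)
        + 6 * K * S * w * ((I (T n (Suc i)) - I (T n i)) + (J (T n (Suc i)) - J (T n i)))"
      if i: "i < n" for i
    proof -
      define p where "p = T n i"
      define q where "q = T n (Suc i)"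
      have pq: "0 \<le> p" "p \<le> q" "0 \<le> q"
        using Tle Tge by (auto simp: p_def q_def)
      have ii: "set_integrable lborel {0..q} (\<lambda>s. 1 / x s)" "set_integrable lborel {0..q} (\<lambda>s. 1 / y s)"
        using o2bp_pathD(7,8)[OF path pq(3)] by auto
      have eqs: "x r = x 0 + b r + \<alpha> * I r + \<beta> * J r" "y r = y 0 + c r + \<gamma> * I r + \<delta> * J r" if "r \<ge> 0" for r
        unfolding I_def J_def using o2bp_pathD(9,10)[OF path that] by auto
      have "f (x q) (y q) - f (x p + (b q - b p)) (y p + (c q - c p)) + (q - p) * a (x p) (y p)
        \<le> (\<theta> + w) * (q - p) + 6 * K * S * w * ((I q - I p) + (J q - J p))"
        unfolding a_def S_def
      proof (rule drift_increment_le)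
        show "AE u in lborel. u \<in> {p..q} \<longrightarrow> 0 < x u \<and> 0 < y u"
          using o2bp_path_AE_pos[OF path pq(3)] by eventually_elim (use pq in auto)
        show "set_integrable lborel {p..q} (\<lambda>u. 1 / x u)" "set_integrable lborel {p..q} (\<lambda>u. 1 / y u)"
          by (rule set_integrable_subset[OF ii(1)] set_integrable_subset[OF ii(2)]; use pq in auto)+
        show "I q - I p = (LINT u:{p..q}|lborel. 1 / x u)" "J q - J p = (LINT u:{p..q}|lborel. 1 / y u)"
          unfolding I_def J_def using pq ii by (auto simp: set_lebesgue_integral_Icc_diff)
        show "x q = x p + (b q - b p) + \<alpha> * (I q - I p) + \<beta> * (J q - J p)"
          "y q = y p + (c q - c p) + \<gamma> * (I q - I p) + \<delta> * (J q - J p)"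
          using eqs[OF pq(1)] eqs[OF pq(3)] by (simp_all add: algebra_simps)
      qed (use elim i gen w pq in \<open>auto simp: a_def p_def q_def\<close>)
      then show ?thesis
        unfolding p_def q_def Tdiff .
    qed
    then have "(\<Sum>i<n. f (x (T n (Suc i))) (y (T n (Suc i)))
      - f (x (T n i) + (b (T n (Suc i)) - b (T n i))) (y (T n i) + (c (T n (Suc i)) - c (T n i)))
      + (t - s) / real n * a (x (T n i)) (y (T n i)))
      \<le> (\<Sum>i<n. (\<theta> + w) * ((t - s) / real n)
        + 6 * K * S * w * ((I (T n (Suc i)) - I (T n i)) + (J (T n (Suc i)) - J (T n i))))"
      by (intro sum_mono) auto
    also have "\<dots> = (\<theta> + w) * (t - s) + 6 * K * S * w * V"
    proof -
      have "(\<Sum>i<n. (I (T n (Suc i)) - I (T n i)) + (J (T n (Suc i)) - J (T n i))) = V"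
        using sum_lessThan_telescope[of "\<lambda>i. I (T n i)" n] sum_lessThan_telescope[of "\<lambda>i. J (T n i)" n]
        unfolding sum.distrib T0 V_def by simp
      moreover have "(\<Sum>i<n. (\<theta> + w) * ((t - s) / real n)) = (\<theta> + w) * (t - s)"
        using elim(1) by simp
      ultimately show ?thesis
        unfolding sum.distrib sum_distrib_left[symmetric] by simp
    qed
    also have "\<dots> = \<theta> * (t - s) + w * ((t - s) + 6 * K * S * V)"
      by (simp add: algebra_simps)
    also have "\<dots> \<le> \<theta> * (t - s) + w * E"
      using E' w by (intro add_left_mono mult_left_mono) auto
    also have "\<dots> = \<theta> * (t - s) + e"
      using E by (simp add: w_def)
    finally show ?case .
  qed
qed

end

section \<open>The supermartingale inequality\<close>

text \<open>A one-sided Vitali theorem: an L2 bound lets a pathwise upper bound on the limit pass to expectations.\<close>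

lemma (in prob_space) expectation_eventually_le_of_L2_bounded:
  fixes U :: "nat \<Rightarrow> 'a \<Rightarrow> real"
  assumes U[measurable]: "\<And>n. U n \<in> borel_measurable M" and A[measurable]: "A \<in> events"
    and sq: "eventually (\<lambda>n. integrable M (\<lambda>\<omega>. (U n \<omega>)\<^sup>2) \<and> expectation (\<lambda>\<omega>. (U n \<omega>)\<^sup>2) \<le> L) sequentially"
    and lim: "AE \<omega> in M. \<forall>e>0. eventually (\<lambda>n. U n \<omega> \<le> e) sequentially"
    and e: "e > 0"
  shows "eventually (\<lambda>n. expectation (\<lambda>\<omega>. indicator A \<omega> * U n \<omega>) \<le> e) sequentially"
proof -
  \<comment> \<open>The allowance \<open>e\<close> is split evenly: one third for outcomes with U at
    most r, one third for the quadratic term, where \<kappa> is small compared with 1/L, and one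
    third for the probability that U exceeds r.\<close>
  define r where "r = e / 3"
  define \<kappa> where "\<kappa> = e / (3 * (\<bar>L\<bar> + 1))"
  have r: "r > 0" and k: "\<kappa> > 0"
    using e by (auto simp: r_def \<kappa>_def)
  have kL: "\<kappa> * L \<le> r"
  proof -
    have "\<kappa> * L \<le> \<kappa> * (\<bar>L\<bar> + 1)"
      using k by (intro mult_left_mono) auto
    also have "\<dots> = r"
      by (simp add: \<kappa>_def r_def field_simps)
    finally show ?thesis .
  qed
  define J where "J = (\<lambda>n \<omega>. indicator {\<omega> \<in> space M. U n \<omega> > r} \<omega> :: real)"
  have J[measurable]: "J n \<in> borel_measurable M" for n
    unfolding J_def by measurable
  have Jb: "\<bar>J n \<omega>\<bar> \<le> 1" for n \<omega>
    by (simp add: J_def indicator_def)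
  have intJ: "integrable M (J n)" for n
    by (rule integrable_const_bound[where B=1]) (use Jb in auto)
  have "(\<lambda>n. expectation (J n)) \<longlonglongrightarrow> expectation (\<lambda>\<omega>. 0)"
  proof (rule integral_dominated_convergence[where w="\<lambda>_. 1"])
    show "AE \<omega> in M. (\<lambda>n. J n \<omega>) \<longlonglongrightarrow> 0"
      using lim
    proof eventually_elim
      case (elim \<omega>)
      then have "eventually (\<lambda>n. U n \<omega> \<le> r) sequentially"
        using r by blast
      then have "eventually (\<lambda>n. J n \<omega> = 0) sequentially"
        by eventually_elim (simp add: J_def indicator_def)
      then show ?case
        by (rule tendsto_eventually)
    qed
  qed (use Jb in auto)
  then have "eventually (\<lambda>n. expectation (J n) < 4 * \<kappa> * r) sequentially"
    using k r by (intro order_tendstoD(2)) auto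
  then show ?thesis
    using sq
  proof eventually_elim
    case (elim n)
    then have int2: "integrable M (\<lambda>\<omega>. (U n \<omega>)\<^sup>2)" and le: "expectation (\<lambda>\<omega>. (U n \<omega>)\<^sup>2) \<le> L"
      by auto
    \<comment> \<open>A quadratic bound on the event where U exceeds r: the square is charged to the
      L2 bound, while the large constant 1/(4 \<kappa>) is multiplied by a probability that tends to
      0. No lower bound on U is used.\<close>
    have amgm: "u \<le> \<kappa> * u\<^sup>2 + 1 / (4 * \<kappa>)" for u :: real
    proof -
      have "0 \<le> (2 * \<kappa> * u - 1)\<^sup>2 / (4 * \<kappa>)"
        using k by simp
      also have "\<dots> = \<kappa> * u\<^sup>2 - u + 1 / (4 * \<kappa>)"
        using k by (simp add: power2_eq_square field_simps)
      finally show ?thesis by simp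
    qed
    have "AE \<omega> in M. indicator A \<omega> * U n \<omega> \<le> r + \<kappa> * (U n \<omega>)\<^sup>2 + J n \<omega> * (1 / (4 * \<kappa>))"
    proof (rule AE_I2)
      fix \<omega> assume "\<omega> \<in> space M"
      then show "indicator A \<omega> * U n \<omega> \<le> r + \<kappa> * (U n \<omega>)\<^sup>2 + J n \<omega> * (1 / (4 * \<kappa>))"
      proof (cases "U n \<omega> > r")
        case True
        then have "indicator A \<omega> * U n \<omega> \<le> U n \<omega>"
          using r by (auto simp: indicator_def)
        moreover have "J n \<omega> * (1 / (4 * \<kappa>)) = 1 / (4 * \<kappa>)"
          using True \<open>\<omega> \<in> space M\<close> by (simp add: J_def)
        ultimately show ?thesis
          using amgm[of "U n \<omega>"] r by linarith
      next
        case False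
        then have "indicator A \<omega> * U n \<omega> \<le> r"
          using r by (auto simp: indicator_def)
        moreover have "0 \<le> \<kappa> * (U n \<omega>)\<^sup>2" "0 \<le> J n \<omega> * (1 / (4 * \<kappa>))"
          using k by (auto simp: J_def)
        ultimately show ?thesis by linarith
      qed
    qed
    moreover have "integrable M (\<lambda>\<omega>. indicator A \<omega> * U n \<omega>)"
      using square_integrable_imp_integrable[OF U int2] integrable_mult_indicator[OF A] by fastforce
    ultimately have "expectation (\<lambda>\<omega>. indicator A \<omega> * U n \<omega>)
      \<le> expectation (\<lambda>\<omega>. r + \<kappa> * (U n \<omega>)\<^sup>2 + J n \<omega> * (1 / (4 * \<kappa>)))"
      by (intro integral_mono_AE) (use int2 intJ in auto)
    also have "\<dots> = r + \<kappa> * expectation (\<lambda>\<omega>. (U n \<omega>)\<^sup>2) + expectation (J n) * (1 / (4 * \<kappa>))"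
      using int2 intJ by (simp add: prob_space)
    also have "\<dots> \<le> r + \<kappa> * L + (4 * \<kappa> * r) * (1 / (4 * \<kappa>))"
      using le k elim(1) by (intro add_mono mult_left_mono mult_right_mono) auto
    also have "\<dots> \<le> r + r + r"
      using kL k by simp
    also have "\<dots> = e"
      by (simp add: r_def)
    finally show ?case .
  qed
qed

lemma (in prob_space) integrable_bounded_mult:
  fixes G Z :: "'a \<Rightarrow> real"
  assumes [measurable]: "G \<in> borel_measurable M" and Z: "integrable M Z" and k: "\<And>\<omega>. \<bar>G \<omega>\<bar> \<le> k"
  shows "integrable M (\<lambda>\<omega>. G \<omega> * Z \<omega>)"
proof (rule Bochner_Integration.integrable_bound[where f="\<lambda>\<omega>. k * Z \<omega>"])
  show "AE \<omega> in M. norm (G \<omega> * Z \<omega>) \<le> norm (k * Z \<omega>)"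
  proof (rule AE_I2)
    fix \<omega>
    have "\<bar>G \<omega>\<bar> \<le> \<bar>k\<bar>"
      using k[of \<omega>] by linarith
    then show "norm (G \<omega> * Z \<omega>) \<le> norm (k * Z \<omega>)"
      by (simp add: abs_mult mult_right_mono)
  qed
qed (use Z in auto)

section \<open>Conditional moments of increments and discrete stochastic integrals\<close>

context brownian_pair
begin

text \<open>Later \<open>G\<close> is the indicator of a past event times a Taylor coefficient
  evaluated at the left endpoint, so a bounded factor measurable at time s is the right
  generality.\<close>

lemma
  fixes G :: "'a \<Rightarrow> real"
  assumes st: "0 \<le> s" "s < t" and G: "G \<in> borel_measurable (F s)" and k: "\<And>\<omega>. \<bar>G \<omega>\<bar> \<le> k"
  shows integrable_mult_incr:
      "integrable M (\<lambda>\<omega>. G \<omega> * (B t \<omega> - B s \<omega>))" "integrable M (\<lambda>\<omega>. G \<omega> * (C t \<omega> - C s \<omega>))"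
      "integrable M (\<lambda>\<omega>. G \<omega> * (B t \<omega> - B s \<omega>)\<^sup>2)" "integrable M (\<lambda>\<omega>. G \<omega> * (C t \<omega> - C s \<omega>)\<^sup>2)"
      "integrable M (\<lambda>\<omega>. G \<omega> * ((B t \<omega> - B s \<omega>) * (C t \<omega> - C s \<omega>)))"
    and expectation_mult_incr:
      "expectation (\<lambda>\<omega>. G \<omega> * (B t \<omega> - B s \<omega>)) = 0" "expectation (\<lambda>\<omega>. G \<omega> * (C t \<omega> - C s \<omega>)) = 0"
      "expectation (\<lambda>\<omega>. G \<omega> * (B t \<omega> - B s \<omega>)\<^sup>2) = (t - s) * expectation G"
      "expectation (\<lambda>\<omega>. G \<omega> * (C t \<omega> - C s \<omega>)\<^sup>2) = (t - s) * expectation G"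
      "expectation (\<lambda>\<omega>. G \<omega> * ((B t \<omega> - B s \<omega>) * (C t \<omega> - C s \<omega>))) = \<rho> * (t - s) * expectation G"
proof -
  note sub = subalgebra_filtration[OF st(1)]
  have GM: "G \<in> borel_measurable M"
    using measurable_filtration_M[OF st(1) G] .
  have B1: "integrable M (\<lambda>\<omega>. B t \<omega> - B s \<omega>)" and C1: "integrable M (\<lambda>\<omega>. C t \<omega> - C s \<omega>)"
    using integrable_incr_B[OF st, of 1] integrable_incr_C[OF st, of 1] by simp_all
  note I = B1 C1 integrable_incr_B[OF st, of 2] integrable_incr_C[OF st, of 2] integrable_incr_BC[OF st]
  show i: "integrable M (\<lambda>\<omega>. G \<omega> * (B t \<omega> - B s \<omega>))" "integrable M (\<lambda>\<omega>. G \<omega> * (C t \<omega> - C s \<omega>))"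
      "integrable M (\<lambda>\<omega>. G \<omega> * (B t \<omega> - B s \<omega>)\<^sup>2)" "integrable M (\<lambda>\<omega>. G \<omega> * (C t \<omega> - C s \<omega>)\<^sup>2)"
      "integrable M (\<lambda>\<omega>. G \<omega> * ((B t \<omega> - B s \<omega>) * (C t \<omega> - C s \<omega>)))"
    by (intro integrable_bounded_mult[OF GM _ k] I)+
  show "expectation (\<lambda>\<omega>. G \<omega> * (B t \<omega> - B s \<omega>)) = 0"
    using expectation_mult_of_const_on_events[OF sub I(1) _ G i(1), of 0] expectation_incr_B[OF st] by simp
  show "expectation (\<lambda>\<omega>. G \<omega> * (C t \<omega> - C s \<omega>)) = 0"
    using expectation_mult_of_const_on_events[OF sub I(2) _ G i(2), of 0] expectation_incr_C[OF st] by simp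
  show "expectation (\<lambda>\<omega>. G \<omega> * (B t \<omega> - B s \<omega>)\<^sup>2) = (t - s) * expectation G"
    by (rule expectation_mult_of_const_on_events[OF sub I(3) _ G i(3)]) (rule expectation_incr_B_square[OF st])
  show "expectation (\<lambda>\<omega>. G \<omega> * (C t \<omega> - C s \<omega>)\<^sup>2) = (t - s) * expectation G"
    by (rule expectation_mult_of_const_on_events[OF sub I(4) _ G i(4)]) (rule expectation_incr_C_square[OF st])
  show "expectation (\<lambda>\<omega>. G \<omega> * ((B t \<omega> - B s \<omega>) * (C t \<omega> - C s \<omega>))) = \<rho> * (t - s) * expectation G"
    by (rule expectation_mult_of_const_on_events[OF sub I(5) _ G i(5)]) (rule expectation_incr_BC[OF st])
qed

text \<open>An Ito isometry in discrete time, as an inequality and by induction on the number of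
  steps: the next increment is orthogonal to everything measurable at time T n, so the second
  moments add up.\<close>

lemma martingale_transform_L2:
  fixes W :: "real \<Rightarrow> 'a \<Rightarrow> real" and G :: "nat \<Rightarrow> 'a \<Rightarrow> real"
  assumes W: "\<And>t. 0 \<le> t \<Longrightarrow> W t \<in> borel_measurable (F t)"
    and int2: "\<And>s t. 0 \<le> s \<Longrightarrow> s < t \<Longrightarrow> integrable M (\<lambda>\<omega>. (W t \<omega> - W s \<omega>)\<^sup>2)"
    and mart: "\<And>s t A. 0 \<le> s \<Longrightarrow> s < t \<Longrightarrow> A \<in> sets (F s) \<Longrightarrow>
      expectation (\<lambda>\<omega>. indicator A \<omega> * (W t \<omega> - W s \<omega>)) = 0"
    and var: "\<And>s t. 0 \<le> s \<Longrightarrow> s < t \<Longrightarrow> expectation (\<lambda>\<omega>. (W t \<omega> - W s \<omega>)\<^sup>2) \<le> t - s"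
    and T: "0 \<le> T 0" "\<And>i. T i < T (Suc i)"
    and G: "\<And>i. G i \<in> borel_measurable (F (T i))" and k: "\<And>i \<omega>. \<bar>G i \<omega>\<bar> \<le> k"
  shows "integrable M (\<lambda>\<omega>. (\<Sum>i<n. G i \<omega> * (W (T (Suc i)) \<omega> - W (T i) \<omega>))\<^sup>2) \<and>
    expectation (\<lambda>\<omega>. (\<Sum>i<n. G i \<omega> * (W (T (Suc i)) \<omega> - W (T i) \<omega>))\<^sup>2) \<le> k\<^sup>2 * (T n - T 0)"
proof -
  define N where "N = (\<lambda>n \<omega>. \<Sum>i<n. G i \<omega> * (W (T (Suc i)) \<omega> - W (T i) \<omega>))"
  have Tmono: "T i \<le> T j" if "i \<le> j" for i j
    using T(2) that by (metis less_imp_le lift_Suc_mono_le)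
  have T0: "0 \<le> T i" for i
    using T(1) Tmono[of 0 i] by simp
  have Nm: "N n \<in> borel_measurable (F (T n))" for n
    unfolding N_def
    by (intro borel_measurable_sum borel_measurable_times borel_measurable_diff
        measurable_filtration_mono[OF _ _ G] measurable_filtration_mono[OF _ _ W] T0 Tmono) auto
  have "integrable M (\<lambda>\<omega>. (N n \<omega>)\<^sup>2) \<and> expectation (\<lambda>\<omega>. (N n \<omega>)\<^sup>2) \<le> k\<^sup>2 * (T n - T 0)" for n
  proof (induction n)
    case 0
    then show ?case by (simp add: N_def)
  next
    case (Suc n)
    define D where "D = (\<lambda>\<omega>. W (T (Suc n)) \<omega> - W (T n) \<omega>)"
    have [measurable]: "N n \<in> borel_measurable M" "G n \<in> borel_measurable M"
      by (rule measurable_filtration_M[OF T0 Nm] measurable_filtration_M[OF T0 G])+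
    have [measurable]: "D \<in> borel_measurable M"
      unfolding D_def by (intro borel_measurable_diff measurable_filtration_M[OF T0 W] T0)
    have D2: "integrable M (\<lambda>\<omega>. (D \<omega>)\<^sup>2)"
      unfolding D_def by (rule int2[OF T0 T(2)])
    then have D1: "integrable M D"
      by (rule square_integrable_imp_integrable[rotated]) auto
    have N2: "integrable M (\<lambda>\<omega>. (N n \<omega>)\<^sup>2)"
      using Suc by simp
    have k2: "(G n \<omega>)\<^sup>2 \<le> k\<^sup>2" for \<omega>
      using k[of n \<omega>] by (metis abs_ge_zero power2_abs power_mono)
    have GD2: "integrable M (\<lambda>\<omega>. (G n \<omega>)\<^sup>2 * (D \<omega>)\<^sup>2)"
      using k2 by (intro integrable_bounded_mult[OF _ D2, of _ "k\<^sup>2"]) auto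
    \<comment> \<open>The past sum \<open>N n\<close> is unbounded, so the integrability of the
      cross term must come from 2 |p q| <= p^2 + q^2 and the induction hypothesis before the
      conditional mean zero can be used.\<close>
    have cross: "integrable M (\<lambda>\<omega>. (N n \<omega> * G n \<omega>) * D \<omega>)"
    proof (rule Bochner_Integration.integrable_bound[where f="\<lambda>\<omega>. (N n \<omega>)\<^sup>2 + (G n \<omega>)\<^sup>2 * (D \<omega>)\<^sup>2"])
      show "AE \<omega> in M. norm (N n \<omega> * G n \<omega> * D \<omega>) \<le> norm ((N n \<omega>)\<^sup>2 + (G n \<omega>)\<^sup>2 * (D \<omega>)\<^sup>2)"
      proof (rule AE_I2)
        fix \<omega>
        have "2 * \<bar>N n \<omega>\<bar> * \<bar>G n \<omega> * D \<omega>\<bar> \<le> \<bar>N n \<omega>\<bar>\<^sup>2 + \<bar>G n \<omega> * D \<omega>\<bar>\<^sup>2"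
          by (rule sum_squares_bound)
        moreover have "0 \<le> \<bar>N n \<omega>\<bar> * \<bar>G n \<omega> * D \<omega>\<bar>"
          by simp
        ultimately have "\<bar>N n \<omega>\<bar> * \<bar>G n \<omega> * D \<omega>\<bar> \<le> \<bar>N n \<omega>\<bar>\<^sup>2 + \<bar>G n \<omega> * D \<omega>\<bar>\<^sup>2"
          by linarith
        then show "norm (N n \<omega> * G n \<omega> * D \<omega>) \<le> norm ((N n \<omega>)\<^sup>2 + (G n \<omega>)\<^sup>2 * (D \<omega>)\<^sup>2)"
          by (simp add: abs_mult power_mult_distrib mult.assoc)
      qed
    qed (use N2 GD2 in auto)
    have exp: "(N (Suc n) \<omega>)\<^sup>2 = (N n \<omega>)\<^sup>2 + 2 * ((N n \<omega> * G n \<omega>) * D \<omega>) + (G n \<omega>)\<^sup>2 * (D \<omega>)\<^sup>2" for \<omega>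
      by (simp add: N_def D_def power2_eq_square algebra_simps)
    have "expectation (\<lambda>\<omega>. (N n \<omega> * G n \<omega>) * D \<omega>) = 0 * expectation (\<lambda>\<omega>. N n \<omega> * G n \<omega>)"
    proof (rule expectation_mult_of_const_on_events[OF subalgebra_filtration[OF T0[of n]] D1 _ _ cross])
      show "(\<lambda>\<omega>. N n \<omega> * G n \<omega>) \<in> borel_measurable (F (T n))"
        using Nm[of n] G[of n] by measurable
      show "expectation (\<lambda>\<omega>. indicator A \<omega> * D \<omega>) = 0 * prob A" if "A \<in> sets (F (T n))" for A
        unfolding D_def using mart[OF T0 T(2) that] by simp
    qed
    then have "expectation (\<lambda>\<omega>. (N (Suc n) \<omega>)\<^sup>2)
      = expectation (\<lambda>\<omega>. (N n \<omega>)\<^sup>2) + expectation (\<lambda>\<omega>. (G n \<omega>)\<^sup>2 * (D \<omega>)\<^sup>2)"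
      unfolding exp using N2 GD2 cross by simp
    also have "expectation (\<lambda>\<omega>. (G n \<omega>)\<^sup>2 * (D \<omega>)\<^sup>2) \<le> expectation (\<lambda>\<omega>. k\<^sup>2 * (D \<omega>)\<^sup>2)"
      using GD2 D2 k2 by (intro integral_mono) (auto intro!: mult_right_mono)
    also have "\<dots> \<le> k\<^sup>2 * (T (Suc n) - T n)"
      using var[OF T0 T(2), of n] by (simp add: D_def mult_left_mono)
    finally have "expectation (\<lambda>\<omega>. (N (Suc n) \<omega>)\<^sup>2) \<le> k\<^sup>2 * (T (Suc n) - T 0)"
      using Suc by (simp add: algebra_simps)
    moreover have "integrable M (\<lambda>\<omega>. (N (Suc n) \<omega>)\<^sup>2)"
      unfolding exp using N2 GD2 cross by auto
    ultimately show ?case by simp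
  qed
  then show ?thesis
    unfolding N_def by blast
qed

end


section \<open>The test function evaluated along the solution\<close>

lemma measurable_two_args:
  fixes h :: "real \<Rightarrow> real \<Rightarrow> real"
  assumes "continuous_on UNIV (\<lambda>p. h (fst p) (snd p))" "x \<in> borel_measurable N" "y \<in> borel_measurable N"
  shows "(\<lambda>\<omega>. h (x \<omega>) (y \<omega>)) \<in> borel_measurable N"
proof -
  have "(\<lambda>\<omega>. (x \<omega>, y \<omega>)) \<in> borel_measurable N"
    using assms(2,3) by simp
  from measurable_compose[OF this borel_measurable_continuous_onI[OF assms(1)]] show ?thesis
    by simp
qed

text \<open>The bound on f is required on the whole plane because the intermediate points, a
  position plus a Brownian increment without drift, may leave the quadrant. The generator inequality
  is required only in the open quadrant, where the path is at almost every time.\<close>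

locale o2bp_test_function =
  brownian_pair M F \<rho> B C + test_function f g1 g2 h11 h12 h22 K
  for M :: "'a measure" and F \<rho> B C f g1 g2 h11 h12 h22 K +
  fixes X Y :: "real \<Rightarrow> 'a \<Rightarrow> real" and \<alpha> \<beta> \<gamma> \<delta> \<theta> k :: real
  assumes adapted_X: "adapted F X" and adapted_Y: "adapted F Y"
    and paths: "AE \<omega> in M. o2bp_path \<alpha> \<beta> \<gamma> \<delta> (\<lambda>t. B t \<omega>) (\<lambda>t. C t \<omega>) (\<lambda>t. X t \<omega>) (\<lambda>t. Y t \<omega>)"
    and generator: "\<And>x y. x > 0 \<Longrightarrow> y > 0 \<Longrightarrow>
      g1 x y * (\<alpha> / x + \<beta> / y) + g2 x y * (\<gamma> / x + \<delta> / y) + (h11 x y + \<rho> * h12 x y + h22 x y) \<le> \<theta>"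
    and bounded_f: "\<And>x y. \<bar>f x y\<bar> \<le> k"
begin

text \<open>In terms of second derivatives this is (f_xx + 2 rho f_xy + f_yy) / 2, the Ito
  correction: \<open>h11\<close> and \<open>h22\<close> already carry the factor 1/2, and
  \<open>h12\<close> is the full mixed derivative.\<close>

definition half_trace :: "real \<Rightarrow> real \<Rightarrow> real" where
  "half_trace x y = h11 x y + \<rho> * h12 x y + h22 x y"

lemma bounded_half_trace: "\<bar>half_trace x y\<bar> \<le> 3 * K"
proof -
  have "\<bar>\<rho> * h12 x y\<bar> \<le> 1 * K"
    unfolding abs_mult using rho bound_h12[of x y] by (intro mult_mono) auto
  then show ?thesis
    unfolding half_trace_def using bound_h11[of x y] bound_h22[of x y] by linarith
qed

lemma cont_half_trace: "continuous_on UNIV (\<lambda>p. half_trace (fst p) (snd p))"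
  unfolding half_trace_def by (intro continuous_intros cont_h11 cont_h12 cont_h22)

lemma measurable_XY:
  assumes "0 \<le> t"
  shows "X t \<in> borel_measurable (F t)" "Y t \<in> borel_measurable (F t)"
  using adapted_X adapted_Y assms by (auto simp: adapted_def)

lemma measurable_at_XY:
  fixes h :: "real \<Rightarrow> real \<Rightarrow> real"
  assumes "continuous_on UNIV (\<lambda>p. h (fst p) (snd p))" "0 \<le> t"
  shows "(\<lambda>\<omega>. h (X t \<omega>) (Y t \<omega>)) \<in> borel_measurable (F t)"
  by (rule measurable_two_args[OF assms(1) measurable_XY[OF assms(2)]])

lemma measurable_M:
  assumes "0 \<le> t"
  shows "X t \<in> borel_measurable M" "Y t \<in> borel_measurable M" "B t \<in> borel_measurable M" "C t \<in> borel_measurable M"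
  using measurable_filtration_M[OF assms] measurable_XY[OF assms] measurable_B[OF assms] measurable_C[OF assms]
  by auto

text \<open>The Taylor point is known at time p, so conditionally on the past the linear terms
  vanish and the quadratic ones give the half trace times q - p. The error is of order (q -
  p)^(3/2), hence negligible after summation over a partition.\<close>

lemma gaussian_step:
  assumes pq: "0 \<le> p" "p < q" and A: "A \<in> sets (F p)"
  shows "expectation (\<lambda>\<omega>. indicator A \<omega> * (f (X p \<omega> + (B q \<omega> - B p \<omega>)) (Y p \<omega> + (C q \<omega> - C p \<omega>)) - f (X p \<omega>) (Y p \<omega>)))
    \<le> (q - p) * expectation (\<lambda>\<omega>. indicator A \<omega> * half_trace (X p \<omega>) (Y p \<omega>)) + 4 * K * ((q - p) * sqrt (q - p))"
proof -
  define b where "b = (\<lambda>\<omega>. B q \<omega> - B p \<omega>)"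
  define c where "c = (\<lambda>\<omega>. C q \<omega> - C p \<omega>)"
  define h where "h = q - p"
  have bd: "b \<omega> = B q \<omega> - B p \<omega>" and cd: "c \<omega> = C q \<omega> - C p \<omega>" for \<omega>
    by (simp_all add: b_def c_def)
  have h: "h > 0"
    using pq by (simp add: h_def)
  have q0: "0 \<le> q"
    using pq by simp
  note [measurable] = measurable_M[OF pq(1)] measurable_M[OF q0]
  have [measurable]: "b \<in> borel_measurable M" "c \<in> borel_measurable M"
    unfolding b_def c_def by measurable
  have AM[measurable]: "A \<in> events"
    using filtration_event pq A by auto
  define G where "G = (\<lambda>g \<omega>. indicator A \<omega> * g (X p \<omega>) (Y p \<omega>) :: real)"
  have Gm: "G g \<in> borel_measurable (F p)" if "continuous_on UNIV (\<lambda>p. g (fst p) (snd p))" for g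
    unfolding G_def using measurable_at_XY[OF that pq(1)] A by measurable
  have Gb: "\<bar>G g \<omega>\<bar> \<le> K" if "\<And>x y. \<bar>g x y\<bar> \<le> K" for g \<omega>
    unfolding G_def using that[of "X p \<omega>" "Y p \<omega>"] K_nonneg by (auto simp: indicator_def)
  have Gint: "integrable M (G g)" if "continuous_on UNIV (\<lambda>p. g (fst p) (snd p))" "\<And>x y. \<bar>g x y\<bar> \<le> K" for g
    by (rule integrable_const_bound[where B=K]) (use Gb[of g] that measurable_filtration_M[OF pq(1) Gm] in auto)
  note I1 = integrable_mult_incr[OF pq Gm[OF cont_g1] Gb[OF bound_g1], folded bd cd]
  note I2 = integrable_mult_incr[OF pq Gm[OF cont_g2] Gb[OF bound_g2], folded bd cd]
  note I11 = integrable_mult_incr[OF pq Gm[OF cont_h11] Gb[OF bound_h11], folded bd cd]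
  note I12 = integrable_mult_incr[OF pq Gm[OF cont_h12] Gb[OF bound_h12], folded bd cd]
  note I22 = integrable_mult_incr[OF pq Gm[OF cont_h22] Gb[OF bound_h22], folded bd cd]
  note E1 = expectation_mult_incr[OF pq Gm[OF cont_g1] Gb[OF bound_g1], folded bd cd h_def]
  note E2 = expectation_mult_incr[OF pq Gm[OF cont_g2] Gb[OF bound_g2], folded bd cd h_def]
  note E11 = expectation_mult_incr[OF pq Gm[OF cont_h11] Gb[OF bound_h11], folded bd cd h_def]
  note E12 = expectation_mult_incr[OF pq Gm[OF cont_h12] Gb[OF bound_h12], folded bd cd h_def]
  note E22 = expectation_mult_incr[OF pq Gm[OF cont_h22] Gb[OF bound_h22], folded bd cd h_def]
  note ib = integrable_incr_B[OF pq, folded bd] integrable_incr_C[OF pq, folded cd]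
  define R where "R = (\<lambda>\<omega>. K * ((sqrt h * (b \<omega>)\<^sup>2 + (b \<omega>) ^ 4 / sqrt h) / 2 + (sqrt h * (c \<omega>)\<^sup>2 + (c \<omega>) ^ 4 / sqrt h) / 2))"
  have Rint: "integrable M R"
    unfolding R_def using ib by (auto intro!: integrable_mult_right Bochner_Integration.integrable_add integrable_divide)
  have ER: "expectation R = 4 * K * (h * sqrt h)"
  proof -
    have sp: "space M \<in> sets (F p)"
      using space_in_filtration pq by simp
    have ind: "expectation (\<lambda>\<omega>. indicator (space M) \<omega> * z \<omega>) = expectation z" for z :: "'a \<Rightarrow> real"
      by (rule Bochner_Integration.integral_cong) auto
    have e2: "expectation (\<lambda>\<omega>. (b \<omega>)\<^sup>2) = h" "expectation (\<lambda>\<omega>. (c \<omega>)\<^sup>2) = h"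
      using expectation_incr_B_square[OF pq sp] expectation_incr_C_square[OF pq sp]
      by (simp_all add: ind prob_space b_def c_def h_def)
    have e4: "expectation (\<lambda>\<omega>. b \<omega> ^ 4) = 3 * h\<^sup>2" "expectation (\<lambda>\<omega>. c \<omega> ^ 4) = 3 * h\<^sup>2"
      using expectation_incr_B_four[OF pq] expectation_incr_C_four[OF pq] by (simp_all add: b_def c_def h_def)
    have "expectation R = K * ((sqrt h * h + 3 * h\<^sup>2 / sqrt h) / 2 + (sqrt h * h + 3 * h\<^sup>2 / sqrt h) / 2)"
      unfolding R_def using ib by (simp add: e2 e4)
    also have "h\<^sup>2 / sqrt h = h * sqrt h"
      using h by (simp add: power2_eq_square real_div_sqrt flip: times_divide_eq_right)
    then have "3 * h\<^sup>2 / sqrt h = 3 * (h * sqrt h)"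
      by (simp only: times_divide_eq_right[symmetric])
    then have "K * ((sqrt h * h + 3 * h\<^sup>2 / sqrt h) / 2 + (sqrt h * h + 3 * h\<^sup>2 / sqrt h) / 2) = 4 * K * (h * sqrt h)"
      by (simp add: algebra_simps)
    finally show ?thesis .
  qed
  \<comment> \<open>The weighted arithmetic-geometric mean of z^2 and z^4 replaces the absolute
    third moment by even moments. With weight sqrt h both halves have order h^(3/2): each coordinate
    contributes (1 + 3) / 2 = 2, which explains the 4 in the error.\<close>
  have cube: "\<bar>z\<bar> ^ 3 \<le> (sqrt h * z\<^sup>2 + z ^ 4 / sqrt h) / 2" for z :: real
  proof -
    define r where "r = sqrt h"
    have r: "r > 0"
      using h by (simp add: r_def)
    have "0 \<le> z\<^sup>2 * (\<bar>z\<bar> - r)\<^sup>2 / r"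
      using r by simp
    also have "\<dots> = z ^ 4 / r - 2 * \<bar>z\<bar> ^ 3 + r * z\<^sup>2"
      using r by (simp add: field_simps eval_nat_numeral abs_mult_self_eq)
    finally show ?thesis
      by (simp add: r_def)
  qed
  define lin where "lin = (\<lambda>\<omega>. (G g1 \<omega> * b \<omega> + G g2 \<omega> * c \<omega>)
    + (G h11 \<omega> * (b \<omega>)\<^sup>2 + G h12 \<omega> * (b \<omega> * c \<omega>) + G h22 \<omega> * (c \<omega>)\<^sup>2))"
  have lint: "integrable M lin"
    unfolding lin_def by (intro Bochner_Integration.integrable_add I1 I2 I11 I12 I22)
  have "expectation lin = h * expectation (G h11) + \<rho> * h * expectation (G h12) + h * expectation (G h22)"
    unfolding lin_def using I1 I2 I11 I12 I22 by (simp add: E1 E2 E11 E12 E22)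
  also have "\<dots> = h * expectation (\<lambda>\<omega>. G h11 \<omega> + \<rho> * G h12 \<omega> + G h22 \<omega>)"
    using Gint[OF cont_h11 bound_h11] Gint[OF cont_h12 bound_h12] Gint[OF cont_h22 bound_h22]
    by (simp add: algebra_simps)
  also have "(\<lambda>\<omega>. G h11 \<omega> + \<rho> * G h12 \<omega> + G h22 \<omega>) = G half_trace"
    by (auto simp: G_def half_trace_def algebra_simps)
  finally have Elin: "expectation lin = h * expectation (G half_trace)" .
  have ptw: "indicator A \<omega> * (f (X p \<omega> + b \<omega>) (Y p \<omega> + c \<omega>) - f (X p \<omega>) (Y p \<omega>)) \<le> lin \<omega> + R \<omega>" for \<omega>
  proof -
    have "f (X p \<omega> + b \<omega>) (Y p \<omega> + c \<omega>) - f (X p \<omega>) (Y p \<omega>)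
      \<le> (g1 (X p \<omega>) (Y p \<omega>) * b \<omega> + g2 (X p \<omega>) (Y p \<omega>) * c \<omega>)
      + (h11 (X p \<omega>) (Y p \<omega>) * (b \<omega>)\<^sup>2 + h12 (X p \<omega>) (Y p \<omega>) * (b \<omega> * c \<omega>) + h22 (X p \<omega>) (Y p \<omega>) * (c \<omega>)\<^sup>2)
      + K * (\<bar>b \<omega>\<bar> ^ 3 + \<bar>c \<omega>\<bar> ^ 3)"
      using taylor3[of "X p \<omega>" "b \<omega>" "Y p \<omega>" "c \<omega>"] by linarith
    moreover have "K * (\<bar>b \<omega>\<bar> ^ 3 + \<bar>c \<omega>\<bar> ^ 3) \<le> R \<omega>"
      unfolding R_def using cube K_nonneg by (intro mult_left_mono add_mono) auto
    moreover have "0 \<le> K * (\<bar>b \<omega>\<bar> ^ 3 + \<bar>c \<omega>\<bar> ^ 3)"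
      using K_nonneg by simp
    ultimately show ?thesis
      by (cases "\<omega> \<in> A") (simp_all add: lin_def G_def)
  qed
  have "expectation (\<lambda>\<omega>. indicator A \<omega> * (f (X p \<omega> + b \<omega>) (Y p \<omega> + c \<omega>) - f (X p \<omega>) (Y p \<omega>)))
    \<le> expectation (\<lambda>\<omega>. lin \<omega> + R \<omega>)"
  proof (intro integral_mono ptw Bochner_Integration.integrable_add lint Rint)
    have "(\<lambda>\<omega>. f (X p \<omega> + b \<omega>) (Y p \<omega> + c \<omega>)) \<in> borel_measurable M" "(\<lambda>\<omega>. f (X p \<omega>) (Y p \<omega>)) \<in> borel_measurable M"
      by (rule measurable_two_args[OF cont_f]; measurable)+
    then show "integrable M (\<lambda>\<omega>. indicator A \<omega> * (f (X p \<omega> + b \<omega>) (Y p \<omega> + c \<omega>) - f (X p \<omega>) (Y p \<omega>)))"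
    proof (intro integrable_const_bound[where B="2 * k"] AE_I2)
      fix \<omega>
      show "norm (indicator A \<omega> * (f (X p \<omega> + b \<omega>) (Y p \<omega> + c \<omega>) - f (X p \<omega>) (Y p \<omega>))) \<le> 2 * k"
        using bounded_f[of "X p \<omega> + b \<omega>" "Y p \<omega> + c \<omega>"] bounded_f[of "X p \<omega>" "Y p \<omega>"]
        by (auto simp: indicator_def)
    qed measurable
  qed
  also have "\<dots> = h * expectation (G half_trace) + 4 * K * (h * sqrt h)"
    using lint Rint by (simp add: Elin ER)
  finally show ?thesis
    unfolding b_def c_def h_def G_def .
qed


text \<open>Each grid increment of f is routed through the point \<open>\<psi>\<close> reached by
  the Brownian move alone. The part from \<open>\<phi>\<close> to \<open>\<psi>\<close> is handled
  in expectation by \<open>gaussian_step\<close>, the part from \<open>\<psi>\<close> to the next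
  \<open>\<phi>\<close> path by path. \<open>U\<close> collects the latter parts with the half
  traces and the target \<theta> (t - s), so that its pathwise upper limit is at most 0.\<close>

lemma supermartingale_inequality:
  assumes st: "0 \<le> s" "s < t" and A: "A \<in> sets (F s)"
  shows "expectation (\<lambda>\<omega>. indicator A \<omega> * f (X t \<omega>) (Y t \<omega>))
    \<le> expectation (\<lambda>\<omega>. indicator A \<omega> * f (X s \<omega>) (Y s \<omega>)) + \<theta> * (t - s) * prob A"
proof -
  define T where "T = (\<lambda>n i. s + real i * ((t - s) / real n))"
  define b where "b = (\<lambda>n i \<omega>. B (T n (Suc i)) \<omega> - B (T n i) \<omega>)"
  define c where "c = (\<lambda>n i \<omega>. C (T n (Suc i)) \<omega> - C (T n i) \<omega>)"
  define \<phi> where "\<phi> = (\<lambda>n i \<omega>. f (X (T n i) \<omega>) (Y (T n i) \<omega>))"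
  define \<psi> where "\<psi> = (\<lambda>n i \<omega>. f (X (T n i) \<omega> + b n i \<omega>) (Y (T n i) \<omega> + c n i \<omega>))"
  define G where "G = (\<lambda>(g :: real \<Rightarrow> real \<Rightarrow> real) n i \<omega>. g (X (T n i) \<omega>) (Y (T n i) \<omega>))"
  define U where "U = (\<lambda>n \<omega>. (\<Sum>i<n. \<phi> n (Suc i) \<omega> - \<psi> n i \<omega> + (t - s) / real n * G half_trace n i \<omega>) - \<theta> * (t - s))"
  have T0: "0 \<le> T n i" for n i
    using st by (auto simp: T_def intro!: add_nonneg_nonneg mult_nonneg_nonneg divide_nonneg_nonneg)
  have sT: "s \<le> T n i" for n i
    using st by (auto simp: T_def intro!: mult_nonneg_nonneg divide_nonneg_nonneg)
  have Tends: "T n 0 = s" "n > 0 \<Longrightarrow> T n n = t" for n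
    by (auto simp: T_def)
  have Tstep: "T n (Suc i) - T n i = (t - s) / real n" for n i
    by (simp add: T_def distrib_right add_divide_distrib)
  have Tless: "T n i < T n (Suc i)" if "n > 0" for n i
    using Tstep[of n i] st that by (metis diff_gt_0_iff_gt divide_pos_pos of_nat_0_less_iff)
  note meas = measurable_M[OF T0]
  have bm[measurable]: "b n i \<in> borel_measurable M" and cm[measurable]: "c n i \<in> borel_measurable M" for n i
    unfolding b_def c_def using meas by (auto intro!: borel_measurable_diff)
  have AM[measurable]: "A \<in> events"
    using filtration_event st A by auto
  have GF: "G g n i \<in> borel_measurable (F (T n i))" if "continuous_on UNIV (\<lambda>p. g (fst p) (snd p))" for g n i
    unfolding G_def by (rule measurable_at_XY[OF that T0])
  have GM: "G g n i \<in> borel_measurable M" if "continuous_on UNIV (\<lambda>p. g (fst p) (snd p))" for g n i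
    by (rule measurable_filtration_M[OF T0 GF[OF that]])
  have am[measurable]: "G half_trace n i \<in> borel_measurable M" for n i
    by (rule GM[OF cont_half_trace])
  have \<phi>m[measurable]: "\<phi> n i \<in> borel_measurable M" for n i
    using GM[OF cont_f, of n i] by (simp add: \<phi>_def G_def)
  have \<psi>m[measurable]: "\<psi> n i \<in> borel_measurable M" for n i
    unfolding \<psi>_def using meas by (intro measurable_two_args[OF cont_f] borel_measurable_add) auto
  have Um[measurable]: "U n \<in> borel_measurable M" for n
    unfolding U_def by measurable
  have int: "integrable M (\<lambda>\<omega>. indicator A \<omega> * z \<omega>)"
    if [measurable]: "z \<in> borel_measurable M" and "\<And>\<omega>. \<bar>z \<omega>\<bar> \<le> r" for z :: "'a \<Rightarrow> real" and r
  proof (rule integrable_const_bound[where B=r])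
    show "AE \<omega> in M. norm (indicator A \<omega> * z \<omega>) \<le> r"
      using that(2) by (intro AE_I2) (auto simp: indicator_def intro: order_trans[OF abs_ge_zero])
  qed measurable
  have int\<phi>: "integrable M (\<lambda>\<omega>. indicator A \<omega> * \<phi> n i \<omega>)"
    and int\<psi>: "integrable M (\<lambda>\<omega>. indicator A \<omega> * \<psi> n i \<omega>)"
    and inta: "integrable M (\<lambda>\<omega>. indicator A \<omega> * G half_trace n i \<omega>)" for n i
  proof -
    show "integrable M (\<lambda>\<omega>. indicator A \<omega> * \<phi> n i \<omega>)"
      by (rule int[OF \<phi>m, of _ _ k]) (simp add: \<phi>_def bounded_f)
    show "integrable M (\<lambda>\<omega>. indicator A \<omega> * \<psi> n i \<omega>)"
      by (rule int[OF \<psi>m, of _ _ k]) (simp add: \<psi>_def bounded_f)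
    show "integrable M (\<lambda>\<omega>. indicator A \<omega> * G half_trace n i \<omega>)"
      by (rule int[OF am, of _ _ "3 * K"]) (simp add: G_def bounded_half_trace)
  qed

  have lim: "AE \<omega> in M. \<forall>e>0. eventually (\<lambda>n. U n \<omega> \<le> e) sequentially"
  proof -
    have "AE \<omega> in M. continuous_on {0..} (\<lambda>t. B t \<omega>) \<and> continuous_on {0..} (\<lambda>t. C t \<omega>)"
      using brownian[unfolded corr_brownian_def, THEN conjunct2, THEN conjunct2, THEN conjunct1]
      by eventually_elim auto
    with paths show ?thesis
    proof eventually_elim
      case (elim \<omega>)
      show ?case
      proof (intro allI impI)
        fix e :: real assume "e > 0"
        with elim have "eventually (\<lambda>n. (\<Sum>i<n. \<phi> n (Suc i) \<omega> - \<psi> n i \<omega> + (t - s) / real n * G half_trace n i \<omega>)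
          \<le> \<theta> * (t - s) + e) sequentially"
          unfolding \<phi>_def \<psi>_def G_def b_def c_def T_def half_trace_def
          by (intro drift_sum_eventually_le[OF st _ _ _ generator]) auto
        then show "eventually (\<lambda>n. U n \<omega> \<le> e) sequentially"
          by eventually_elim (simp add: U_def)
      qed
    qed
  qed

  \<comment> \<open>\<open>L\<close> is a bound for the second moment of \<open>U n\<close> that
    does not depend on n. The factor 4 is the number of terms in the decomposition P - M1 - M2 -
    \<zeta> used below, and \<open>Q\<close> bounds the part P pointwise.\<close>
  define Q where "Q = 2 * k + 3 * K * (t - s) + \<bar>\<theta>\<bar> * (t - s)"
  define L where "L = 4 * (Q\<^sup>2 + K\<^sup>2 * (t - s) + K\<^sup>2 * (t - s) + K\<^sup>2 * (12 * (t - s)\<^sup>2))"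
  have sq: "integrable M (\<lambda>\<omega>. (U n \<omega>)\<^sup>2) \<and> expectation (\<lambda>\<omega>. (U n \<omega>)\<^sup>2) \<le> L" if n: "n > 0" for n
  proof -
    define M1 where "M1 = (\<lambda>\<omega>. \<Sum>i<n. G g1 n i \<omega> * b n i \<omega>)"
    define M2 where "M2 = (\<lambda>\<omega>. \<Sum>i<n. G g2 n i \<omega> * c n i \<omega>)"
    define q where "q = (\<lambda>i \<omega>. (b n i \<omega>)\<^sup>2 + (c n i \<omega>)\<^sup>2)"
    \<comment> \<open>By Cauchy-Schwarz this dominates the square of the sum of all squared
      increments. Its mean is n * n * 2 * (3 + 3) * ((t - s) / n)^2 = 12 (t - s)^2, uniformly in
      n.\<close>
    define Z where "Z = (\<lambda>\<omega>. real n * (\<Sum>i<n. 2 * (b n i \<omega> ^ 4 + c n i \<omega> ^ 4)))"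
    have sp: "space M \<in> sets (F r)" if "0 \<le> r" for r
      using space_in_filtration that by simp
    have ind: "expectation (\<lambda>\<omega>. indicator (space M) \<omega> * z \<omega>) = expectation z" for z :: "'a \<Rightarrow> real"
      by (rule Bochner_Integration.integral_cong) auto
    have M1: "integrable M (\<lambda>\<omega>. (M1 \<omega>)\<^sup>2) \<and> expectation (\<lambda>\<omega>. (M1 \<omega>)\<^sup>2) \<le> K\<^sup>2 * (t - s)"
      using martingale_transform_L2[of B "T n" "G g1 n" K n] measurable_B integrable_incr_B expectation_incr_B
        expectation_incr_B_square[OF _ _ sp] T0 Tless[OF n] GF[OF cont_g1] bound_g1 Tends n st(1)
      by (simp add: M1_def b_def ind prob_space G_def)
    have M2: "integrable M (\<lambda>\<omega>. (M2 \<omega>)\<^sup>2) \<and> expectation (\<lambda>\<omega>. (M2 \<omega>)\<^sup>2) \<le> K\<^sup>2 * (t - s)"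
      using martingale_transform_L2[of C "T n" "G g2 n" K n] measurable_C integrable_incr_C expectation_incr_C
        expectation_incr_C_square[OF _ _ sp] T0 Tless[OF n] GF[OF cont_g2] bound_g2 Tends n st(1)
      by (simp add: M2_def c_def ind prob_space G_def)
    have b4: "integrable M (\<lambda>\<omega>. b n i \<omega> ^ 4)" "expectation (\<lambda>\<omega>. b n i \<omega> ^ 4) = 3 * ((t - s) / real n)\<^sup>2"
      and c4: "integrable M (\<lambda>\<omega>. c n i \<omega> ^ 4)" "expectation (\<lambda>\<omega>. c n i \<omega> ^ 4) = 3 * ((t - s) / real n)\<^sup>2" for i
      unfolding b_def c_def using integrable_incr_B[OF T0 Tless[OF n]] integrable_incr_C[OF T0 Tless[OF n]]
        expectation_incr_B_four[OF T0 Tless[OF n]] expectation_incr_C_four[OF T0 Tless[OF n]]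
      unfolding Tstep by auto
    have Zint: "integrable M Z"
      unfolding Z_def using b4 c4 by (intro integrable_mult_right Bochner_Integration.integrable_sum
        Bochner_Integration.integrable_add) auto
    have "expectation Z = real n * (\<Sum>i<n. 2 * (3 * ((t - s) / real n)\<^sup>2 + 3 * ((t - s) / real n)\<^sup>2))"
      unfolding Z_def using b4 c4 by (simp add: Bochner_Integration.integral_sum)
    also have "\<dots> = 12 * (t - s)\<^sup>2"
      using n by (simp add: power2_eq_square)
    finally have EZ: "expectation Z = 12 * (t - s)\<^sup>2" .
    have qZ: "(\<Sum>i<n. q i \<omega>)\<^sup>2 \<le> Z \<omega>" for \<omega>
    proof -
      have "(\<Sum>i<n. q i \<omega>)\<^sup>2 \<le> (\<Sum>i<n. (q i \<omega>)\<^sup>2) * (\<Sum>i<n. 1\<^sup>2)"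
        using Cauchy_Schwarz_ineq_sum[of "\<lambda>i. q i \<omega>" "\<lambda>_. 1" "{..<n}"] by simp
      also have "\<dots> = real n * (\<Sum>i<n. (q i \<omega>)\<^sup>2)"
        by simp
      also have "\<dots> \<le> Z \<omega>"
        unfolding Z_def
      proof (intro mult_left_mono sum_mono)
        fix i
        have "2 * (b n i \<omega>)\<^sup>2 * (c n i \<omega>)\<^sup>2 \<le> ((b n i \<omega>)\<^sup>2)\<^sup>2 + ((c n i \<omega>)\<^sup>2)\<^sup>2"
          by (rule sum_squares_bound)
        then show "(q i \<omega>)\<^sup>2 \<le> 2 * (b n i \<omega> ^ 4 + c n i \<omega> ^ 4)"
          by (simp add: q_def power2_sum power_mult[symmetric])
      qed auto
      finally show ?thesis .
    qed
    have Ub: "(U n \<omega>)\<^sup>2 \<le> 4 * (Q\<^sup>2 + (M1 \<omega>)\<^sup>2 + (M2 \<omega>)\<^sup>2 + K\<^sup>2 * Z \<omega>)" for \<omega>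
    proof -
      define \<zeta> where "\<zeta> = (\<Sum>i<n. \<psi> n i \<omega> - \<phi> n i \<omega> - (G g1 n i \<omega> * b n i \<omega> + G g2 n i \<omega> * c n i \<omega>))"
      have "\<bar>\<zeta>\<bar> \<le> (\<Sum>i<n. K * q i \<omega>)"
        unfolding \<zeta>_def by (intro order_trans[OF sum_abs] sum_mono) (simp add: \<psi>_def \<phi>_def G_def q_def taylor2)
      then have z: "\<bar>\<zeta>\<bar> \<le> K * (\<Sum>i<n. q i \<omega>)"
        by (simp add: sum_distrib_left)
      have z2: "\<zeta>\<^sup>2 \<le> K\<^sup>2 * Z \<omega>"
      proof -
        have "\<zeta>\<^sup>2 \<le> (K * (\<Sum>i<n. q i \<omega>))\<^sup>2"
          using z by (metis abs_ge_zero power2_abs power_mono)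
        also have "\<dots> = K\<^sup>2 * (\<Sum>i<n. q i \<omega>)\<^sup>2"
          by (simp add: power_mult_distrib)
        also have "\<dots> \<le> K\<^sup>2 * Z \<omega>"
          using qZ by (intro mult_left_mono) auto
        finally show ?thesis .
      qed
      define P where "P = \<phi> n n \<omega> - \<phi> n 0 \<omega> + (\<Sum>i<n. (t - s) / real n * G half_trace n i \<omega>) - \<theta> * (t - s)"
      \<comment> \<open>Telescoping removes the drift from the expression: what remains is bounded
        (P), a discrete stochastic integral against B or C (M1, M2), or a second-order Taylor
        remainder in the Brownian increments (\<zeta>).\<close>
      have U_eq: "U n \<omega> = P - M1 \<omega> - M2 \<omega> - \<zeta>"
      proof -
        have "(\<Sum>i<n. \<phi> n (Suc i) \<omega> - \<phi> n i \<omega>) = \<phi> n n \<omega> - \<phi> n 0 \<omega>"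
          by (rule sum_lessThan_telescope)
        then show ?thesis
          unfolding U_def P_def \<zeta>_def M1_def M2_def by (simp add: sum.distrib sum_subtractf)
      qed
      have P: "\<bar>P\<bar> \<le> Q"
      proof -
        have "\<bar>\<Sum>i<n. (t - s) / real n * G half_trace n i \<omega>\<bar> \<le> (\<Sum>i<n. (t - s) / real n * (3 * K))"
        proof (intro order_trans[OF sum_abs] sum_mono)
          fix i
          show "\<bar>(t - s) / real n * G half_trace n i \<omega>\<bar> \<le> (t - s) / real n * (3 * K)"
            unfolding abs_mult using st bounded_half_trace by (intro mult_mono) (auto simp: G_def)
        qed
        also have "\<dots> = 3 * K * (t - s)"
          using n by simp
        finally have "\<bar>\<Sum>i<n. (t - s) / real n * G half_trace n i \<omega>\<bar> \<le> 3 * K * (t - s)" .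
        moreover have "\<bar>\<phi> n n \<omega>\<bar> \<le> k" "\<bar>\<phi> n 0 \<omega>\<bar> \<le> k"
          by (simp_all add: \<phi>_def bounded_f)
        moreover have "\<bar>\<theta> * (t - s)\<bar> = \<bar>\<theta>\<bar> * (t - s)"
          using st by (simp add: abs_mult)
        ultimately show ?thesis
          unfolding P_def Q_def by linarith
      qed
      have "(p1 - p2 - p3 - p4)\<^sup>2 \<le> 4 * (p1\<^sup>2 + p2\<^sup>2 + p3\<^sup>2 + p4\<^sup>2)" for p1 p2 p3 p4 :: real
      proof -
        have "0 \<le> (p1 + p2)\<^sup>2 + (p1 + p3)\<^sup>2 + (p1 + p4)\<^sup>2 + (p2 - p3)\<^sup>2 + (p2 - p4)\<^sup>2 + (p3 - p4)\<^sup>2"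
          by (intro add_nonneg_nonneg) auto
        then show ?thesis
          by (simp add: power2_eq_square algebra_simps)
      qed
      from this[of P "M1 \<omega>" "M2 \<omega>" \<zeta>] have "(U n \<omega>)\<^sup>2 \<le> 4 * (P\<^sup>2 + (M1 \<omega>)\<^sup>2 + (M2 \<omega>)\<^sup>2 + \<zeta>\<^sup>2)"
        by (simp add: U_eq)
      also have "\<dots> \<le> 4 * (Q\<^sup>2 + (M1 \<omega>)\<^sup>2 + (M2 \<omega>)\<^sup>2 + K\<^sup>2 * Z \<omega>)"
        using z2 P by (intro mult_left_mono add_mono) (auto simp: abs_le_square_iff[symmetric])
      finally show ?thesis .
    qed
    have dom: "integrable M (\<lambda>\<omega>. 4 * (Q\<^sup>2 + (M1 \<omega>)\<^sup>2 + (M2 \<omega>)\<^sup>2 + K\<^sup>2 * Z \<omega>))"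
      using M1 M2 Zint by auto
    have U2: "integrable M (\<lambda>\<omega>. (U n \<omega>)\<^sup>2)"
      by (rule Bochner_Integration.integrable_bound[OF dom])
         (auto intro!: AE_I2 order_trans[OF Ub] simp del: distrib_left_numeral)
    have "expectation (\<lambda>\<omega>. (U n \<omega>)\<^sup>2) \<le> expectation (\<lambda>\<omega>. 4 * (Q\<^sup>2 + (M1 \<omega>)\<^sup>2 + (M2 \<omega>)\<^sup>2 + K\<^sup>2 * Z \<omega>))"
      by (intro integral_mono U2 dom Ub)
    also have "\<dots> = 4 * (Q\<^sup>2 + expectation (\<lambda>\<omega>. (M1 \<omega>)\<^sup>2) + expectation (\<lambda>\<omega>. (M2 \<omega>)\<^sup>2) + K\<^sup>2 * (12 * (t - s)\<^sup>2))"
      using M1 M2 Zint by (simp add: EZ prob_space)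
    also have "\<dots> \<le> L"
      unfolding L_def using M1 M2 by (intro mult_left_mono add_mono) auto
    finally show ?thesis
      using U2 by simp
  qed

  \<comment> \<open>The half-trace sum built into \<open>U\<close> is exactly what the Gaussian
    steps contribute. Their n errors 4 K h sqrt h add up to the last term, since n h = t -
    s.\<close>
  have main: "expectation (\<lambda>\<omega>. indicator A \<omega> * \<phi> n n \<omega>) - expectation (\<lambda>\<omega>. indicator A \<omega> * \<phi> n 0 \<omega>)
    \<le> expectation (\<lambda>\<omega>. indicator A \<omega> * U n \<omega>) + \<theta> * (t - s) * prob A
      + 4 * K * ((t - s) * sqrt ((t - s) / real n))" if n: "n > 0" for n
  proof -
    define h where "h = (t - s) / real n"
    define E where "E = (\<lambda>z. expectation (\<lambda>\<omega>. indicator A \<omega> * z \<omega> :: real))"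
    have step: "E (\<psi> n i) - E (\<phi> n i) \<le> h * E (G half_trace n i) + 4 * K * (h * sqrt h)" for i
    proof -
      have "A \<in> sets (F (T n i))"
        using A filtration[unfolded filtration_usual_def, THEN conjunct2, THEN conjunct1] st(1) sT[of n i] by blast
      from gaussian_step[OF T0 Tless[OF n] this]
      have "expectation (\<lambda>\<omega>. indicator A \<omega> * (\<psi> n i \<omega> - \<phi> n i \<omega>)) \<le> h * E (G half_trace n i) + 4 * K * (h * sqrt h)"
        unfolding \<psi>_def \<phi>_def b_def c_def E_def G_def Tstep h_def[symmetric] .
      then show ?thesis
        using int\<phi> int\<psi> by (simp add: E_def right_diff_distrib)
    qed
    have EU: "E (U n) + \<theta> * (t - s) * prob A = (\<Sum>i<n. E (\<phi> n (Suc i)) - E (\<psi> n i) + h * E (G half_trace n i))"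
    proof -
      have "indicator A \<omega> * U n \<omega> = (\<Sum>i<n. indicator A \<omega> * \<phi> n (Suc i) \<omega> - indicator A \<omega> * \<psi> n i \<omega>
          + h * (indicator A \<omega> * G half_trace n i \<omega>)) - \<theta> * (t - s) * indicator A \<omega>" for \<omega>
        unfolding U_def right_diff_distrib sum_distrib_left by (simp add: h_def algebra_simps)
      then have "E (U n) = expectation (\<lambda>\<omega>. (\<Sum>i<n. indicator A \<omega> * \<phi> n (Suc i) \<omega> - indicator A \<omega> * \<psi> n i \<omega>
          + h * (indicator A \<omega> * G half_trace n i \<omega>)) - \<theta> * (t - s) * indicator A \<omega>)"
        unfolding E_def by simp
      also have "\<dots> = (\<Sum>i<n. E (\<phi> n (Suc i)) - E (\<psi> n i) + h * E (G half_trace n i)) - \<theta> * (t - s) * prob A"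
        using int\<phi> int\<psi> inta by (simp add: E_def Bochner_Integration.integral_sum emeasure_eq_measure)
      finally show ?thesis by simp
    qed
    have "E (\<phi> n n) - E (\<phi> n 0) = (\<Sum>i<n. E (\<phi> n (Suc i)) - E (\<phi> n i))"
      by (rule sum_lessThan_telescope[symmetric])
    also have "\<dots> = (\<Sum>i<n. (E (\<phi> n (Suc i)) - E (\<psi> n i)) + (E (\<psi> n i) - E (\<phi> n i)))"
      by simp
    also have "\<dots> \<le> (\<Sum>i<n. (E (\<phi> n (Suc i)) - E (\<psi> n i)) + (h * E (G half_trace n i) + 4 * K * (h * sqrt h)))"
      using step by (intro sum_mono add_left_mono) auto
    also have "\<dots> = (\<Sum>i<n. E (\<phi> n (Suc i)) - E (\<psi> n i) + h * E (G half_trace n i)) + real n * (4 * K * (h * sqrt h))"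
      by (simp add: sum.distrib)
    also have "real n * (4 * K * (h * sqrt h)) = 4 * K * ((real n * h) * sqrt h)"
      by simp
    also have "real n * h = t - s"
      using n by (simp add: h_def)
    finally show ?thesis
      unfolding EU[symmetric] by (simp add: E_def h_def)
  qed

  have "expectation (\<lambda>\<omega>. indicator A \<omega> * f (X t \<omega>) (Y t \<omega>)) - expectation (\<lambda>\<omega>. indicator A \<omega> * f (X s \<omega>) (Y s \<omega>))
    \<le> \<theta> * (t - s) * prob A + e" if e: "e > 0" for e
  proof -
    have ev1: "eventually (\<lambda>n. expectation (\<lambda>\<omega>. indicator A \<omega> * U n \<omega>) \<le> e / 2) sequentially"
      by (rule expectation_eventually_le_of_L2_bounded[OF Um AM _ lim, of L])
         (use e sq in \<open>auto intro!: eventually_sequentiallyI[of 1]\<close>)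
    have "(\<lambda>n. 4 * K * ((t - s) * sqrt ((t - s) * (1 / real n)))) \<longlonglongrightarrow> 4 * K * ((t - s) * sqrt ((t - s) * 0))"
      by (intro tendsto_intros lim_1_over_n)
    then have "eventually (\<lambda>n. 4 * K * ((t - s) * sqrt ((t - s) / real n)) < e / 2) sequentially"
      using e by (intro order_tendstoD(2)) auto
    with ev1 eventually_gt_at_top[of 0] have "eventually (\<lambda>n. n > 0 \<and> expectation (\<lambda>\<omega>. indicator A \<omega> * U n \<omega>) \<le> e / 2 \<and>
        4 * K * ((t - s) * sqrt ((t - s) / real n)) < e / 2) sequentially"
      by eventually_elim auto
    then obtain n :: nat where n: "n > 0" "expectation (\<lambda>\<omega>. indicator A \<omega> * U n \<omega>) \<le> e / 2"
        "4 * K * ((t - s) * sqrt ((t - s) / real n)) < e / 2"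
      by (auto dest: eventually_happens)
    have ends: "\<phi> n n = (\<lambda>\<omega>. f (X t \<omega>) (Y t \<omega>))" "\<phi> n 0 = (\<lambda>\<omega>. f (X s \<omega>) (Y s \<omega>))"
      by (simp_all only: \<phi>_def Tends(1) Tends(2)[OF n(1)])
    show ?thesis
      using main[OF n(1)] n(2,3) unfolding ends by linarith
  qed
  then have "expectation (\<lambda>\<omega>. indicator A \<omega> * f (X t \<omega>) (Y t \<omega>)) - expectation (\<lambda>\<omega>. indicator A \<omega> * f (X s \<omega>) (Y s \<omega>))
    \<le> \<theta> * (t - s) * prob A"
    by (rule field_le_epsilon)
  then show ?thesis
    by linarith
qed

end

section \<open>Avoiding the corner\<close>

text \<open>No measurability of \<open>P\<close> is assumed, so it is enclosed in events. This suits
  hitting statements, which quantify over uncountably many times.\<close>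

lemma (in prob_space) AE_not_of_small_covers:
  assumes "\<And>e. e > 0 \<Longrightarrow> \<exists>Z\<in>events. prob Z \<le> e \<and> (AE \<omega> in M. P \<omega> \<longrightarrow> \<omega> \<in> Z)"
  shows "AE \<omega> in M. \<not> P \<omega>"
proof -
  have "\<exists>Z. Z \<in> events \<and> prob Z \<le> 1 / real (Suc j) \<and> (AE \<omega> in M. P \<omega> \<longrightarrow> \<omega> \<in> Z)" for j
    using assms[of "1 / real (Suc j)"] by auto
  then obtain Z where Z: "\<And>j. Z j \<in> events" "\<And>j. prob (Z j) \<le> 1 / real (Suc j)"
      "\<And>j. AE \<omega> in M. P \<omega> \<longrightarrow> \<omega> \<in> Z j"
    by metis
  have I: "(\<Inter>j. Z j) \<in> events"
    using Z(1) by auto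
  have "prob (\<Inter>j. Z j) \<le> 0"
  proof (rule LIMSEQ_le_const)
    show "(\<lambda>j. 1 / real (Suc j)) \<longlonglongrightarrow> 0"
      by (rule LIMSEQ_Suc[OF lim_1_over_n])
    have "prob (\<Inter>j. Z j) \<le> 1 / real (Suc j)" for j
      using finite_measure_mono[of "\<Inter>j. Z j" "Z j"] Z(1,2)[of j] by (meson INF_lower UNIV_I order_trans)
    then show "\<exists>N. \<forall>n\<ge>N. prob (\<Inter>j. Z j) \<le> 1 / real (Suc n)"
      by blast
  qed
  then have "AE \<omega> in M. \<omega> \<notin> (\<Inter>j. Z j)"
    using I prob_eq_0 measure_nonneg by (metis order_antisym)
  moreover have "AE \<omega> in M. \<forall>j. P \<omega> \<longrightarrow> \<omega> \<in> Z j"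
    using Z(3) unfolding AE_all_countable by blast
  ultimately show ?thesis
    by eventually_elim auto
qed

context o2bp_test_function
begin

text \<open>\<open>N i\<close> is the part of \<open>A\<close> on which the level has not been
  reached before step i. It is known at time T i, and so is the smaller event that also step i stays
  below \<open>l\<close>; on that event the supermartingale inequality is applied.\<close>

lemma maximal_inequality_grid:
  fixes T :: "nat \<Rightarrow> real"
  assumes T: "0 \<le> T 0" "\<And>i. T i < T (Suc i)" and A: "A \<in> sets (F (T 0))"
    and nonneg: "\<And>x y. f x y \<ge> 0" and th: "\<theta> \<ge> 0" and l: "l > 0"
  shows "l * prob {\<omega> \<in> A. \<exists>j<n. f (X (T j) \<omega>) (Y (T j) \<omega>) \<ge> l}
    \<le> expectation (\<lambda>\<omega>. indicator A \<omega> * f (X (T 0) \<omega>) (Y (T 0) \<omega>)) + \<theta> * (T n - T 0)"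
proof -
  define S where "S = (\<lambda>i \<omega>. f (X (T i) \<omega>) (Y (T i) \<omega>))"
  define N where "N = (\<lambda>i. {\<omega> \<in> A. \<forall>j<i. S j \<omega> < l})"
  have Tmono: "T i \<le> T j" if "i \<le> j" for i j
    using T(2) that by (metis less_imp_le lift_Suc_mono_le)
  have T0: "0 \<le> T i" for i
    using T(1) Tmono[of 0 i] by simp
  have SF: "S i \<in> borel_measurable (F (T i))" for i
    unfolding S_def by (rule measurable_at_XY[OF cont_f T0])
  have Sm[measurable]: "S i \<in> borel_measurable M" for i
    by (rule measurable_filtration_M[OF T0 SF])
  have mono: "sets (F p) \<subseteq> sets (F q)" if "0 \<le> p" "p \<le> q" for p q
    using filtration[unfolded filtration_usual_def, THEN conjunct2, THEN conjunct1] that by simp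
  have NF: "N i \<in> sets (F (T i))" for i
  proof (induction i)
    case 0
    then show ?case using A by (simp add: N_def)
  next
    case (Suc i)
    have "{\<omega> \<in> space (F (T i)). S i \<omega> < l} \<in> sets (F (T i))"
      using SF[of i] by measurable
    then have "N i \<inter> {\<omega> \<in> space (F (T i)). S i \<omega> < l} \<in> sets (F (T i))"
      using Suc by auto
    also have "N i \<inter> {\<omega> \<in> space (F (T i)). S i \<omega> < l} = N (Suc i)"
      using sets.sets_into_space[OF Suc] by (auto simp: N_def less_Suc_eq)
    finally show ?case
      using mono[OF T0, of i "T (Suc i)"] T(2)[of i] by auto
  qed
  have NM[measurable]: "N i \<in> events" for i
    using filtration_event[OF T0 NF] .
  have AM: "A \<in> events"
    using filtration_event[OF T(1) A] .
  have int: "integrable M (\<lambda>\<omega>. indicator E \<omega> * S i \<omega>)" if [measurable]: "E \<in> events" for E i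
  proof (rule integrable_const_bound[where B=k])
    show "AE \<omega> in M. norm (indicator E \<omega> * S i \<omega>) \<le> k"
      using bounded_f by (intro AE_I2) (auto simp: indicator_def S_def intro: order_trans[OF abs_ge_zero])
  qed measurable
  \<comment> \<open>Optional stopping on the grid: the left side is the mean of the process replaced
    by the constant \<open>l\<close> once the level is reached. At that moment the true value is at
    least \<open>l\<close>, so the replacement only lowers the mean, and each step adds at most
    \<theta> times its length.\<close>
  have claim: "expectation (\<lambda>\<omega>. indicator (N i) \<omega> * S i \<omega>) + l * prob (A - N i)
    \<le> expectation (\<lambda>\<omega>. indicator A \<omega> * S 0 \<omega>) + \<theta> * (T i - T 0)" for i
  proof (induction i)
    case 0
    then show ?case by (simp add: N_def)
  next
    case (Suc i)
    define D where "D = N i - N (Suc i)"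
    have [measurable]: "D \<in> events"
      by (simp add: D_def)
    have Dl: "S i \<omega> \<ge> l" if "\<omega> \<in> D" for \<omega>
      using that by (auto simp: D_def N_def less_Suc_eq)
    have sub: "N (Suc i) \<subseteq> N i" "N i \<subseteq> A"
      by (auto simp: N_def)
    have "expectation (\<lambda>\<omega>. indicator (N (Suc i)) \<omega> * S (Suc i) \<omega>) \<le> expectation (\<lambda>\<omega>. indicator (N (Suc i)) \<omega> * S i \<omega>)
      + \<theta> * (T (Suc i) - T i) * prob (N (Suc i))"
    proof -
      have "N (Suc i) \<in> sets (F (T i))"
      proof -
        have "N (Suc i) = N i \<inter> {\<omega> \<in> space (F (T i)). S i \<omega> < l}"
          using sets.sets_into_space[OF NF[of i]] by (auto simp: N_def less_Suc_eq)
        moreover have "{\<omega> \<in> space (F (T i)). S i \<omega> < l} \<in> sets (F (T i))"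
          using SF[of i] by measurable
        ultimately show ?thesis
          using NF[of i] by auto
      qed
      from supermartingale_inequality[OF T0 T(2) this] show ?thesis
        unfolding S_def .
    qed
    also have "\<theta> * (T (Suc i) - T i) * prob (N (Suc i)) \<le> \<theta> * (T (Suc i) - T i) * 1"
      using th T(2)[of i] by (intro mult_left_mono) auto
    also have "expectation (\<lambda>\<omega>. indicator (N (Suc i)) \<omega> * S i \<omega>)
      = expectation (\<lambda>\<omega>. indicator (N i) \<omega> * S i \<omega>) - expectation (\<lambda>\<omega>. indicator D \<omega> * S i \<omega>)"
    proof -
      have "indicator (N (Suc i)) \<omega> * S i \<omega> = indicator (N i) \<omega> * S i \<omega> - indicator D \<omega> * S i \<omega>" for \<omega>
        using sub by (auto simp: indicator_def D_def)
      then show ?thesis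
        using int[OF NM] int[OF \<open>D \<in> events\<close>] by simp
    qed
    finally have 1: "expectation (\<lambda>\<omega>. indicator (N (Suc i)) \<omega> * S (Suc i) \<omega>)
      \<le> expectation (\<lambda>\<omega>. indicator (N i) \<omega> * S i \<omega>) - expectation (\<lambda>\<omega>. indicator D \<omega> * S i \<omega>) + \<theta> * (T (Suc i) - T i)"
      by simp
    have 2: "l * prob D \<le> expectation (\<lambda>\<omega>. indicator D \<omega> * S i \<omega>)"
    proof -
      have "expectation (\<lambda>\<omega>. l * indicator D \<omega>) \<le> expectation (\<lambda>\<omega>. indicator D \<omega> * S i \<omega>)"
        using Dl by (intro integral_mono int integrable_mult_right integrable_real_indicator)
          (auto simp: emeasure_eq_measure indicator_def)
      then show ?thesis
        by simp
    qed
    have "A - N (Suc i) = (A - N i) \<union> D"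
      using sub by (auto simp: D_def)
    then have 3: "prob (A - N (Suc i)) = prob (A - N i) + prob D"
      using finite_measure_Union[of "A - N i" D] AM by (auto simp: D_def)
    show ?case
      using 1 2 Suc unfolding 3 by (simp add: algebra_simps)
  qed
  have "0 \<le> expectation (\<lambda>\<omega>. indicator (N n) \<omega> * S n \<omega>)"
    using nonneg by (intro integral_nonneg_AE) (auto simp: S_def)
  with claim[of n] have "l * prob (A - N n) \<le> expectation (\<lambda>\<omega>. indicator A \<omega> * S 0 \<omega>) + \<theta> * (T n - T 0)"
    by linarith
  moreover have "A - N n = {\<omega> \<in> A. \<exists>j<n. S j \<omega> \<ge> l}"
    by (auto simp: N_def not_less)
  ultimately show ?thesis
    by (simp add: S_def)
qed

text \<open>If f exceeds \<open>l\<close> strictly at some time, uniform continuity leaves f at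
  least \<open>l\<close> at a neighbouring grid point for every sufficiently fine grid. The hitting
  set thus lies in the lower limit of the grid events, and the uniform bound on their probabilities
  passes to the increasing union \<open>\<Union>m. D m\<close>.\<close>

lemma hitting_cover:
  assumes st: "0 \<le> s" "s < t" and A: "A \<in> sets (F s)"
    and nonneg: "\<And>x y. f x y \<ge> 0" and th: "\<theta> \<ge> 0" and l: "l > 0"
    and start: "\<And>\<omega>. \<omega> \<in> A \<Longrightarrow> f (X s \<omega>) (Y s \<omega>) \<le> r" and r: "r \<ge> 0"
  shows "\<exists>Z\<in>events. prob Z \<le> (r + 2 * \<theta> * (t - s)) / l \<and>
    (AE \<omega> in M. \<omega> \<in> A \<and> (\<exists>u\<in>{s..t}. f (X u \<omega>) (Y u \<omega>) > l) \<longrightarrow> \<omega> \<in> Z)"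
proof -
  define T where "T = (\<lambda>n i. s + real i * ((t - s) / real (Suc n)))"
  \<comment> \<open>The grid has Suc n cells, and the indices below Suc (Suc n) include the right
    endpoint t. The shift by one avoids an empty partition.\<close>
  define E where "E = (\<lambda>n. {\<omega> \<in> A. \<exists>j<Suc (Suc n). f (X (T n j) \<omega>) (Y (T n j) \<omega>) \<ge> l})"
  define D where "D = (\<lambda>m. \<Inter>n\<in>{m..}. E n)"
  have h: "(t - s) / real (Suc n) > 0" for n
    using st by simp
  have T0: "0 \<le> T n i" for n i
    using st h[of n] by (auto simp: T_def intro!: add_nonneg_nonneg mult_nonneg_nonneg simp del: of_nat_Suc)
  have Tless: "T n i < T n (Suc i)" for n i
    using h[of n] by (simp add: T_def distrib_right add_divide_distrib)
  have Tstart: "T n 0 = s" for n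
    by (simp add: T_def)
  have AM: "A \<in> events"
    using filtration_event[OF st(1) A] .
  have Em: "E n \<in> events" for n
  proof -
    have m: "(\<lambda>\<omega>. f (X (T n j) \<omega>) (Y (T n j) \<omega>)) \<in> borel_measurable M" for j
      by (rule measurable_filtration_M[OF T0 measurable_at_XY[OF cont_f T0]])
    have "E n = A \<inter> (\<Union>j\<in>{..<Suc (Suc n)}. {\<omega> \<in> space M. f (X (T n j) \<omega>) (Y (T n j) \<omega>) \<ge> l})"
      using sets.sets_into_space[OF AM] by (auto simp: E_def)
    also have "\<dots> \<in> events"
      using AM m by (intro sets.Int sets.finite_UN) auto
    finally show ?thesis .
  qed
  have PE: "prob (E n) \<le> (r + 2 * \<theta> * (t - s)) / l" for n
  proof -
    have "l * prob (E n) \<le> expectation (\<lambda>\<omega>. indicator A \<omega> * f (X (T n 0) \<omega>) (Y (T n 0) \<omega>)) + \<theta> * (T n (Suc (Suc n)) - T n 0)"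
      unfolding E_def by (rule maximal_inequality_grid[of "T n", OF T0 Tless _ nonneg th l]) (use A Tstart in auto)
    also have "expectation (\<lambda>\<omega>. indicator A \<omega> * f (X (T n 0) \<omega>) (Y (T n 0) \<omega>)) \<le> r"
    proof (rule integral_le_const)
      have [measurable]: "(\<lambda>\<omega>. f (X (T n 0) \<omega>) (Y (T n 0) \<omega>)) \<in> borel_measurable M"
        by (rule measurable_filtration_M[OF T0 measurable_at_XY[OF cont_f T0]])
      note [measurable] = AM
      show "integrable M (\<lambda>\<omega>. indicator A \<omega> * f (X (T n 0) \<omega>) (Y (T n 0) \<omega>))"
      proof (rule integrable_const_bound[where B=k])
        show "AE \<omega> in M. norm (indicator A \<omega> * f (X (T n 0) \<omega>) (Y (T n 0) \<omega>)) \<le> k"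
          using bounded_f by (intro AE_I2) (auto simp: indicator_def intro: order_trans[OF abs_ge_zero])
      qed measurable
      show "AE \<omega> in M. indicator A \<omega> * f (X (T n 0) \<omega>) (Y (T n 0) \<omega>) \<le> r"
        using start r by (intro AE_I2) (auto simp: indicator_def Tstart)
    qed
    \<comment> \<open>The maximal inequality runs to the grid time after its last tested one, which
      here lies one cell beyond t. At worst, for a single cell, this doubles the length, hence the
      factor 2 in the statement.\<close>
    also have "\<theta> * (T n (Suc (Suc n)) - T n 0) \<le> \<theta> * (2 * (t - s))"
    proof (intro mult_left_mono th)
      have "T n (Suc (Suc n)) - T n 0 = (t - s) * (real (Suc (Suc n)) / real (Suc n))"
        by (simp add: T_def)
      also have "\<dots> \<le> (t - s) * 2"
        using st by (intro mult_left_mono) (auto simp: field_simps)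
      finally show "T n (Suc (Suc n)) - T n 0 \<le> 2 * (t - s)"
        by simp
    qed
    finally show ?thesis
      using l by (simp add: field_simps)
  qed
  have Dm: "D m \<in> events" for m
    unfolding D_def using Em by (intro sets.countable_INT) auto
  have PD: "prob (D m) \<le> (r + 2 * \<theta> * (t - s)) / l" for m
    using finite_measure_mono[OF _ Em[of m], of "D m"] PE[of m] by (force simp: D_def)
  have "incseq D"
    unfolding D_def by (auto simp: incseq_def)
  then have "(\<lambda>m. prob (D m)) \<longlonglongrightarrow> prob (\<Union>m. D m)"
    using Dm by (intro finite_Lim_measure_incseq) auto
  then have PZ: "prob (\<Union>m. D m) \<le> (r + 2 * \<theta> * (t - s)) / l"
    by (rule LIMSEQ_le_const2) (use PD in auto)
  have "AE \<omega> in M. \<omega> \<in> A \<and> (\<exists>u\<in>{s..t}. f (X u \<omega>) (Y u \<omega>) > l) \<longrightarrow> \<omega> \<in> (\<Union>m. D m)"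
    using paths
  proof eventually_elim
    case (elim \<omega>)
    show ?case
    proof (intro impI, elim conjE bexE)
      fix u assume \<omega>: "\<omega> \<in> A" and u: "u \<in> {s..t}" and fu: "l < f (X u \<omega>) (Y u \<omega>)"
      define z where "z = (\<lambda>u. f (X u \<omega>) (Y u \<omega>))"
      have sub: "{s..t} \<subseteq> {0..}"
        using st by auto
      have "continuous_on {s..t} (\<lambda>u. (X u \<omega>, Y u \<omega>))"
        using o2bp_pathD(1,2)[OF elim] sub by (auto intro!: continuous_on_Pair intro: continuous_on_subset)
      from continuous_on_compose2[OF cont_f this] have cz: "continuous_on {s..t} z"
        by (simp add: z_def)
      have zl: "z u - l > 0"
        using fu by (simp add: z_def)
      from uniformly_continuous_eventually_grid[OF cz st(2) this] obtain m where m: "\<And>n. n \<ge> m \<Longrightarrow> \<forall>i<n. \<forall>v\<in>{s + real i * ((t - s) / real n)..s + real (Suc i) * ((t - s) / real n)}.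
          \<bar>z v - z (s + real i * ((t - s) / real n))\<bar> \<le> z u - l"
        unfolding eventually_sequentially by blast
      have "\<omega> \<in> E n" if n: "n \<ge> m" for n
      proof -
        define H where "H = (t - s) / real (Suc n)"
        have H: "H > 0" "real (Suc n) * H = t - s"
          using st by (auto simp: H_def simp del: of_nat_Suc)
        \<comment> \<open>The grid point to the left of u. The index reaches Suc n only if u = t,
          where the grid point coincides with u and no oscillation estimate is needed.\<close>
        define i where "i = nat \<lfloor>(u - s) / H\<rfloor>"
        have "0 \<le> (u - s) / H"
          using u H by auto
        then have i: "real i \<le> (u - s) / H" "(u - s) / H < real i + 1"
          unfolding i_def by (auto simp: of_nat_nat)
        then have iu: "s + real i * H \<le> u" "u < s + real (Suc i) * H"
          using H by (auto simp: field_simps)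
        have "(u - s) / H \<le> real (Suc n)"
          using u H by (simp add: field_simps)
        then have "i \<le> Suc n"
          using i(1) by linarith
        then consider "i < Suc n" | "i = Suc n"
          by linarith
        then have "z (T n i) \<ge> l"
        proof cases
          case 1
          have "u \<in> {s + real i * H..s + real (Suc i) * H}"
            using iu by auto
          with m[of "Suc n"] n 1 have "\<bar>z u - z (s + real i * H)\<bar> \<le> z u - l"
            unfolding H_def by (meson le_SucI)
          then show ?thesis
            by (simp add: T_def H_def)
        next
          case 2
          then have "T n i = t"
            using H(2) by (simp add: T_def H_def)
          moreover have "u = t"
            using iu(1) u H(2) 2 by auto
          ultimately show ?thesis
            using zl by simp
        qed
        moreover have "i < Suc (Suc n)"
          using \<open>i \<le> Suc n\<close> by simp
        ultimately show ?thesis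
          using \<omega> by (auto simp: E_def z_def)
      qed
      then show "\<omega> \<in> (\<Union>m. D m)"
        by (auto simp: D_def)
    qed
  qed
  then show ?thesis
    using PZ Dm by blast
qed

end


text \<open>The difference equals ln (1 + 1/(n + eps)), decreasing in n + eps. The second bound
  makes f bounded for fixed eps; the third is free of eps and controls the starting value away from
  the corner.\<close>

lemma log_ratio_bounds:
  fixes n \<epsilon> :: real
  assumes n: "n \<ge> 0" and e: "\<epsilon> > 0"
  shows "0 \<le> (ln (n + (1 + \<epsilon>)) - ln (n + \<epsilon>)) / 2"
    and "(ln (n + (1 + \<epsilon>)) - ln (n + \<epsilon>)) / 2 \<le> ln (1 + 1 / \<epsilon>) / 2"
    and "n > 0 \<Longrightarrow> (ln (n + (1 + \<epsilon>)) - ln (n + \<epsilon>)) / 2 \<le> ln (1 + 1 / n) / 2"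
proof -
  have eq: "ln (n + (1 + \<epsilon>)) - ln (n + \<epsilon>) = ln (1 + 1 / (n + \<epsilon>))"
  proof -
    have "1 + 1 / (n + \<epsilon>) = (n + (1 + \<epsilon>)) / (n + \<epsilon>)"
      using n e by (simp add: field_simps)
    then show ?thesis
      using n e by (simp add: ln_div)
  qed
  show "0 \<le> (ln (n + (1 + \<epsilon>)) - ln (n + \<epsilon>)) / 2"
    unfolding eq using n e by simp
  have le: "ln (1 + 1 / (n + \<epsilon>)) \<le> ln (1 + 1 / m)" if "0 < m" "m \<le> n + \<epsilon>" for m
    using that n e by (subst ln_le_cancel_iff) (auto intro!: divide_left_mono add_pos_pos)
  show "(ln (n + (1 + \<epsilon>)) - ln (n + \<epsilon>)) / 2 \<le> ln (1 + 1 / \<epsilon>) / 2"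
    unfolding eq using le[of \<epsilon>] n e by simp
  show "n > 0 \<Longrightarrow> (ln (n + (1 + \<epsilon>)) - ln (n + \<epsilon>)) / 2 \<le> ln (1 + 1 / n) / 2"
    unfolding eq using le[of n] e by simp
qed

section \<open>From the maximal inequality to almost sure avoidance of the corner\<close>

context brownian_pair
begin

text \<open>On the event |V_s|^2 >= \<kappa> the starting value of f is at most \<open>r\<close>,
  uniformly in eps, whereas f at the corner grows without bound as eps tends to 0. The maximal
  inequality with a high level \<open>W\<close> then makes the probability of reaching the corner as
  small as desired.\<close>

lemma AE_no_corner_after:
  fixes c1 c2 :: "'b::euclidean_space" and X Y :: "real \<Rightarrow> 'a \<Rightarrow> real" and \<alpha> \<beta> \<gamma> \<delta> \<theta> \<kappa> :: real
  defines "v \<equiv> \<lambda>x y. x *\<^sub>R c1 + y *\<^sub>R c2"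
  assumes aX: "adapted F X" and aY: "adapted F Y"
    and paths: "AE \<omega> in M. o2bp_path \<alpha> \<beta> \<gamma> \<delta> (\<lambda>t. B t \<omega>) (\<lambda>t. C t \<omega>) (\<lambda>t. X t \<omega>) (\<lambda>t. Y t \<omega>)"
    and th: "\<theta> \<ge> 0"
    and disp: "\<And>x y. x > 0 \<Longrightarrow> y > 0 \<Longrightarrow>
      (v x y \<bullet> c1)\<^sup>2 + 2 * \<rho> * ((v x y \<bullet> c1) * (v x y \<bullet> c2)) + (v x y \<bullet> c2)\<^sup>2 \<le> \<theta> * (v x y \<bullet> v x y)"
    and drift: "\<And>x y. x > 0 \<Longrightarrow> y > 0 \<Longrightarrow>
      2 * ((v x y \<bullet> c1) * (\<alpha> / x + \<beta> / y) + (v x y \<bullet> c2) * (\<gamma> / x + \<delta> / y))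
        + (c1 \<bullet> c1 + 2 * \<rho> * (c1 \<bullet> c2) + c2 \<bullet> c2) \<ge> 2 * \<theta>"
    and st: "0 \<le> s" "s < t" and k: "\<kappa> > 0"
  shows "AE \<omega> in M. \<not> (v (X s \<omega>) (Y s \<omega>) \<bullet> v (X s \<omega>) (Y s \<omega>) \<ge> \<kappa> \<and> (\<exists>u\<in>{s..t}. X u \<omega> = 0 \<and> Y u \<omega> = 0))"
proof (rule AE_not_of_small_covers)
  fix e :: real assume e: "e > 0"
  define A where "A = {\<omega> \<in> space M. v (X s \<omega>) (Y s \<omega>) \<bullet> v (X s \<omega>) (Y s \<omega>) \<ge> \<kappa>}"
  have spF: "space (F s) = space M"
    using subalgebra_filtration[OF st(1)] by (simp add: subalgebra_def)
  have [measurable]: "X s \<in> borel_measurable (F s)" "Y s \<in> borel_measurable (F s)"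
    using aX aY st by (auto simp: adapted_def)
  have A: "A \<in> sets (F s)"
    unfolding A_def spF[symmetric] v_def by measurable
  define r where "r = ln (1 + 1 / \<kappa>) / 2"
  have r: "r \<ge> 0"
    using k by (simp add: r_def)
  \<comment> \<open>The level is chosen to make (r + 2 \<theta> (t - s)) / W at most
    \<open>e\<close>; the added 1 keeps it positive even when the numerator vanishes.\<close>
  define W where "W = (r + 2 * \<theta> * (t - s)) / e + 1"
  have W: "W > 0"
    using r th st e by (auto simp: W_def intro!: add_nonneg_pos divide_nonneg_nonneg)
  \<comment> \<open>With this choice f at the corner is (ln (1 + \<epsilon>) + 2 W) / 2, strictly
    above the level, as \<open>hitting_cover\<close> demands.\<close>
  define \<epsilon> where "\<epsilon> = exp (- (2 * W))"
  have eps: "\<epsilon> > 0"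
    by (simp add: \<epsilon>_def)
  define f where "f = (\<lambda>x y. (ln (v x y \<bullet> v x y + (1 + \<epsilon>)) - ln (v x y \<bullet> v x y + \<epsilon>)) / 2)"
  obtain g1 g2 h11 h12 h22 K where test: "test_function f g1 g2 h11 h12 h22 K"
    and gen: "\<forall>x>0. \<forall>y>0. g1 x y * (\<alpha> / x + \<beta> / y) + g2 x y * (\<gamma> / x + \<delta> / y)
       + (h11 x y + \<rho> * h12 x y + h22 x y) \<le> \<theta>"
    using log_ratio_test_function[of \<epsilon> \<theta> c1 c2 \<rho> \<alpha> \<beta> \<gamma> \<delta>, OF eps th disp[unfolded v_def] drift[unfolded v_def]]
    unfolding f_def v_def by blast
  have f0: "f x y \<ge> 0" for x y
    unfolding f_def by (rule log_ratio_bounds(1)[OF _ eps]) simp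
  have fb: "f x y \<le> ln (1 + 1 / \<epsilon>) / 2" for x y
    unfolding f_def by (rule log_ratio_bounds(2)[OF _ eps]) simp
  interpret P: o2bp_test_function M F \<rho> B C f g1 g2 h11 h12 h22 K X Y \<alpha> \<beta> \<gamma> \<delta> \<theta> "ln (1 + 1 / \<epsilon>) / 2"
  proof (intro o2bp_test_function.intro o2bp_test_function_axioms.intro)
    show "\<bar>f x y\<bar> \<le> ln (1 + 1 / \<epsilon>) / 2" for x y
      using f0[of x y] fb[of x y] by simp
  qed (use brownian_pair_axioms test aX aY paths gen in auto)
  have start: "f (X s \<omega>) (Y s \<omega>) \<le> r" if "\<omega> \<in> A" for \<omega>
  proof -
    define n where "n = v (X s \<omega>) (Y s \<omega>) \<bullet> v (X s \<omega>) (Y s \<omega>)"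
    have n: "n \<ge> \<kappa>"
      using that by (simp add: A_def n_def)
    then have "f (X s \<omega>) (Y s \<omega>) \<le> ln (1 + 1 / n) / 2"
      unfolding f_def n_def[symmetric] by (intro log_ratio_bounds(3)[OF _ eps]) (use k in auto)
    also have "\<dots> \<le> r"
    proof -
      have "1 / n \<le> 1 / \<kappa>"
        using n k by (intro divide_left_mono) auto
      moreover have "0 < 1 / n"
        using n k by simp
      ultimately have "ln (1 + 1 / n) \<le> ln (1 + 1 / \<kappa>)"
        by (subst ln_le_cancel_iff) linarith+
      then show ?thesis
        unfolding r_def by simp
    qed
    finally show ?thesis .
  qed
  have corner: "f 0 0 > W"
  proof -
    have "f 0 0 = (ln (1 + \<epsilon>) + 2 * W) / 2"
      by (simp add: f_def v_def \<epsilon>_def)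
    moreover have "ln (1 + \<epsilon>) > 0"
      using eps by simp
    ultimately show ?thesis
      by simp
  qed
  obtain Z where Z: "Z \<in> events" "prob Z \<le> (r + 2 * \<theta> * (t - s)) / W"
    and cover: "AE \<omega> in M. \<omega> \<in> A \<and> (\<exists>u\<in>{s..t}. f (X u \<omega>) (Y u \<omega>) > W) \<longrightarrow> \<omega> \<in> Z"
    using P.hitting_cover[OF st A f0 th W start r] by blast
  have "(r + 2 * \<theta> * (t - s)) / W \<le> e"
    using W e by (simp add: W_def field_simps)
  moreover have "AE \<omega> in M. (v (X s \<omega>) (Y s \<omega>) \<bullet> v (X s \<omega>) (Y s \<omega>) \<ge> \<kappa> \<and> (\<exists>u\<in>{s..t}. X u \<omega> = 0 \<and> Y u \<omega> = 0)) \<longrightarrow> \<omega> \<in> Z"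
    using cover AE_space
  proof eventually_elim
    case (elim \<omega>)
    have "f (X u \<omega>) (Y u \<omega>) > W" if "X u \<omega> = 0 \<and> Y u \<omega> = 0" for u
      using corner that by simp
    then show ?case
      using elim unfolding A_def by blast
  qed
  ultimately show "\<exists>Z\<in>events. prob Z \<le> e \<and> (AE \<omega> in M.
      (v (X s \<omega>) (Y s \<omega>) \<bullet> v (X s \<omega>) (Y s \<omega>) \<ge> \<kappa> \<and> (\<exists>u\<in>{s..t}. X u \<omega> = 0 \<and> Y u \<omega> = 0)) \<longrightarrow> \<omega> \<in> Z)"
    using Z by (intro bexI[of _ Z]) auto
qed

text \<open>The exceptional sets of \<open>AE_no_corner_after\<close> are collected over rational
  starting times s, integer horizons n and thresholds 1/(m + 1), a countable family. Any visit to
  the corner at a positive time falls under one of them, even when the process starts in the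
  corner.\<close>

lemma AE_no_corner:
  fixes c1 c2 :: "'b::euclidean_space" and X Y :: "real \<Rightarrow> 'a \<Rightarrow> real" and \<alpha> \<beta> \<gamma> \<delta> \<theta> :: real
  defines "v \<equiv> \<lambda>x y. x *\<^sub>R c1 + y *\<^sub>R c2"
  assumes aX: "adapted F X" and aY: "adapted F Y"
    and paths: "AE \<omega> in M. o2bp_path \<alpha> \<beta> \<gamma> \<delta> (\<lambda>t. B t \<omega>) (\<lambda>t. C t \<omega>) (\<lambda>t. X t \<omega>) (\<lambda>t. Y t \<omega>)"
    and th: "\<theta> \<ge> 0"
    and disp: "\<And>x y. x > 0 \<Longrightarrow> y > 0 \<Longrightarrow>
      (v x y \<bullet> c1)\<^sup>2 + 2 * \<rho> * ((v x y \<bullet> c1) * (v x y \<bullet> c2)) + (v x y \<bullet> c2)\<^sup>2 \<le> \<theta> * (v x y \<bullet> v x y)"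
    and drift: "\<And>x y. x > 0 \<Longrightarrow> y > 0 \<Longrightarrow>
      2 * ((v x y \<bullet> c1) * (\<alpha> / x + \<beta> / y) + (v x y \<bullet> c2) * (\<gamma> / x + \<delta> / y))
        + (c1 \<bullet> c1 + 2 * \<rho> * (c1 \<bullet> c2) + c2 \<bullet> c2) \<ge> 2 * \<theta>"
    and nz: "\<And>x y. x > 0 \<Longrightarrow> y > 0 \<Longrightarrow> v x y \<noteq> 0"
  shows "AE \<omega> in M. \<forall>t>0. \<not> (X t \<omega> = 0 \<and> Y t \<omega> = 0)"
proof -
  have "AE \<omega> in M. \<forall>s::rat. \<forall>n m :: nat. 0 \<le> real_of_rat s \<and> real_of_rat s < real n \<longrightarrow>
    \<not> (v (X (real_of_rat s) \<omega>) (Y (real_of_rat s) \<omega>) \<bullet> v (X (real_of_rat s) \<omega>) (Y (real_of_rat s) \<omega>) \<ge> 1 / real (Suc m)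
      \<and> (\<exists>u\<in>{real_of_rat s..real n}. X u \<omega> = 0 \<and> Y u \<omega> = 0))"
    unfolding AE_all_countable
  proof (intro allI)
    fix s :: rat and n m :: nat
    show "AE \<omega> in M. 0 \<le> real_of_rat s \<and> real_of_rat s < real n \<longrightarrow>
    \<not> (v (X (real_of_rat s) \<omega>) (Y (real_of_rat s) \<omega>) \<bullet> v (X (real_of_rat s) \<omega>) (Y (real_of_rat s) \<omega>) \<ge> 1 / real (Suc m)
      \<and> (\<exists>u\<in>{real_of_rat s..real n}. X u \<omega> = 0 \<and> Y u \<omega> = 0))"
    proof (cases "0 \<le> real_of_rat s \<and> real_of_rat s < real n")
      case True
      then have s: "0 \<le> real_of_rat s" "real_of_rat s < real n"
        by auto
      show ?thesis
        using AE_no_corner_after[where s="real_of_rat s" and t="real n" and \<kappa>="1 / real (Suc m)",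
          OF aX aY paths th disp[unfolded v_def] drift[unfolded v_def] s]
        unfolding v_def by simp
    next
      case False
      then show ?thesis by (intro AE_I2) blast
    qed
  qed
  with paths show ?thesis
  proof eventually_elim
    case (elim \<omega>)
    show ?case
    proof (intro allI impI notI)
      fix t :: real assume t: "t > 0" and zero: "X t \<omega> = 0 \<and> Y t \<omega> = 0"
      have cx: "continuous_on {0..} (\<lambda>u. X u \<omega>)" and cy: "continuous_on {0..} (\<lambda>u. Y u \<omega>)"
        using o2bp_pathD(1,2)[OF elim(1)] by auto
      \<comment> \<open>An open set of times before the visit with both coordinates positive. It is
        nonempty because the path is off the axes at almost every time, so it contains a rational
        time, at which V is nonzero by \<open>nz\<close>.\<close>
      define U where "U = {u \<in> {0<..<t}. X u \<omega> > 0} \<inter> {u \<in> {0<..<t}. Y u \<omega> > 0}"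
      have "open U"
        unfolding U_def
      proof (intro open_Int)
        have op: "open {u \<in> {0<..<t}. z u > 0}" if "continuous_on {0..} z" for z :: "real \<Rightarrow> real"
        proof -
          have "continuous_on {0<..<t} z"
            by (rule continuous_on_subset[OF that]) auto
          from continuous_open_preimage[OF this, of "{0<..}"] show ?thesis
            by (simp add: vimage_def Int_def)
        qed
        show "open {u \<in> {0<..<t}. X u \<omega> > 0}" "open {u \<in> {0<..<t}. Y u \<omega> > 0}"
          by (rule op[OF cx], rule op[OF cy])
      qed
      moreover have "U \<noteq> {}"
      proof
        assume "U = {}"
        have "AE u in lborel. u \<notin> {0<..<t}"
          using o2bp_path_AE_pos[OF elim(1) less_imp_le[OF t]]
        proof eventually_elim
          case (elim u)
          then show ?case
            using \<open>U = {}\<close> by (auto simp: U_def)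
        qed
        then have "emeasure lborel {0<..<t} = 0"
          by (subst (asm) AE_iff_measurable[where N="{0<..<t}"]) auto
        then show False
          using t by simp
      qed
      ultimately obtain x d where x: "x \<in> U" and d: "d > 0" "\<And>y. \<bar>y - x\<bar> < d \<Longrightarrow> y \<in> U"
        by (metis all_not_in_conv open_real)
      obtain s where s: "s \<in> \<rat>" "x < s" "s < x + d"
        using Rats_dense_in_real[of x "x + d"] d by auto
      then obtain q where q: "s = real_of_rat q"
        by (auto simp: Rats_def)
      have sU: "s \<in> U"
        using s d by auto
      have "v (X s \<omega>) (Y s \<omega>) \<noteq> 0"
        using sU by (intro nz) (auto simp: U_def)
      then have "v (X s \<omega>) (Y s \<omega>) \<bullet> v (X s \<omega>) (Y s \<omega>) > 0"
        by simp
      then obtain m :: nat where m: "1 / real (Suc m) < v (X s \<omega>) (Y s \<omega>) \<bullet> v (X s \<omega>) (Y s \<omega>)"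
        using nat_approx_posE by blast
      obtain n :: nat where n: "t < real n"
        using reals_Archimedean2 by blast
      have "0 \<le> s" "s < real n" "t \<in> {s..real n}"
        using sU n by (auto simp: U_def)
      then show False
        using elim(2)[rule_format, of q n m] m zero unfolding q[symmetric] by auto
    qed
  qed
qed

end

section \<open>Verification of the parameter conditions\<close>

lemma corner_time_eq_infinity:
  assumes "\<forall>t>0. \<not> (X t \<omega> = 0 \<and> Y t \<omega> = 0)"
  shows "corner_time X Y \<omega> = \<infinity>"
proof -
  have "{ereal t |t. t > 0 \<and> X t \<omega> = 0 \<and> Y t \<omega> = 0} = {}"
    using assms by auto
  then show ?thesis
    unfolding corner_time_def by (simp only: Inf_empty top_ereal_def)
qed

text \<open>After expansion the right side depends on x and y only through r = x/y and equals la p +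
  mu q + la q r + mu p / r; the arithmetic-geometric mean inequality bounds the last two terms. For
  positive constants the bound is the minimum over r, which is the origin of the squared sum of
  roots in condition C3.\<close>

lemma linear_drift_ge:
  fixes x y p q la mu :: real
  assumes "x > 0" "y > 0" "la \<ge> 0" "mu \<ge> 0" "p \<ge> 0" "q \<ge> 0"
  shows "(sqrt (la * p) + sqrt (mu * q))\<^sup>2 \<le> (la * x + mu * y) * (p / x + q / y)"
proof -
  define r where "r = x / y"
  have r: "r > 0"
    using assms by (simp add: r_def)
  have sq: "sqrt (la * p) * sqrt (mu * q) = sqrt (la * q * r) * sqrt (mu * p / r)"
    using r by (simp add: real_sqrt_mult[symmetric] ac_simps)
  have "2 * sqrt (la * q * r) * sqrt (mu * p / r) \<le> (sqrt (la * q * r))\<^sup>2 + (sqrt (mu * p / r))\<^sup>2"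
    by (rule sum_squares_bound)
  also have "\<dots> = la * q * r + mu * p / r"
    using assms r by simp
  finally have "2 * sqrt (la * p) * sqrt (mu * q) \<le> la * q * r + mu * p / r"
    using sq by (simp add: mult.assoc)
  then have "(sqrt (la * p) + sqrt (mu * q))\<^sup>2 \<le> la * p + mu * q + (la * q * r + mu * p / r)"
    using assms by (simp add: power2_sum)
  also have "\<dots> = (la * x + mu * y) * (p / x + q / y)"
    using assms by (simp add: r_def field_simps)
  finally show ?thesis .
qed

text \<open>Here V = la X + mu Y is scalar and \<theta> is the variance rate of la B + mu C, so the
  dispersion hypothesis is an equality. The drift hypothesis reduces to V times its drift being at
  least \<theta> / 2, the Bessel condition of dimension at least 2. One weight may vanish, so C2a
  and C2b are included.\<close>

lemma (in brownian_pair) AE_no_corner_linear: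
  fixes X Y :: "real \<Rightarrow> 'a \<Rightarrow> real" and \<alpha> \<beta> \<gamma> \<delta> la mu :: real
  assumes aX: "adapted F X" and aY: "adapted F Y"
    and paths: "AE \<omega> in M. o2bp_path \<alpha> \<beta> \<gamma> \<delta> (\<lambda>t. B t \<omega>) (\<lambda>t. C t \<omega>) (\<lambda>t. X t \<omega>) (\<lambda>t. Y t \<omega>)"
    and nn: "la \<ge> 0" "mu \<ge> 0" "la > 0 \<or> mu > 0"
    and p: "la * \<alpha> + mu * \<gamma> \<ge> 0" and q: "la * \<beta> + mu * \<delta> \<ge> 0"
    and cond: "(sqrt (la * (la * \<alpha> + mu * \<gamma>)) + sqrt (mu * (la * \<beta> + mu * \<delta>)))\<^sup>2
      \<ge> (la\<^sup>2 + mu\<^sup>2 + 2 * \<rho> * la * mu) / 2"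
  shows "AE \<omega> in M. \<forall>t>0. \<not> (X t \<omega> = 0 \<and> Y t \<omega> = 0)"
proof (rule AE_no_corner[where ?c1.0=la and ?c2.0=mu and \<theta>="la\<^sup>2 + mu\<^sup>2 + 2 * \<rho> * la * mu", OF aX aY paths])
  show "0 \<le> la\<^sup>2 + mu\<^sup>2 + 2 * \<rho> * la * mu"
  proof -
    have "(-1) * (2 * la * mu) \<le> \<rho> * (2 * la * mu)"
      using rho nn by (intro mult_right_mono) auto
    moreover have "0 \<le> (la - mu)\<^sup>2"
      by simp
    ultimately show ?thesis
      by (simp add: power2_eq_square algebra_simps)
  qed
  fix x y :: real assume xy: "x > 0" "y > 0"
  show "((x *\<^sub>R la + y *\<^sub>R mu) \<bullet> la)\<^sup>2 + 2 * \<rho> * (((x *\<^sub>R la + y *\<^sub>R mu) \<bullet> la) * ((x *\<^sub>R la + y *\<^sub>R mu) \<bullet> mu)) + ((x *\<^sub>R la + y *\<^sub>R mu) \<bullet> mu)\<^sup>2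
    \<le> (la\<^sup>2 + mu\<^sup>2 + 2 * \<rho> * la * mu) * ((x *\<^sub>R la + y *\<^sub>R mu) \<bullet> (x *\<^sub>R la + y *\<^sub>R mu))"
  proof -
    have "(z * la)\<^sup>2 + 2 * \<rho> * ((z * la) * (z * mu)) + (z * mu)\<^sup>2 = (la\<^sup>2 + mu\<^sup>2 + 2 * \<rho> * la * mu) * (z * z)" for z
      by (simp add: power2_eq_square algebra_simps)
    then show ?thesis
      by simp
  qed
  show "2 * (la\<^sup>2 + mu\<^sup>2 + 2 * \<rho> * la * mu) \<le> 2 * (((x *\<^sub>R la + y *\<^sub>R mu) \<bullet> la) * (\<alpha> / x + \<beta> / y)
      + ((x *\<^sub>R la + y *\<^sub>R mu) \<bullet> mu) * (\<gamma> / x + \<delta> / y)) + (la \<bullet> la + 2 * \<rho> * (la \<bullet> mu) + mu \<bullet> mu)"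
  proof -
    define z where "z = la * x + mu * y"
    have v: "x *\<^sub>R la + y *\<^sub>R mu = z"
      by (simp add: z_def)
    have "(la\<^sup>2 + mu\<^sup>2 + 2 * \<rho> * la * mu) / 2 \<le> z * ((la * \<alpha> + mu * \<gamma>) / x + (la * \<beta> + mu * \<delta>) / y)"
      using cond linear_drift_ge[OF xy nn(1,2) p q] unfolding z_def by linarith
    also have "\<dots> = (z * la) * (\<alpha> / x + \<beta> / y) + (z * mu) * (\<gamma> / x + \<delta> / y)"
      by (simp add: algebra_simps add_divide_distrib)
    finally show ?thesis
      unfolding v by (simp add: power2_eq_square algebra_simps)
  qed
  show "x *\<^sub>R la + y *\<^sub>R mu \<noteq> 0"
  proof -
    have "0 < x * la + y * mu"
      using xy nn by (auto intro: add_pos_nonneg add_nonneg_pos)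
    then show ?thesis by simp
  qed
qed

text \<open>Here V = (X, Y) and |V|^2 has drift rate at least 2 (\<alpha> + \<delta>) + 2, the cross
  terms being nonnegative. For rho >= 0 the speed 1 + rho is the larger eigenvalue of the covariance
  matrix; for rho < 0 the cross term of the dispersion is negative in the quadrant and speed 1
  suffices. This is the origin of \<open>max \<rho> 0\<close>.\<close>

lemma (in brownian_pair) AE_no_corner_radial:
  fixes X Y :: "real \<Rightarrow> 'a \<Rightarrow> real" and \<alpha> \<beta> \<gamma> \<delta> :: real
  assumes aX: "adapted F X" and aY: "adapted F Y"
    and paths: "AE \<omega> in M. o2bp_path \<alpha> \<beta> \<gamma> \<delta> (\<lambda>t. B t \<omega>) (\<lambda>t. C t \<omega>) (\<lambda>t. X t \<omega>) (\<lambda>t. Y t \<omega>)"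
    and pos: "\<alpha> > 0" "\<delta> > 0" and nn: "\<beta> \<ge> 0" "\<gamma> \<ge> 0" and le: "\<rho> \<le> \<alpha> + \<delta>"
  shows "AE \<omega> in M. \<forall>t>0. \<not> (X t \<omega> = 0 \<and> Y t \<omega> = 0)"
proof (rule AE_no_corner[where ?c1.0="(1, 0) :: real \<times> real" and ?c2.0="(0, 1)" and \<theta>="1 + max \<rho> 0", OF aX aY paths])
  fix x y :: real assume xy: "x > 0" "y > 0"
  show "((x *\<^sub>R (1, 0) + y *\<^sub>R (0, 1)) \<bullet> ((1, 0) :: real \<times> real))\<^sup>2
      + 2 * \<rho> * (((x *\<^sub>R (1, 0) + y *\<^sub>R (0, 1)) \<bullet> ((1, 0) :: real \<times> real)) * ((x *\<^sub>R (1, 0) + y *\<^sub>R (0, 1)) \<bullet> ((0, 1) :: real \<times> real)))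
      + ((x *\<^sub>R (1, 0) + y *\<^sub>R (0, 1)) \<bullet> ((0, 1) :: real \<times> real))\<^sup>2
    \<le> (1 + max \<rho> 0) * ((x *\<^sub>R (1, 0) + y *\<^sub>R (0, 1)) \<bullet> (x *\<^sub>R ((1, 0) :: real \<times> real) + y *\<^sub>R (0, 1)))"
  proof -
    have "\<rho> * (2 * x * y) \<le> max \<rho> 0 * (2 * x * y)"
      using xy by (intro mult_right_mono) auto
    also have "\<dots> \<le> max \<rho> 0 * (x\<^sup>2 + y\<^sup>2)"
      by (intro mult_left_mono sum_squares_bound) auto
    finally have "x\<^sup>2 + 2 * \<rho> * (x * y) + y\<^sup>2 \<le> (1 + max \<rho> 0) * (x\<^sup>2 + y\<^sup>2)"
      by (simp add: algebra_simps)
    then show ?thesis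
      by (simp add: power2_eq_square)
  qed
  show "2 * (1 + max \<rho> 0) \<le> 2 * (((x *\<^sub>R (1, 0) + y *\<^sub>R (0, 1)) \<bullet> ((1, 0) :: real \<times> real)) * (\<alpha> / x + \<beta> / y)
      + ((x *\<^sub>R (1, 0) + y *\<^sub>R (0, 1)) \<bullet> ((0, 1) :: real \<times> real)) * (\<gamma> / x + \<delta> / y))
      + ((1, 0) \<bullet> ((1, 0) :: real \<times> real) + 2 * \<rho> * ((1, 0) \<bullet> ((0, 1) :: real \<times> real)) + (0, 1) \<bullet> ((0, 1) :: real \<times> real))"
  proof -
    have "x * (\<alpha> / x + \<beta> / y) + y * (\<gamma> / x + \<delta> / y) = \<alpha> + \<delta> + (x * \<beta> / y + y * \<gamma> / x)"
      using xy by (simp add: field_simps)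
    moreover have "0 \<le> x * \<beta> / y + y * \<gamma> / x"
      using xy nn by (auto intro!: add_nonneg_nonneg divide_nonneg_nonneg mult_nonneg_nonneg)
    ultimately have "max \<rho> 0 \<le> x * (\<alpha> / x + \<beta> / y) + y * (\<gamma> / x + \<delta> / y)"
      using pos le by linarith
    moreover have "2 * (1 + m) \<le> 2 * z + (1 + 2 * \<rho> * 0 + 1)" if "m \<le> z" for m z
      using that by simp
    ultimately have "2 * (1 + max \<rho> 0) \<le> 2 * (x * (\<alpha> / x + \<beta> / y) + y * (\<gamma> / x + \<delta> / y)) + (1 + 2 * \<rho> * 0 + 1)"
      by blast
    then show ?thesis
      by (simp only: inner_Pair scaleR_Pair add_Pair inner_real_def real_scaleR_def
          mult_1_right mult_zero_right add_0_left add_0_right)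
  qed
  show "x *\<^sub>R ((1, 0) :: real \<times> real) + y *\<^sub>R (0, 1) \<noteq> 0"
    using xy by (simp add: zero_prod_def)
qed auto

theorem mainTheorem5:
  fixes M :: "'a measure" and F :: "real \<Rightarrow> 'a measure"
    and B C X Y :: "real \<Rightarrow> 'a \<Rightarrow> real"
    and \<alpha> \<beta> \<gamma> \<delta> \<rho> :: real
  assumes "prob_space M" and "filtration_usual M F"
    and "\<alpha> > 0" and "\<delta> > 0" and "-1 \<le> \<rho>" and "\<rho> \<le> 1"
    and "corr_brownian M F \<rho> B C"
    and "O2BP M F \<alpha> \<beta> \<gamma> \<delta> B C X Y"
    and "(\<beta> \<ge> 0 \<and> \<gamma> \<ge> 0 \<and> -1 \<le> \<rho> \<and> \<rho> \<le> \<alpha> + \<delta>)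
         \<or> (\<alpha> \<ge> 1/2 \<and> \<beta> \<ge> 0)
         \<or> (\<delta> \<ge> 1/2 \<and> \<gamma> \<ge> 0)
         \<or> (\<exists>la mu. la > 0 \<and> mu > 0 \<and> la * \<alpha> + mu * \<gamma> \<ge> 0 \<and> la * \<beta> + mu * \<delta> \<ge> 0 \<and>
              (sqrt (la * (la * \<alpha> + mu * \<gamma>)) + sqrt (mu * (la * \<beta> + mu * \<delta>)))\<^sup>2
                \<ge> (la\<^sup>2 + mu\<^sup>2 + 2 * \<rho> * la * mu) / 2)"
  shows "AE \<omega> in M. corner_time X Y \<omega> = \<infinity>"
proof -
  interpret brownian_pair M F \<rho> B C
    using assms by (simp add: brownian_pair_def brownian_pair_axioms_def)
  note o2bp = assms(8)[unfolded O2BP_def]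
  have "AE \<omega> in M. o2bp_path \<alpha> \<beta> \<gamma> \<delta> (\<lambda>t. B t \<omega>) (\<lambda>t. C t \<omega>) (\<lambda>t. X t \<omega>) (\<lambda>t. Y t \<omega>)"
    unfolding o2bp_path_def by (rule o2bp[THEN conjunct2, THEN conjunct2])
  note a = o2bp[THEN conjunct1] o2bp[THEN conjunct2, THEN conjunct1] this
  from assms(9) have "AE \<omega> in M. \<forall>t>0. \<not> (X t \<omega> = 0 \<and> Y t \<omega> = 0)"
  proof (elim disjE exE conjE)
    assume "\<beta> \<ge> 0" "\<gamma> \<ge> 0" "\<rho> \<le> \<alpha> + \<delta>"
    then show ?thesis
      by (rule AE_no_corner_radial[OF a assms(3,4)])
  next
    assume "\<alpha> \<ge> 1/2" "\<beta> \<ge> 0"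
    \<comment> \<open>With weights (1, 0) the variance rate is 1 and the condition reads \<alpha> >=
      1/2, the classical threshold for a one-dimensional Bessel process; the weights (0, 1) give the
      symmetric case.\<close>
    then show ?thesis
      by (intro AE_no_corner_linear[OF a, of 1 0]) auto
  next
    assume "\<delta> \<ge> 1/2" "\<gamma> \<ge> 0"
    then show ?thesis
      by (intro AE_no_corner_linear[OF a, of 0 1]) auto
  next
    fix la mu :: real
    assume "la > 0" "mu > 0" "la * \<alpha> + mu * \<gamma> \<ge> 0" "la * \<beta> + mu * \<delta> \<ge> 0"
      "(sqrt (la * (la * \<alpha> + mu * \<gamma>)) + sqrt (mu * (la * \<beta> + mu * \<delta>)))\<^sup>2 \<ge> (la\<^sup>2 + mu\<^sup>2 + 2 * \<rho> * la * mu) / 2"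
    then show ?thesis
      by (intro AE_no_corner_linear[OF a, of la mu]) auto
  qed
  then show ?thesis
    by eventually_elim (rule corner_time_eq_infinity)
qed

end
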